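(* For every well-pointed quandle $(Q,q)$ and every graded group $\Lambda$ we have natural graded bijections $$H^2(Q,\Lambda)\cong\mathrm{Ext}(Q,\Lambda)\cong\mathrm{Hom}(\pi_1(Q,q),\Lambda).$$ If $\Lambda$ is an abelian group, or more generally a module over some ring $R$, then these objects carry natural $R$-module structures and the bijections are isomorphisms of $R$-modules.
   Context: A quandle is a set $Q$ with two binary operations $*,\bar{*}$ such that for all $a,b,c\in Q$: $a*a=a$; $(a*b)\bar{*}b=a=(a\bar{*}b)*b$; $(a*b)*c=(a*c)*(b*c)$. A quandle homomorphism is a map preserving $*$ (hence $\bar{*}$). $\mathrm{Inn}(Q)$ is the group of automorphisms of $Q$ generated by the right translations $x\mapsto x*a$; the connected components of $Q$ are the orbits of $\mathrm{Inn}(Q)$. A well-pointed quandle $(Q,q)$ indexed by a set $I$ is a quandle $Q=\bigsqcup_{i\in I}Q_i$ where the $Q_i$ are exactly the (pairwise distinct) connected components, with a base point $q_i\in Q_i$ for each $i\in I$. A graded group is a group $\Lambda=\prod_{i\in I}\Lambda_i$ together with the groups $\Lambda_i$ (not assumed abelian) composing it as a product; a homomorphism of graded groups is a product of homomorphisms of the factors. In the module case each $\Lambda_i$ is an $R$-module. The adjoint group $\mathrm{Adj}(Q)$ is generated by symbols $\mathrm{adj}(a)$, $a\in Q$, subject to $\mathrm{adj}(a*b)=\mathrm{adj}(b)^{-1}\mathrm{adj}(a)\,\mathrm{adj}(b)$. It acts on $Q$ from the right with $a^{\mathrm{adj}(b)}=a*b$. Let $\varepsilon\colon\mathrm{Adj}(Q)\to\mathbb{Z}$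 be the homomorphism with $\varepsilon(\mathrm{adj}(a))=1$ for all $a\in Q$, and $\mathrm{Adj}(Q)^\circ=\ker\varepsilon$. Set $\pi_1(Q,q_i)=\{g\in\mathrm{Adj}(Q)^\circ\mid q_i^g=q_i\}$ and let $\pi_1(Q,q)=\prod_{i\in I}\pi_1(Q,q_i)$ be the graded fundamental group. $\mathrm{Hom}(\pi_1(Q,q),\Lambda)=\prod_{i\in I}\mathrm{Hom}(\pi_1(Q,q_i),\Lambda_i)$ is the set of homomorphisms of graded groups. A graded extension $\Lambda\curvearrowright\tilde Q\xrightarrow{p}Q$ consists of a surjective quandle homomorphism $p\colon\tilde Q\to Q$ (with $\tilde Q_i=p^{-1}(Q_i)$) and a graded left action of $\Lambda$ on $\tilde Q$ ($\Lambda$ acts on $\tilde Q_i$ through an action of $\Lambda_i$) such that: (E1) $(\lambda\tilde x)*\tilde y=\lambda(\tilde x*\tilde y)$ and $\tilde x*(\lambda\tilde y)=\tilde x*\tilde y$ for all $\tilde x,\tilde y\in\tilde Q$, $\lambda\in\Lambda$; (E2) $\Lambda_i$ acts freely and transitively on each fibre $p^{-1}(x)$ with $x\in Q_i$. An equivalence of extensions is a $\Lambda$-equivariant quandle isomorphism compatible with the projections to $Q$; $\mathrm{Ext}(Q,\Lambda)$ is the set of equivalence classes of graded extensions of $Q$ by $\Lambda$. A $2$-cocycle is a map $f\colon Q\times Q\to\Lambda$ with $f(Q_i\times Q)\subset\Lambda_i$, $f(a,a)=1$ and $f(a,b)f(a*b,c)=f(a,c)f(a*c,b*c)$ for all $a,b,c\in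 Q$. Two cocycles $f,f'$ are cohomologous if there is a map $g\colon Q\to\Lambda$ with $g(Q_i)\subset\Lambda_i$ such that $f(a,b)=g(a)^{-1}f'(a,b)g(a*b)$ for all $a,b\in Q$. $H^2(Q,\Lambda)$ is the set of cohomology classes of $2$-cocycles.
   Formalization: For non-abelian Λ, Hom(π₁(Q,q),Λ) is taken modulo conjugation in each factor Λ_i, since the literal claim fails (trivial two-element quandle, Λ₁=Λ₂=S₃: 36 homomorphisms, 9 classes). For abelian Λ and modules, Hom itself is used. *)

theory Defs
  imports "HOL-Algebra.Group_Action" "HOL-Algebra.Generated_Groups" "HOL-Algebra.Module"
begin

section \<open>Quandles\<close>

record 'a quandle = "'a partial_object" +
  qop :: "['a, 'a] \<Rightarrow> 'a" (infixl \<open>\<triangleright>\<index>\<close> 70)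
  qbar :: "['a, 'a] \<Rightarrow> 'a" (infixl \<open>\<triangleleft>\<index>\<close> 70)

locale quandle =
  fixes Q (structure)
  assumes qop_closed: "\<lbrakk>a \<in> carrier Q; b \<in> carrier Q\<rbrakk> \<Longrightarrow> a \<triangleright> b \<in> carrier Q"
    and qbar_closed: "\<lbrakk>a \<in> carrier Q; b \<in> carrier Q\<rbrakk> \<Longrightarrow> a \<triangleleft> b \<in> carrier Q"
    and idem: "a \<in> carrier Q \<Longrightarrow> a \<triangleright> a = a"
    and qop_qbar: "\<lbrakk>a \<in> carrier Q; b \<in> carrier Q\<rbrakk> \<Longrightarrow> (a \<triangleright> b) \<triangleleft> b = a"
    and qbar_qop: "\<lbrakk>a \<in> carrier Q; b \<in> carrier Q\<rbrakk> \<Longrightarrow> (a \<triangleleft> b) \<triangleright> b = a"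
    and self_distrib: "\<lbrakk>a \<in> carrier Q; b \<in> carrier Q; c \<in> carrier Q\<rbrakk>
        \<Longrightarrow> (a \<triangleright> b) \<triangleright> c = (a \<triangleright> c) \<triangleright> (b \<triangleright> c)"

definition quandle_hom ::
  "('a, 'y) quandle_scheme \<Rightarrow> ('b, 'z) quandle_scheme \<Rightarrow> ('a \<Rightarrow> 'b) set" where
  "quandle_hom Q Q' = {\<phi> \<in> carrier Q \<rightarrow> carrier Q'.
     \<forall>a\<in>carrier Q. \<forall>b\<in>carrier Q. \<phi> (a \<triangleright>\<^bsub>Q\<^esub> b) = \<phi> a \<triangleright>\<^bsub>Q'\<^esub> \<phi> b}"

definition Inn :: "('a, 'z) quandle_scheme \<Rightarrow> ('a \<Rightarrow> 'a) set" where
  "Inn Q = generate (BijGroup (carrier Q)) ((\<lambda>a. \<lambda>x\<in>carrier Q. x \<triangleright>\<^bsub>Q\<^esub> a) ` carrier Q)"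

definition qcomponent :: "('a, 'z) quandle_scheme \<Rightarrow> 'a \<Rightarrow> 'a set" where
  "qcomponent Q x = {\<sigma> x | \<sigma>. \<sigma> \<in> Inn Q}"

record ('a, 'i) wpquandle = "'a quandle" +
  Ind :: "'i set"
  base :: "'i \<Rightarrow> 'a"

text \<open>The component \<open>Q\<^sub>i\<close> is determined by its base point \<open>q\<^sub>i\<close>, so it is not
  part of the data.\<close>

definition cpt :: "('a, 'i, 'z) wpquandle_scheme \<Rightarrow> 'i \<Rightarrow> 'a set" where
  "cpt W i = qcomponent W (base W i)"

locale well_pointed = quandle W for W (structure) +
  assumes base_closed: "i \<in> Ind W \<Longrightarrow> base W i \<in> carrier W"
    and cpt_distinct: "\<lbrakk>i \<in> Ind W; j \<in> Ind W; i \<noteq> j\<rbrakk> \<Longrightarrow> cpt W i \<noteq> cpt W j"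
    and cpt_exhaust: "x \<in> carrier W \<Longrightarrow> \<exists>i\<in>Ind W. qcomponent W x = cpt W i"

definition grade :: "('a, 'i, 'z) wpquandle_scheme \<Rightarrow> 'a \<Rightarrow> 'i" where
  "grade W x = (THE i. i \<in> Ind W \<and> x \<in> cpt W i)"

text \<open>Homomorphisms of well-pointed quandles are taken over a fixed index set, as the
  grading of the coefficients is indexed by it; they preserve base points, hence
  components.\<close>

definition wp_hom ::
  "('a, 'i, 'y) wpquandle_scheme \<Rightarrow> ('b, 'i, 'z) wpquandle_scheme \<Rightarrow> ('a \<Rightarrow> 'b) set" where
  "wp_hom W W' = {\<phi> \<in> quandle_hom W W'. Ind W = Ind W' \<and>
     (\<forall>i\<in>Ind W. \<phi> (base W i) = base W' i)}"


section \<open>The adjoint group and the fundamental group\<close>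

text \<open>\<open>Adj Q\<close> is the group presented by generators \<open>adj a\<close> and relations
  \<open>adj (a \<triangleright> b) = (adj b)\<inverse> (adj a) (adj b)\<close>. A word is a list of letters
  \<open>(a, True)\<close> for \<open>adj a\<close> and \<open>(a, False)\<close> for \<open>(adj a)\<inverse>\<close>.\<close>

type_synonym 'a word = "('a \<times> bool) list"

definition words :: "('a, 'z) quandle_scheme \<Rightarrow> 'a word set" where
  "words Q = lists (carrier Q \<times> UNIV)"

inductive adj_eq :: "('a, 'z) quandle_scheme \<Rightarrow> 'a word \<Rightarrow> 'a word \<Rightarrow> bool" for Q where
  adj_refl: "u \<in> words Q \<Longrightarrow> adj_eq Q u u"
| adj_sym: "adj_eq Q u v \<Longrightarrow> adj_eq Q v u"
| adj_trans: "adj_eq Q u v \<Longrightarrow> adj_eq Q v w \<Longrightarrow> adj_eq Q u w"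
| adj_cong: "adj_eq Q u u' \<Longrightarrow> adj_eq Q v v' \<Longrightarrow> adj_eq Q (u @ v) (u' @ v')"
| adj_inverse: "a \<in> carrier Q \<Longrightarrow> adj_eq Q [(a, s), (a, \<not> s)] []"
| adj_relation: "a \<in> carrier Q \<Longrightarrow> b \<in> carrier Q
    \<Longrightarrow> adj_eq Q [(a \<triangleright>\<^bsub>Q\<^esub> b, True)] [(b, False), (a, True), (b, True)]"

definition adj_rel :: "('a, 'z) quandle_scheme \<Rightarrow> ('a word \<times> 'a word) set" where
  "adj_rel Q = {(u, v). adj_eq Q u v}"

definition adj_class :: "('a, 'z) quandle_scheme \<Rightarrow> 'a word \<Rightarrow> 'a word set" where
  "adj_class Q w = adj_rel Q `` {w}"

definition Adj :: "('a, 'z) quandle_scheme \<Rightarrow> 'a word set monoid" where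
  "Adj Q = \<lparr>carrier = words Q // adj_rel Q,
     monoid.mult = \<lambda>A B. adj_rel Q `` {u @ v | u v. u \<in> A \<and> v \<in> B},
     one = adj_class Q []\<rparr>"

definition word_deg :: "'a word \<Rightarrow> int" where
  "word_deg w = (\<Sum>(a, s)\<leftarrow>w. if s then 1 else - 1)"

definition adj_deg :: "'a word set \<Rightarrow> int" where
  "adj_deg g = the_elem (word_deg ` g)"

definition word_act :: "('a, 'z) quandle_scheme \<Rightarrow> 'a \<Rightarrow> 'a word \<Rightarrow> 'a" where
  "word_act Q x w = foldl (\<lambda>y (a, s). if s then y \<triangleright>\<^bsub>Q\<^esub> a else y \<triangleleft>\<^bsub>Q\<^esub> a) x w"

definition adj_act :: "('a, 'z) quandle_scheme \<Rightarrow> 'a \<Rightarrow> 'a word set \<Rightarrow> 'a" where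
  "adj_act Q x g = the_elem (word_act Q x ` g)"

definition pi1 :: "('a, 'z) quandle_scheme \<Rightarrow> 'a \<Rightarrow> 'a word set monoid" where
  "pi1 Q x = (Adj Q)\<lparr>carrier := {g \<in> carrier (Adj Q). adj_deg g = 0 \<and> adj_act Q x g = x}\<rparr>"

definition map_word :: "('a \<Rightarrow> 'b) \<Rightarrow> 'a word \<Rightarrow> 'b word" where
  "map_word \<phi> = map (map_prod \<phi> id)"

definition Adj_map ::
  "('a \<Rightarrow> 'b) \<Rightarrow> ('b, 'z) quandle_scheme \<Rightarrow> 'a word set \<Rightarrow> 'b word set" where
  "Adj_map \<phi> Q' g = adj_rel Q' `` (map_word \<phi> ` g)"


section \<open>Graded groups and graded homomorphisms\<close>

text \<open>A graded group \<open>\<Lambda> = \<Prod>i\<in>I. \<Lambda>\<^sub>i\<close> is given by the family of its factors. An element or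
  map required to lie in the subgroup \<open>\<Lambda>\<^sub>i\<close> is an element of, or a map to, the \<open>i\<close>-th
  factor.\<close>

definition graded_group :: "'i set \<Rightarrow> ('i \<Rightarrow> ('l, 'g) monoid_scheme) \<Rightarrow> bool" where
  "graded_group I \<Lambda> \<longleftrightarrow> (\<forall>i\<in>I. group (\<Lambda> i))"

definition graded_hom ::
  "'i set \<Rightarrow> ('i \<Rightarrow> ('l, 'g) monoid_scheme) \<Rightarrow> ('i \<Rightarrow> ('m, 'h) monoid_scheme) \<Rightarrow> ('i \<Rightarrow> 'l \<Rightarrow> 'm) set"
  where "graded_hom I \<Lambda> \<Lambda>' = {\<psi>. \<forall>i\<in>I. \<psi> i \<in> hom (\<Lambda> i) (\<Lambda>' i)}"

text \<open>The factor \<open>\<Lambda>\<^sub>i\<close>, regarded as a graded group concentrated in degree \<open>i\<close>, and the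
  projection of \<open>\<Lambda>\<close> to it.\<close>

definition grade_part ::
  "('i \<Rightarrow> ('l, 'g) monoid_scheme) \<Rightarrow> 'i \<Rightarrow> 'i \<Rightarrow> ('l, 'g) monoid_scheme" where
  "grade_part \<Lambda> i j = (if j = i then \<Lambda> j else (\<Lambda> j)\<lparr>carrier := {\<one>\<^bsub>\<Lambda> j\<^esub>}\<rparr>)"

definition grade_proj :: "('i \<Rightarrow> ('l, 'g) monoid_scheme) \<Rightarrow> 'i \<Rightarrow> 'i \<Rightarrow> 'l \<Rightarrow> 'l" where
  "grade_proj \<Lambda> i j = (\<lambda>l. if j = i then l else \<one>\<^bsub>\<Lambda> j\<^esub>)"

definition Hom ::
  "('a, 'i, 'z) wpquandle_scheme \<Rightarrow> ('i \<Rightarrow> ('l, 'g) monoid_scheme) \<Rightarrow> ('i \<Rightarrow> 'a word set \<Rightarrow> 'l) set"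
  where "Hom W \<Lambda> = (\<Pi>\<^sub>E i\<in>Ind W.
     {h \<in> hom (pi1 W (base W i)) (\<Lambda> i). h \<in> extensional (carrier (pi1 W (base W i)))})"

definition hom_pull ::
  "('a, 'i, 'y) wpquandle_scheme \<Rightarrow> ('b, 'i, 'z) wpquandle_scheme \<Rightarrow> ('a \<Rightarrow> 'b)
     \<Rightarrow> ('i \<Rightarrow> 'b word set \<Rightarrow> 'l) \<Rightarrow> ('i \<Rightarrow> 'a word set \<Rightarrow> 'l)" where
  "hom_pull W W' \<phi> h = (\<lambda>i\<in>Ind W. \<lambda>g\<in>carrier (pi1 W (base W i)). h i (Adj_map \<phi> W' g))"

definition hom_push ::
  "('a, 'i, 'z) wpquandle_scheme \<Rightarrow> ('i \<Rightarrow> 'l \<Rightarrow> 'm)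
     \<Rightarrow> ('i \<Rightarrow> 'a word set \<Rightarrow> 'l) \<Rightarrow> ('i \<Rightarrow> 'a word set \<Rightarrow> 'm)" where
  "hom_push W \<psi> h = (\<lambda>i\<in>Ind W. \<lambda>g\<in>carrier (pi1 W (base W i)). \<psi> i (h i g))"

text \<open>An extension \<open>E\<close> of \<open>Q\<close> with chosen points \<open>x\<^sub>i\<close> above the base points \<open>q\<^sub>i\<close> has a
  monodromy homomorphism \<open>h\<close> with \<open>x\<^sub>i\<^sup>g = h\<^sub>i(g) x\<^sub>i\<close>. Neither extensions nor their
  equivalences are pointed, and replacing \<open>x\<^sub>i\<close> by \<open>c\<^sub>i x\<^sub>i\<close> replaces \<open>h\<^sub>i\<close> by
  \<open>c\<^sub>i h\<^sub>i c\<^sub>i\<inverse>\<close>. So for coefficients that are not abelian it is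
  homomorphisms up to conjugation in each \<open>\<Lambda>\<^sub>i\<close> that classify extensions, and not the
  homomorphisms themselves: if \<open>Q\<close> is trivial with two elements, then
  \<open>\<pi>\<^sub>1(Q, q\<^sub>i) = \<int>\<close> for both \<open>i\<close>, and \<open>\<Lambda>\<^sub>1 = \<Lambda>\<^sub>2 = S\<^sub>3\<close> yields \<open>36\<close> homomorphisms but
  \<open>9\<close> cohomology classes. For abelian \<open>\<Lambda>\<close> conjugacy is equality.\<close>

definition conj_rel ::
  "('a, 'i, 'z) wpquandle_scheme \<Rightarrow> ('i \<Rightarrow> ('l, 'g) monoid_scheme)
     \<Rightarrow> (('i \<Rightarrow> 'a word set \<Rightarrow> 'l) \<times> ('i \<Rightarrow> 'a word set \<Rightarrow> 'l)) set" where
  "conj_rel W \<Lambda> = {(h, h'). h \<in> Hom W \<Lambda> \<and> h' \<in> Hom W \<Lambda> \<and>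
     (\<exists>c\<in>(\<Pi> i\<in>Ind W. carrier (\<Lambda> i)). \<forall>i\<in>Ind W. \<forall>g\<in>carrier (pi1 W (base W i)).
        h' i g = c i \<otimes>\<^bsub>\<Lambda> i\<^esub> h i g \<otimes>\<^bsub>\<Lambda> i\<^esub> inv\<^bsub>\<Lambda> i\<^esub> c i)}"

definition HomC ::
  "('a, 'i, 'z) wpquandle_scheme \<Rightarrow> ('i \<Rightarrow> ('l, 'g) monoid_scheme)
     \<Rightarrow> ('i \<Rightarrow> 'a word set \<Rightarrow> 'l) set set" where
  "HomC W \<Lambda> = Hom W \<Lambda> // conj_rel W \<Lambda>"

definition HomC_pull ::
  "('a, 'i, 'y) wpquandle_scheme \<Rightarrow> ('b, 'i, 'z) wpquandle_scheme
     \<Rightarrow> ('i \<Rightarrow> ('l, 'g) monoid_scheme) \<Rightarrow> ('a \<Rightarrow> 'b)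
     \<Rightarrow> ('i \<Rightarrow> 'b word set \<Rightarrow> 'l) set \<Rightarrow> ('i \<Rightarrow> 'a word set \<Rightarrow> 'l) set" where
  "HomC_pull W W' \<Lambda> \<phi> C = conj_rel W \<Lambda> `` (hom_pull W W' \<phi> ` C)"

definition HomC_push ::
  "('a, 'i, 'z) wpquandle_scheme \<Rightarrow> ('i \<Rightarrow> ('m, 'h) monoid_scheme) \<Rightarrow> ('i \<Rightarrow> 'l \<Rightarrow> 'm)
     \<Rightarrow> ('i \<Rightarrow> 'a word set \<Rightarrow> 'l) set \<Rightarrow> ('i \<Rightarrow> 'a word set \<Rightarrow> 'm) set" where
  "HomC_push W \<Lambda>' \<psi> C = conj_rel W \<Lambda>' `` (hom_push W \<psi> ` C)"


section \<open>Second cohomology\<close>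

definition cochains2 ::
  "('a, 'i, 'z) wpquandle_scheme \<Rightarrow> ('i \<Rightarrow> ('l, 'g) monoid_scheme) \<Rightarrow> ('a \<times> 'a \<Rightarrow> 'l) set" where
  "cochains2 W \<Lambda> = (\<Pi>\<^sub>E (a, b)\<in>carrier W \<times> carrier W. carrier (\<Lambda> (grade W a)))"

definition Z2 ::
  "('a, 'i, 'z) wpquandle_scheme \<Rightarrow> ('i \<Rightarrow> ('l, 'g) monoid_scheme) \<Rightarrow> ('a \<times> 'a \<Rightarrow> 'l) set" where
  "Z2 W \<Lambda> = {f \<in> cochains2 W \<Lambda>.
     (\<forall>a\<in>carrier W. f (a, a) = \<one>\<^bsub>\<Lambda> (grade W a)\<^esub>) \<and>
     (\<forall>a\<in>carrier W. \<forall>b\<in>carrier W. \<forall>c\<in>carrier W.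
        f (a, b) \<otimes>\<^bsub>\<Lambda> (grade W a)\<^esub> f (a \<triangleright>\<^bsub>W\<^esub> b, c) =
        f (a, c) \<otimes>\<^bsub>\<Lambda> (grade W a)\<^esub> f (a \<triangleright>\<^bsub>W\<^esub> c, b \<triangleright>\<^bsub>W\<^esub> c))}"

definition cohom_rel ::
  "('a, 'i, 'z) wpquandle_scheme \<Rightarrow> ('i \<Rightarrow> ('l, 'g) monoid_scheme)
     \<Rightarrow> (('a \<times> 'a \<Rightarrow> 'l) \<times> ('a \<times> 'a \<Rightarrow> 'l)) set" where
  "cohom_rel W \<Lambda> = {(f, f'). f \<in> Z2 W \<Lambda> \<and> f' \<in> Z2 W \<Lambda> \<and>
     (\<exists>g\<in>(\<Pi> a\<in>carrier W. carrier (\<Lambda> (grade W a))). \<forall>a\<in>carrier W. \<forall>b\<in>carrier W.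
        f (a, b) = inv\<^bsub>\<Lambda> (grade W a)\<^esub> g a \<otimes>\<^bsub>\<Lambda> (grade W a)\<^esub> f' (a, b)
                     \<otimes>\<^bsub>\<Lambda> (grade W a)\<^esub> g (a \<triangleright>\<^bsub>W\<^esub> b))}"

definition H2 ::
  "('a, 'i, 'z) wpquandle_scheme \<Rightarrow> ('i \<Rightarrow> ('l, 'g) monoid_scheme) \<Rightarrow> ('a \<times> 'a \<Rightarrow> 'l) set set" where
  "H2 W \<Lambda> = Z2 W \<Lambda> // cohom_rel W \<Lambda>"

definition H2_pull ::
  "('a, 'i, 'y) wpquandle_scheme \<Rightarrow> ('i \<Rightarrow> ('l, 'g) monoid_scheme) \<Rightarrow> ('a \<Rightarrow> 'b)
     \<Rightarrow> ('b \<times> 'b \<Rightarrow> 'l) set \<Rightarrow> ('a \<times> 'a \<Rightarrow> 'l) set" where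
  "H2_pull W \<Lambda> \<phi> C = cohom_rel W \<Lambda> ``
     ((\<lambda>f. \<lambda>(a, b)\<in>carrier W \<times> carrier W. f (\<phi> a, \<phi> b)) ` C)"

definition H2_push ::
  "('a, 'i, 'z) wpquandle_scheme \<Rightarrow> ('i \<Rightarrow> ('m, 'h) monoid_scheme) \<Rightarrow> ('i \<Rightarrow> 'l \<Rightarrow> 'm)
     \<Rightarrow> ('a \<times> 'a \<Rightarrow> 'l) set \<Rightarrow> ('a \<times> 'a \<Rightarrow> 'm) set" where
  "H2_push W \<Lambda>' \<psi> C = cohom_rel W \<Lambda>' ``
     ((\<lambda>f. \<lambda>(a, b)\<in>carrier W \<times> carrier W. \<psi> (grade W a) (f (a, b))) ` C)"


section \<open>Graded extensions\<close>

text \<open>The action is a single function: an element \<open>x\<close> of the total space determines the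
  degree \<open>i\<close> with \<open>proj x \<in> Q\<^sub>i\<close> and hence the group \<open>\<Lambda>\<^sub>i\<close> that acts on it.\<close>

record ('e, 'a, 'l) qext =
  total :: "'e quandle"
  proj :: "'e \<Rightarrow> 'a"
  eact :: "'l \<Rightarrow> 'e \<Rightarrow> 'e"

definition fibres :: "('e, 'a, 'l) qext \<Rightarrow> 'a set \<Rightarrow> 'e set" where
  "fibres E S = {x \<in> carrier (total E). proj E x \<in> S}"

locale graded_ext =
  fixes W :: "('a, 'i, 'z) wpquandle_scheme"
    and \<Lambda> :: "'i \<Rightarrow> ('l, 'g) monoid_scheme"
    and E :: "('e, 'a, 'l) qext"
  assumes total_quandle: "quandle (total E)"
    and proj_hom: "proj E \<in> quandle_hom (total E) W"
    and proj_surj: "proj E ` carrier (total E) = carrier W"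
    and action: "i \<in> Ind W \<Longrightarrow> group_action (\<Lambda> i) (fibres E (cpt W i))
                                 (\<lambda>l. restrict (eact E l) (fibres E (cpt W i)))"
    and E1_left: "\<lbrakk>i \<in> Ind W; l \<in> carrier (\<Lambda> i); x \<in> fibres E (cpt W i); y \<in> carrier (total E)\<rbrakk>
        \<Longrightarrow> eact E l x \<triangleright>\<^bsub>total E\<^esub> y = eact E l (x \<triangleright>\<^bsub>total E\<^esub> y)"
    and E1_right: "\<lbrakk>i \<in> Ind W; l \<in> carrier (\<Lambda> i); x \<in> carrier (total E); y \<in> fibres E (cpt W i)\<rbrakk>
        \<Longrightarrow> x \<triangleright>\<^bsub>total E\<^esub> eact E l y = x \<triangleright>\<^bsub>total E\<^esub> y"
    and E2_fibre: "\<lbrakk>i \<in> Ind W; a \<in> cpt W i; l \<in> carrier (\<Lambda> i); x \<in> fibres E {a}\<rbrakk>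
        \<Longrightarrow> eact E l x \<in> fibres E {a}"
    and E2_free: "\<lbrakk>i \<in> Ind W; a \<in> cpt W i; l \<in> carrier (\<Lambda> i); x \<in> fibres E {a}; eact E l x = x\<rbrakk>
        \<Longrightarrow> l = \<one>\<^bsub>\<Lambda> i\<^esub>"
    and E2_transitive: "\<lbrakk>i \<in> Ind W; a \<in> cpt W i; x \<in> fibres E {a}; y \<in> fibres E {a}\<rbrakk>
        \<Longrightarrow> \<exists>l\<in>carrier (\<Lambda> i). eact E l x = y"

definition ext_hom ::
  "('a, 'i, 'z) wpquandle_scheme \<Rightarrow> ('i \<Rightarrow> ('l, 'g) monoid_scheme) \<Rightarrow> ('a \<Rightarrow> 'b) \<Rightarrow> ('i \<Rightarrow> 'l \<Rightarrow> 'm)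
     \<Rightarrow> ('e, 'a, 'l) qext \<Rightarrow> ('f, 'b, 'm) qext \<Rightarrow> ('e \<Rightarrow> 'f) set" where
  "ext_hom W \<Lambda> \<phi> \<psi> E E' = {F \<in> quandle_hom (total E) (total E').
     (\<forall>x\<in>carrier (total E). proj E' (F x) = \<phi> (proj E x)) \<and>
     (\<forall>i\<in>Ind W. \<forall>l\<in>carrier (\<Lambda> i). \<forall>x\<in>fibres E (cpt W i). F (eact E l x) = eact E' (\<psi> i l) (F x))}"

definition ext_equiv ::
  "('a, 'i, 'z) wpquandle_scheme \<Rightarrow> ('i \<Rightarrow> ('l, 'g) monoid_scheme)
     \<Rightarrow> ('e, 'a, 'l) qext \<Rightarrow> ('f, 'a, 'l) qext \<Rightarrow> bool" where
  "ext_equiv W \<Lambda> E E' \<longleftrightarrow>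
     (\<exists>F\<in>ext_hom W \<Lambda> id (\<lambda>i. id) E E'. bij_betw F (carrier (total E)) (carrier (total E')))"

text \<open>A set of equivalence classes needs a fixed type for the total spaces. The type
  \<open>'a \<times> 'l\<close> is large enough: by the lemma \<open>ext_representative\<close> below, every extension,
  of whatever type, is equivalent to one of this type.\<close>

type_synonym ('a, 'l) extn = "('a \<times> 'l, 'a, 'l) qext"

definition exts ::
  "('a, 'i, 'z) wpquandle_scheme \<Rightarrow> ('i \<Rightarrow> ('l, 'g) monoid_scheme) \<Rightarrow> ('a, 'l) extn set" where
  "exts W \<Lambda> = {E. graded_ext W \<Lambda> E}"

definition ext_transport :: "('e \<Rightarrow> 'f) \<Rightarrow> ('e, 'a, 'l) qext \<Rightarrow> ('f, 'a, 'l) qext" where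
  "ext_transport j E = (let C = carrier (total E); k = inv_into C j in
     \<lparr>total = \<lparr>carrier = j ` C,
        qop = \<lambda>u v. j (k u \<triangleright>\<^bsub>total E\<^esub> k v),
        qbar = \<lambda>u v. j (k u \<triangleleft>\<^bsub>total E\<^esub> k v)\<rparr>,
     proj = \<lambda>u. proj E (k u),
     eact = \<lambda>l u. j (eact E l (k u))\<rparr>)"

lemma group_action_transport:
  assumes act: "group_action G S (\<lambda>g. restrict (\<alpha> g) S)" and inj: "inj_on j S"
    and \<beta>: "\<And>g x. g \<in> carrier G \<Longrightarrow> x \<in> S \<Longrightarrow> \<beta> g (j x) = j (\<alpha> g x)"
  shows "group_action G (j ` S) (\<lambda>g. restrict (\<beta> g) (j ` S))"
proof -
  interpret A: group_action G S "\<lambda>g. restrict (\<alpha> g) S" by (rule act)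
  interpret G: group G using A.group_hom by (simp add: group_hom_def)
  have im: "\<alpha> g x \<in> S" if "g \<in> carrier G" "x \<in> S" for g x
    using A.element_image[OF that] that by auto
  have mult: "\<alpha> (g \<otimes>\<^bsub>G\<^esub> h) x = \<alpha> g (\<alpha> h x)" if "g \<in> carrier G" "h \<in> carrier G" "x \<in> S" for g h x
    using A.composition_rule[of x g h] that im by auto
  have bij: "bij_betw (\<alpha> g) S S" if "g \<in> carrier G" for g
    using A.bij_prop0[OF that] by (simp add: Bij_def bij_betw_def inj_on_def image_def)
  have bij': "restrict (\<beta> g) (j ` S) \<in> Bij (j ` S)" if g: "g \<in> carrier G" for g
  proof -
    have "inj_on (\<beta> g) (j ` S)"
    proof (rule inj_onI, clarify)
      fix x y assume xy: "x \<in> S" "y \<in> S" "\<beta> g (j x) = \<beta> g (j y)"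
      then have "j (\<alpha> g x) = j (\<alpha> g y)" using \<beta>[OF g] by simp
      then have "\<alpha> g x = \<alpha> g y" using inj im[OF g] xy by (auto dest: inj_onD)
      then show "j x = j y" using bij[OF g] xy by (auto simp: bij_betw_def dest: inj_onD)
    qed
    moreover have "\<beta> g ` j ` S = j ` \<alpha> g ` S"
      using \<beta>[OF g] by (auto simp: image_iff)
    ultimately show ?thesis
      using bij[OF g] by (auto simp: Bij_def bij_betw_def inj_on_restrict_eq)
  qed
  have "group_hom G (BijGroup (j ` S)) (\<lambda>g. restrict (\<beta> g) (j ` S))"
  proof (intro group_hom.intro group_hom_axioms.intro G.is_group group_BijGroup homI)
    show "restrict (\<beta> g) (j ` S) \<in> carrier (BijGroup (j ` S))" if "g \<in> carrier G" for g
      using bij'[OF that] by (simp add: BijGroup_def)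
    show "restrict (\<beta> (g \<otimes>\<^bsub>G\<^esub> h)) (j ` S)
        = restrict (\<beta> g) (j ` S) \<otimes>\<^bsub>BijGroup (j ` S)\<^esub> restrict (\<beta> h) (j ` S)"
      if g: "g \<in> carrier G" and h: "h \<in> carrier G" for g h
    proof -
      have "restrict (\<beta> (g \<otimes>\<^bsub>G\<^esub> h)) (j ` S)
          = compose (j ` S) (restrict (\<beta> g) (j ` S)) (restrict (\<beta> h) (j ` S))"
      proof (rule extensionalityI[OF restrict_extensional compose_extensional])
        fix u assume "u \<in> j ` S"
        then obtain x where x: "x \<in> S" "u = j x" by blast
        show "restrict (\<beta> (g \<otimes>\<^bsub>G\<^esub> h)) (j ` S) u
            = compose (j ` S) (restrict (\<beta> g) (j ` S)) (restrict (\<beta> h) (j ` S)) u"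
          using x g h by (simp add: compose_def \<beta> im mult)
      qed
      then show ?thesis using bij'[OF g] bij'[OF h] by (simp add: BijGroup_def)
    qed
  qed
  then show ?thesis by (rule group_action.intro)
qed

lemma ext_transport:
  assumes E: "graded_ext W \<Lambda> E" and wp: "well_pointed W" and inj: "inj_on j (carrier (total E))"
  shows "graded_ext W \<Lambda> (ext_transport j E)" and "ext_equiv W \<Lambda> E (ext_transport j E)"
proof -
  interpret E: graded_ext W \<Lambda> E by (rule E)
  interpret T: quandle "total E" by (rule E.total_quandle)
  interpret W: well_pointed W by (rule wp)
  let ?C = "carrier (total E)" and ?E = "ext_transport j E"
  have k: "inv_into ?C j (j x) = x" if "x \<in> ?C" for x using inj that by simp
  have carr: "carrier (total ?E) = j ` ?C" by (simp add: ext_transport_def Let_def)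
  have op: "j x \<triangleright>\<^bsub>total ?E\<^esub> j y = j (x \<triangleright>\<^bsub>total E\<^esub> y)"
    and bar: "j x \<triangleleft>\<^bsub>total ?E\<^esub> j y = j (x \<triangleleft>\<^bsub>total E\<^esub> y)" if "x \<in> ?C" "y \<in> ?C" for x y
    using that by (simp_all add: ext_transport_def Let_def k)
  have pr: "proj ?E (j x) = proj E x" and ac: "eact ?E l (j x) = j (eact E l x)"
    if "x \<in> ?C" for x l
    using that by (simp_all add: ext_transport_def Let_def k)
  have ab: "fibres ?E S = j ` fibres E S" for S
    by (auto simp: fibres_def carr pr)
  have sub: "x \<in> ?C" if "x \<in> fibres E S" for x S using that by (simp add: fibres_def)
  have cl: "eact E l x \<in> fibres E (cpt W i)"
    if "i \<in> Ind W" "l \<in> carrier (\<Lambda> i)" "x \<in> fibres E (cpt W i)" for i l x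
    using E.E2_fibre[of i "proj E x" l x] that by (auto simp: fibres_def)
  have jeq: "x = y" if "j x = j y" "x \<in> ?C" "y \<in> ?C" for x y
    using inj that by (auto simp: inj_on_def)
  show "graded_ext W \<Lambda> ?E"
  proof (rule graded_ext.intro)
    show "quandle (total ?E)"
      by (rule quandle.intro)
        (auto simp: carr op bar T.qop_closed T.qbar_closed T.idem T.qop_qbar T.qbar_qop
           T.self_distrib[symmetric])
    show "proj ?E \<in> quandle_hom (total ?E) W"
      using E.proj_hom by (auto simp: quandle_hom_def carr op pr T.qop_closed)
    show "proj ?E ` carrier (total ?E) = carrier W"
      using E.proj_surj by (simp add: carr image_image pr)
    show "group_action (\<Lambda> i) (fibres ?E (cpt W i)) (\<lambda>l. restrict (eact ?E l) (fibres ?E (cpt W i)))"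
      if "i \<in> Ind W" for i
      unfolding ab
      by (rule group_action_transport[OF E.action[OF that]])
        (auto intro: inj_on_subset[OF inj] simp: sub ac)
    show "eact ?E l u \<triangleright>\<^bsub>total ?E\<^esub> v = eact ?E l (u \<triangleright>\<^bsub>total ?E\<^esub> v)"
      if "i \<in> Ind W" "l \<in> carrier (\<Lambda> i)" "u \<in> fibres ?E (cpt W i)" "v \<in> carrier (total ?E)" for i l u v
      using that E.E1_left[of i l] cl[of i l] sub[OF cl[of i l]] by (auto simp: ab carr ac op sub T.qop_closed)
    show "u \<triangleright>\<^bsub>total ?E\<^esub> eact ?E l v = u \<triangleright>\<^bsub>total ?E\<^esub> v"
      if "i \<in> Ind W" "l \<in> carrier (\<Lambda> i)" "u \<in> carrier (total ?E)" "v \<in> fibres ?E (cpt W i)" for i l u v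
      using that E.E1_right[of i l] cl[of i l] sub[OF cl[of i l]] by (auto simp: ab carr ac op sub)
    show "eact ?E l u \<in> fibres ?E {a}"
      if "i \<in> Ind W" "a \<in> cpt W i" "l \<in> carrier (\<Lambda> i)" "u \<in> fibres ?E {a}" for i a l u
      using that E.E2_fibre[of i a l] by (auto simp: ab ac sub)
    show "l = \<one>\<^bsub>\<Lambda> i\<^esub>"
      if *: "i \<in> Ind W" "a \<in> cpt W i" "l \<in> carrier (\<Lambda> i)" "u \<in> fibres ?E {a}" "eact ?E l u = u" for i a l u
    proof -
      obtain x where x: "x \<in> fibres E {a}" "u = j x" using *(4) by (auto simp: ab)
      have "eact E l x = x"
        using *(5) x E.E2_fibre[OF *(1-3) x(1)] by (auto simp: ac sub intro: jeq)
      then show ?thesis using E.E2_free[OF *(1-3) x(1)] by simp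
    qed
    show "\<exists>l\<in>carrier (\<Lambda> i). eact ?E l u = v"
      if "i \<in> Ind W" "a \<in> cpt W i" "u \<in> fibres ?E {a}" "v \<in> fibres ?E {a}" for i a u v
      using that E.E2_transitive[of i a] by (fastforce simp: ab ac sub)
  qed
  have "j \<in> ext_hom W \<Lambda> id (\<lambda>i. id) E ?E"
    by (auto simp: ext_hom_def quandle_hom_def carr op pr ac sub)
  then show "ext_equiv W \<Lambda> E ?E"
    using inj carr by (auto simp: ext_equiv_def bij_betw_def)
qed

lemma ext_representative:
  fixes W :: "('a, 'i, 'z) wpquandle_scheme" and E :: "('e, 'a, 'l) qext"
  assumes E: "graded_ext W \<Lambda> E" and wp: "well_pointed W"
  shows "\<exists>E' \<in> exts W \<Lambda>. ext_equiv W \<Lambda> E E'"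
proof -
  interpret E: graded_ext W \<Lambda> E by (rule E)
  interpret W: well_pointed W by (rule wp)
  let ?C = "carrier (total E)"
  define s where "s a = (SOME x. x \<in> fibres E {a})" for a
  define c where "c x = (SOME l. eact E l (s (proj E x)) = x)" for x
  have c: "eact E (c x) (s (proj E x)) = x" if x: "x \<in> ?C" for x
  proof -
    have px: "proj E x \<in> carrier W" using E.proj_surj x by auto
    have "group (BijGroup (carrier W))" by (rule group_BijGroup)
    have "\<one>\<^bsub>BijGroup (carrier W)\<^esub> \<in> Inn W" unfolding Inn_def by (rule generate.one)
    moreover have "\<one>\<^bsub>BijGroup (carrier W)\<^esub> (proj E x) = proj E x"
      using px by (simp add: BijGroup_def)
    ultimately have "proj E x \<in> qcomponent W (proj E x)"
      unfolding qcomponent_def by (metis (mono_tags, lifting) mem_Collect_eq)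
    then obtain i where i: "i \<in> Ind W" "proj E x \<in> cpt W i"
      using W.cpt_exhaust[OF px] by auto
    have "x \<in> fibres E {proj E x}" using x by (simp add: fibres_def)
    moreover from this have "s (proj E x) \<in> fibres E {proj E x}" unfolding s_def by (rule someI)
    ultimately have "\<exists>l. eact E l (s (proj E x)) = x" using E.E2_transitive[OF i] by blast
    then show ?thesis unfolding c_def by (rule someI_ex)
  qed
  have "inj_on (\<lambda>x. (proj E x, c x)) ?C"
    by (rule inj_onI) (metis c prod.inject)
  from ext_transport[OF E wp this] show ?thesis by (auto simp: exts_def)
qed

definition ext_rel ::
  "('a, 'i, 'z) wpquandle_scheme \<Rightarrow> ('i \<Rightarrow> ('l, 'g) monoid_scheme)
     \<Rightarrow> (('a, 'l) extn \<times> ('a, 'l) extn) set" where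
  "ext_rel W \<Lambda> = {(E, E'). E \<in> exts W \<Lambda> \<and> E' \<in> exts W \<Lambda> \<and> ext_equiv W \<Lambda> E E'}"

definition Ext ::
  "('a, 'i, 'z) wpquandle_scheme \<Rightarrow> ('i \<Rightarrow> ('l, 'g) monoid_scheme) \<Rightarrow> ('a, 'l) extn set set" where
  "Ext W \<Lambda> = exts W \<Lambda> // ext_rel W \<Lambda>"

text \<open>Functoriality. The pullback \<open>\<phi>\<^sup>*E'\<close> is, up to equivalence, the extension that maps to
  \<open>E'\<close> by a \<open>\<Lambda>\<close>-equivariant homomorphism over \<open>\<phi>\<close>; the pushforward \<open>\<psi>\<^sub>*E\<close> is, up to
  equivalence, the extension that receives a \<open>\<psi>\<close>-equivariant homomorphism from \<open>E\<close> over the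
  identity.\<close>

definition ext_pull ::
  "('a, 'i, 'y) wpquandle_scheme \<Rightarrow> ('i \<Rightarrow> ('l, 'g) monoid_scheme) \<Rightarrow> ('a \<Rightarrow> 'b)
     \<Rightarrow> ('b, 'l) extn set \<Rightarrow> ('a, 'l) extn set" where
  "ext_pull W \<Lambda> \<phi> \<xi> = {E \<in> exts W \<Lambda>. \<exists>E'\<in>\<xi>. ext_hom W \<Lambda> \<phi> (\<lambda>i. id) E E' \<noteq> {}}"

definition ext_push ::
  "('a, 'i, 'z) wpquandle_scheme \<Rightarrow> ('i \<Rightarrow> ('l, 'g) monoid_scheme) \<Rightarrow> ('i \<Rightarrow> ('m, 'h) monoid_scheme)
     \<Rightarrow> ('i \<Rightarrow> 'l \<Rightarrow> 'm) \<Rightarrow> ('a, 'l) extn set \<Rightarrow> ('a, 'm) extn set" where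
  "ext_push W \<Lambda> \<Lambda>' \<psi> \<xi> = {E' \<in> exts W \<Lambda>'. \<exists>E\<in>\<xi>. ext_hom W \<Lambda> id \<psi> E E' \<noteq> {}}"


section \<open>The comparison maps\<close>

definition ext_cocycles ::
  "('a, 'i, 'z) wpquandle_scheme \<Rightarrow> ('i \<Rightarrow> ('l, 'g) monoid_scheme) \<Rightarrow> ('e, 'a, 'l) qext
     \<Rightarrow> ('a \<times> 'a \<Rightarrow> 'l) set" where
  "ext_cocycles W \<Lambda> E = {f \<in> cochains2 W \<Lambda>. \<exists>s\<in>(\<Pi> a\<in>carrier W. fibres E {a}).
     \<forall>a\<in>carrier W. \<forall>b\<in>carrier W. s a \<triangleright>\<^bsub>total E\<^esub> s b = eact E (f (a, b)) (s (a \<triangleright>\<^bsub>W\<^esub> b))}"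

definition cocycle_class ::
  "('a, 'i, 'z) wpquandle_scheme \<Rightarrow> ('i \<Rightarrow> ('l, 'g) monoid_scheme) \<Rightarrow> ('a, 'l) extn set
     \<Rightarrow> ('a \<times> 'a \<Rightarrow> 'l) set" where
  "cocycle_class W \<Lambda> \<xi> = (\<Union>E\<in>\<xi>. ext_cocycles W \<Lambda> E)"

text \<open>\<open>Adj Q\<close> acts on the total space of an extension, because \<open>x \<triangleright> y\<close> and \<open>x \<triangleleft> y\<close> depend
  on \<open>y\<close> only through its projection; so \<open>x\<^sup>g\<close> is computed by any word \<open>w\<close> in the total
  space whose projection represents \<open>g\<close>.\<close>

definition monodromies ::
  "('a, 'i, 'z) wpquandle_scheme \<Rightarrow> ('i \<Rightarrow> ('l, 'g) monoid_scheme) \<Rightarrow> ('e, 'a, 'l) qext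
     \<Rightarrow> ('i \<Rightarrow> 'a word set \<Rightarrow> 'l) set" where
  "monodromies W \<Lambda> E = {h \<in> Hom W \<Lambda>. \<exists>x\<in>(\<Pi> i\<in>Ind W. fibres E {base W i}).
     \<forall>i\<in>Ind W. \<forall>g\<in>carrier (pi1 W (base W i)). \<forall>w\<in>words (total E).
       map_word (proj E) w \<in> g \<longrightarrow> word_act (total E) (x i) w = eact E (h i g) (x i)}"

definition monodromy_class ::
  "('a, 'i, 'z) wpquandle_scheme \<Rightarrow> ('i \<Rightarrow> ('l, 'g) monoid_scheme) \<Rightarrow> ('a, 'l) extn set
     \<Rightarrow> ('i \<Rightarrow> 'a word set \<Rightarrow> 'l) set" where
  "monodromy_class W \<Lambda> \<xi> = (\<Union>E\<in>\<xi>. monodromies W \<Lambda> E)"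

text \<open>For abelian coefficients the monodromy class is a singleton.\<close>

definition monodromy_hom ::
  "('a, 'i, 'z) wpquandle_scheme \<Rightarrow> ('i \<Rightarrow> ('l, 'g) monoid_scheme) \<Rightarrow> ('a, 'l) extn set
     \<Rightarrow> ('i \<Rightarrow> 'a word set \<Rightarrow> 'l)" where
  "monodromy_hom W \<Lambda> \<xi> = the_elem (monodromy_class W \<Lambda> \<xi>)"


section \<open>Modules\<close>

text \<open>The library locale \<open>module\<close> requires a commutative ring of scalars; left modules over
  an arbitrary ring are needed here.\<close>

locale left_module = R?: ring R + M?: abelian_group M for R and M (structure) +
  assumes smult_closed: "\<lbrakk>r \<in> carrier R; x \<in> carrier M\<rbrakk> \<Longrightarrow> r \<odot>\<^bsub>M\<^esub> x \<in> carrier M"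
    and smult_l_distr: "\<lbrakk>r \<in> carrier R; s \<in> carrier R; x \<in> carrier M\<rbrakk>
        \<Longrightarrow> (r \<oplus>\<^bsub>R\<^esub> s) \<odot>\<^bsub>M\<^esub> x = r \<odot>\<^bsub>M\<^esub> x \<oplus>\<^bsub>M\<^esub> s \<odot>\<^bsub>M\<^esub> x"
    and smult_r_distr: "\<lbrakk>r \<in> carrier R; x \<in> carrier M; y \<in> carrier M\<rbrakk>
        \<Longrightarrow> r \<odot>\<^bsub>M\<^esub> (x \<oplus>\<^bsub>M\<^esub> y) = r \<odot>\<^bsub>M\<^esub> x \<oplus>\<^bsub>M\<^esub> r \<odot>\<^bsub>M\<^esub> y"
    and smult_assoc: "\<lbrakk>r \<in> carrier R; s \<in> carrier R; x \<in> carrier M\<rbrakk>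
        \<Longrightarrow> (r \<otimes>\<^bsub>R\<^esub> s) \<odot>\<^bsub>M\<^esub> x = r \<odot>\<^bsub>M\<^esub> (s \<odot>\<^bsub>M\<^esub> x)"
    and smult_one: "x \<in> carrier M \<Longrightarrow> \<one>\<^bsub>R\<^esub> \<odot>\<^bsub>M\<^esub> x = x"

lemma module_iff_left_module: "module R M \<longleftrightarrow> cring R \<and> left_module R M"
  unfolding module_def left_module_def module_axioms_def left_module_axioms_def
  by (auto simp: cring_def)

definition linear_maps ::
  "('r, 's) ring_scheme \<Rightarrow> ('r, 'l, 'g) module_scheme \<Rightarrow> ('r, 'm, 'h) module_scheme \<Rightarrow> ('l \<Rightarrow> 'm) set"
  where "linear_maps R M N = {f \<in> carrier M \<rightarrow> carrier N.
     (\<forall>x\<in>carrier M. \<forall>y\<in>carrier M. f (x \<oplus>\<^bsub>M\<^esub> y) = f x \<oplus>\<^bsub>N\<^esub> f y) \<and>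
     (\<forall>r\<in>carrier R. \<forall>x\<in>carrier M. f (r \<odot>\<^bsub>M\<^esub> x) = r \<odot>\<^bsub>N\<^esub> f x)}"

definition module_isos ::
  "('r, 's) ring_scheme \<Rightarrow> ('r, 'l, 'g) module_scheme \<Rightarrow> ('r, 'm, 'h) module_scheme \<Rightarrow> ('l \<Rightarrow> 'm) set"
  where "module_isos R M N = {f \<in> linear_maps R M N. bij_betw f (carrier M) (carrier N)}"

definition coeff_groups :: "('i \<Rightarrow> ('r, 'l) module) \<Rightarrow> 'i \<Rightarrow> 'l monoid" where
  "coeff_groups M i = \<lparr>carrier = carrier (M i), monoid.mult = add (M i), one = zero (M i)\<rparr>"

text \<open>The record type of modules contains a multiplication and a unit, which the notion of
  module does not use.\<close>

definition H2_module ::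
  "('a, 'i, 'z) wpquandle_scheme \<Rightarrow> ('i \<Rightarrow> ('r, 'l) module) \<Rightarrow> ('r, ('a \<times> 'a \<Rightarrow> 'l) set) module"
  where "H2_module W M = \<lparr>carrier = H2 W (coeff_groups M), monoid.mult = undefined, one = undefined,
     zero = cohom_rel W (coeff_groups M) ``
       {\<lambda>(a, b)\<in>carrier W \<times> carrier W. \<zero>\<^bsub>M (grade W a)\<^esub>},
     add = \<lambda>C D. cohom_rel W (coeff_groups M) ``
       {\<lambda>(a, b)\<in>carrier W \<times> carrier W. f (a, b) \<oplus>\<^bsub>M (grade W a)\<^esub> f' (a, b) | f f'. f \<in> C \<and> f' \<in> D},
     smult = \<lambda>r. H2_push W (coeff_groups M) (\<lambda>i. smult (M i) r)\<rparr>"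

definition Hom_module ::
  "('a, 'i, 'z) wpquandle_scheme \<Rightarrow> ('i \<Rightarrow> ('r, 'l) module) \<Rightarrow> ('r, 'i \<Rightarrow> 'a word set \<Rightarrow> 'l) module"
  where "Hom_module W M = \<lparr>carrier = Hom W (coeff_groups M), monoid.mult = undefined, one = undefined,
     zero = (\<lambda>i\<in>Ind W. \<lambda>g\<in>carrier (pi1 W (base W i)). \<zero>\<^bsub>M i\<^esub>),
     add = \<lambda>h h'. \<lambda>i\<in>Ind W. \<lambda>g\<in>carrier (pi1 W (base W i)). h i g \<oplus>\<^bsub>M i\<^esub> h' i g,
     smult = \<lambda>r. hom_push W (\<lambda>i. smult (M i) r)\<rparr>"

definition trivial_ext ::
  "('a, 'i, 'z) wpquandle_scheme \<Rightarrow> ('i \<Rightarrow> ('l, 'g) monoid_scheme) \<Rightarrow> ('a, 'l) extn" where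
  "trivial_ext W \<Lambda> = \<lparr>
     total = \<lparr>carrier = (SIGMA a:carrier W. carrier (\<Lambda> (grade W a))),
        qop = \<lambda>(a, l) (b, m). (a \<triangleright>\<^bsub>W\<^esub> b, l),
        qbar = \<lambda>(a, l) (b, m). (a \<triangleleft>\<^bsub>W\<^esub> b, l)\<rparr>,
     proj = fst,
     eact = \<lambda>m (a, l). (a, m \<otimes>\<^bsub>\<Lambda> (grade W a)\<^esub> l)\<rparr>"

text \<open>The Baer sum of \<open>E\<^sub>1\<close> and \<open>E\<^sub>2\<close> is the pushforward of the fibre product
  \<open>E\<^sub>1 \<times>\<^sub>Q E\<^sub>2\<close> along the addition \<open>\<Lambda> \<times> \<Lambda> \<rightarrow> \<Lambda>\<close>, which is a homomorphism for abelian \<open>\<Lambda>\<close>.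
  As for \<open>ext_push\<close>, it is the extension that receives an equivariant homomorphism over \<open>Q\<close>.\<close>

definition baer_homs ::
  "('a, 'i, 'z) wpquandle_scheme \<Rightarrow> ('i \<Rightarrow> ('l, 'g) monoid_scheme)
     \<Rightarrow> ('e, 'a, 'l) qext \<Rightarrow> ('f, 'a, 'l) qext \<Rightarrow> ('d, 'a, 'l) qext \<Rightarrow> ('e \<times> 'f \<Rightarrow> 'd) set" where
  "baer_homs W \<Lambda> E1 E2 E = {F.
     (\<forall>a\<in>carrier W. \<forall>x\<in>fibres E1 {a}. \<forall>y\<in>fibres E2 {a}. F (x, y) \<in> fibres E {a}) \<and>
     (\<forall>a\<in>carrier W. \<forall>x\<in>fibres E1 {a}. \<forall>y\<in>fibres E2 {a}.
      \<forall>b\<in>carrier W. \<forall>x'\<in>fibres E1 {b}. \<forall>y'\<in>fibres E2 {b}.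
        F (x \<triangleright>\<^bsub>total E1\<^esub> x', y \<triangleright>\<^bsub>total E2\<^esub> y') = F (x, y) \<triangleright>\<^bsub>total E\<^esub> F (x', y')) \<and>
     (\<forall>a\<in>carrier W. \<forall>x\<in>fibres E1 {a}. \<forall>y\<in>fibres E2 {a}.
      \<forall>l\<in>carrier (\<Lambda> (grade W a)). \<forall>m\<in>carrier (\<Lambda> (grade W a)).
        F (eact E1 l x, eact E2 m y) = eact E (l \<otimes>\<^bsub>\<Lambda> (grade W a)\<^esub> m) (F (x, y)))}"

definition Ext_module ::
  "('a, 'i, 'z) wpquandle_scheme \<Rightarrow> ('i \<Rightarrow> ('r, 'l) module) \<Rightarrow> ('r, ('a, 'l) extn set) module"
  where "Ext_module W M = \<lparr>carrier = Ext W (coeff_groups M), monoid.mult = undefined, one = undefined,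
     zero = ext_rel W (coeff_groups M) `` {trivial_ext W (coeff_groups M)},
     add = \<lambda>\<xi> \<eta>. {E \<in> exts W (coeff_groups M).
        \<exists>E1\<in>\<xi>. \<exists>E2\<in>\<eta>. baer_homs W (coeff_groups M) E1 E2 E \<noteq> {}},
     smult = \<lambda>r. ext_push W (coeff_groups M) (coeff_groups M) (\<lambda>i. smult (M i) r)\<rparr>"

end

theory Submission
  imports Defs
begin

text \<open>Choosing a section \<open>s\<close> of an extension turns it into a cocycle \<open>f\<close> through
  \<open>s(a) \<triangleright> s(b) = f(a, b) s(a \<triangleright> b)\<close>, and transporting the points of the section along words in
  \<open>Q\<close> turns the cocycle into a homomorphism on the fundamental group. All statements about
  \<open>H\<^sup>2\<close>, \<open>Ext\<close> and \<open>Hom\<close> are proved by exhibiting the three sets, the last one up to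
  conjugation, as quotients of the set \<open>Z\<^sup>2\<close> of cocycles by the same equivalence relation.

  For \<open>Ext\<close>, self-distributivity of the total space says that \<open>f\<close> is a cocycle, and conversely
  every cocycle is realised on \<open>\<Union>\<^sub>a {a} \<times> \<Lambda>\<^sub>a\<close> (\<open>ext_from_cocycle\<close>). The key is
  \<open>ext_hom_iff_cohomologous\<close>: a homomorphism of extensions over \<open>\<phi> : V \<rightarrow> W\<close> and
  \<open>\<psi> : \<Lambda> \<rightarrow> \<Lambda>'\<close> exists if and only if \<open>\<psi> f\<close> is cohomologous to \<open>\<phi>\<^sup>* f'\<close>. For
  identities this is the bijection with \<open>H\<^sup>2\<close>; in general it computes pullbacks and
  pushforwards of extensions, and a variant for two extensions (\<open>baer_homs_iff\<close>) computes Baer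
  sums.

  For \<open>Hom\<close>, the holonomy of \<open>f\<close> along a word \<open>w\<close> from \<open>x\<close> is the element \<open>k\<close> with
  \<open>s(x)\<^sup>w = k s(x\<^sup>w)\<close>. The cocycle equation says precisely that it respects the
  relations of the adjoint group (\<open>holonomy_adj_eq\<close>), so that the holonomy along closed words at
  \<open>q\<^sub>i\<close> defines a homomorphism on \<open>\<pi>\<^sub>1(Q, q\<^sub>i)\<close>. As in the theory of flat bundles, two
  cocycles are cohomologous if and only if these homomorphisms are conjugate (\<open>cohom_imp_conj\<close>,
  \<open>conj_imp_cohom\<close>), and every homomorphism occurs (\<open>loop_holonomy_surj\<close>). The restriction to
  words of degree zero in the definition of \<open>\<pi>\<^sub>1\<close> is harmless and necessary: since
  \<open>q \<triangleright> q = q\<close>, the generator \<open>adj(q)\<close> is central in the stabiliser of \<open>q\<close>, the stabiliser is the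
  product of \<open>\<pi>\<^sub>1\<close> with the powers of \<open>adj(q)\<close>, and \<open>f(q, q) = 1\<close> forces the holonomy to be
  trivial on these powers.

  Naturality then only has to be checked for cocycles, where all maps are given by explicit
  formulas. The same holds for the module structures: cocycles with values in modules form a
  module pointwise, and the three maps out of \<open>Z\<^sup>2\<close> are linear surjections.\<close>

section \<open>Words and the adjoint group\<close>

definition word_inv :: "'a word \<Rightarrow> 'a word" where
  "word_inv w = rev (map (\<lambda>(a, s). (a, \<not> s)) w)"

text \<open>The words that represent the elements of \<open>\<pi>\<^sub>1(Q, x)\<close>.\<close>

definition loops :: "('a, 'z) quandle_scheme \<Rightarrow> 'a \<Rightarrow> 'a word set" where
  "loops Q x = {w \<in> words Q. word_deg w = 0 \<and> word_act Q x w = x}"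

lemma word_act_simps [simp]:
  "word_act Q x [] = x"
  "word_act Q x ((a, s) # w) = word_act Q (if s then x \<triangleright>\<^bsub>Q\<^esub> a else x \<triangleleft>\<^bsub>Q\<^esub> a) w"
  "word_act Q x (u @ v) = word_act Q (word_act Q x u) v"
  by (simp_all add: word_act_def)

lemma word_deg_simps [simp]:
  "word_deg [] = 0"
  "word_deg ((a, s) # w) = (if s then 1 else - 1) + word_deg w"
  "word_deg (u @ v) = word_deg u + word_deg v"
  by (simp_all add: word_deg_def)

lemma words_simps [simp]:
  "[] \<in> words Q"
  "(a, s) # w \<in> words Q \<longleftrightarrow> a \<in> carrier Q \<and> w \<in> words Q"
  "u @ v \<in> words Q \<longleftrightarrow> u \<in> words Q \<and> v \<in> words Q"
  by (auto simp: words_def)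

lemma word_inv_simps [simp]:
  "word_inv [] = []"
  "word_inv ((a, s) # w) = word_inv w @ [(a, \<not> s)]"
  "word_inv (u @ v) = word_inv v @ word_inv u"
  by (simp_all add: word_inv_def)

lemma map_word_simps [simp]:
  "map_word \<phi> [] = []"
  "map_word \<phi> ((a, s) # w) = (\<phi> a, s) # map_word \<phi> w"
  "map_word \<phi> (u @ v) = map_word \<phi> u @ map_word \<phi> v"
  by (simp_all add: map_word_def)

lemma word_inv_words [simp]: "word_inv w \<in> words Q \<longleftrightarrow> w \<in> words Q"
  by (induction w) auto

lemma map_word_words:
  assumes "w \<in> words Q" and "\<phi> \<in> carrier Q \<rightarrow> carrier Q'"
  shows "map_word \<phi> w \<in> words Q'"
  using assms by (induction w) auto

lemma word_deg_map_word [simp]: "word_deg (map_word \<phi> w) = word_deg w"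
  by (induction w) auto

lemma adj_eq_words: "adj_eq Q u v \<Longrightarrow> quandle Q \<Longrightarrow> u \<in> words Q \<and> v \<in> words Q"
  by (induction rule: adj_eq.induct) (auto intro: quandle.qop_closed)

lemma adj_eq_deg: "adj_eq Q u v \<Longrightarrow> word_deg u = word_deg v"
  by (induction rule: adj_eq.induct) auto

lemma adj_rel_iff [simp]: "(u, v) \<in> adj_rel Q \<longleftrightarrow> adj_eq Q u v"
  by (simp add: adj_rel_def)

lemma mem_adj_class: "v \<in> adj_class Q u \<longleftrightarrow> adj_eq Q u v"
  by (simp add: adj_class_def)

context quandle
begin

lemma word_act_closed [simp]:
  "x \<in> carrier Q \<Longrightarrow> w \<in> words Q \<Longrightarrow> word_act Q x w \<in> carrier Q"
  by (induction w arbitrary: x) (auto simp: qop_closed qbar_closed)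

lemma word_act_inv [simp]:
  "x \<in> carrier Q \<Longrightarrow> w \<in> words Q \<Longrightarrow> word_act Q (word_act Q x w) (word_inv w) = x"
  by (induction w arbitrary: x) (auto simp: qop_closed qbar_closed qop_qbar qbar_qop)

lemma word_act_inv2:
  "x \<in> carrier Q \<Longrightarrow> w \<in> words Q \<Longrightarrow> word_act Q x w = y \<Longrightarrow> word_act Q y (word_inv w) = x"
  using word_act_inv by blast

lemma adj_eq_act:
  "adj_eq Q u v \<Longrightarrow> x \<in> carrier Q \<Longrightarrow> word_act Q x u = word_act Q x v"
proof (induction arbitrary: x rule: adj_eq.induct)
  case (adj_cong u u' v v')
  then show ?case using adj_eq_words[OF adj_cong(2)] adj_eq_words[OF adj_cong(1)] quandle_axioms
    by simp
next
  case (adj_relation a b)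
  then show ?case using self_distrib[of "x \<triangleleft> b" a b] by (simp add: qbar_closed qbar_qop)
qed (auto simp: qop_qbar qbar_qop)

lemma adj_eq_cancel:
  assumes "a \<in> carrier Q" "u \<in> words Q" "v \<in> words Q"
  shows "adj_eq Q (u @ [(a, s), (a, \<not> s)] @ v) (u @ v)"
  using adj_cong[OF adj_refl[OF assms(2)] adj_cong[OF adj_inverse[OF assms(1)] adj_refl[OF assms(3)]]]
  by simp

lemma adj_eq_right_inv: "w \<in> words Q \<Longrightarrow> adj_eq Q (w @ word_inv w) []"
proof (induction w rule: rev_induct)
  case Nil
  then show ?case by (simp add: adj_refl)
next
  case (snoc l w)
  obtain a s where l: "l = (a, s)" by (cases l)
  show ?case using snoc adj_trans[OF adj_eq_cancel[of a w "word_inv w" s] snoc.IH] by (simp add: l)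
qed

lemma adj_eq_left_inv: "w \<in> words Q \<Longrightarrow> adj_eq Q (word_inv w @ w) []"
proof (induction w)
  case Nil
  then show ?case by (simp add: adj_refl)
next
  case (Cons l w)
  obtain a s where l: "l = (a, s)" by (cases l)
  show ?case using Cons adj_trans[OF adj_eq_cancel[of a "word_inv w" w "\<not> s"] Cons.IH]
    by (simp add: l)
qed

text \<open>This is \<open>g\<inverse> adj(x) g = adj(x\<^sup>g)\<close>: by the defining relations it holds for generators \<open>g\<close>
  and their inverses, hence for all \<open>g\<close>.\<close>

lemma adj_eq_conj:
  assumes "x \<in> carrier Q" "w \<in> words Q"
  shows "adj_eq Q ((x, True) # w) (w @ [(word_act Q x w, True)])"
  using assms
proof (induction w arbitrary: x)
  case Nil
  then show ?case by (simp add: adj_refl)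
next
  case (Cons l w)
  obtain b s where l: "l = (b, s)" by (cases l)
  have b: "b \<in> carrier Q" and w: "w \<in> words Q" and x: "x \<in> carrier Q" using Cons.prems by (auto simp: l)
  define y where "y = (if s then x \<triangleright> b else x \<triangleleft> b)"
  have y: "y \<in> carrier Q" using b x by (simp add: y_def qop_closed qbar_closed)
  have step: "adj_eq Q [(x, True), (b, s)] [(b, s), (y, True)]"
  proof (cases s)
    case True
    have "adj_eq Q ([(b, True)] @ [(y, True)]) ([(b, True)] @ [(b, False), (x, True), (b, True)])"
      using b x by (intro adj_cong adj_refl) (auto simp: y_def True intro: adj_relation)
    moreover have "adj_eq Q ([] @ [(b, True), (b, \<not> True)] @ [(x, True), (b, True)])
        ([] @ [(x, True), (b, True)])"
      using b x by (intro adj_eq_cancel) auto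
    ultimately show ?thesis by (auto simp: True intro: adj_sym adj_trans)
  next
    case False
    have "adj_eq Q [(y \<triangleright> b, True)] [(b, False), (y, True), (b, True)]"
      using b y by (rule adj_relation[rotated])
    then have "adj_eq Q ([(x, True)] @ [(b, False)]) ([(b, False), (y, True), (b, True)] @ [(b, False)])"
      using b x by (intro adj_cong adj_refl) (auto simp: y_def False qbar_qop)
    moreover have "adj_eq Q ([(b, False), (y, True)] @ [(b, True), (b, \<not> True)] @ [])
        ([(b, False), (y, True)] @ [])"
      using b y by (intro adj_eq_cancel) auto
    ultimately show ?thesis by (auto simp: False intro: adj_trans)
  qed
  have "adj_eq Q ([(x, True), (b, s)] @ w) ([(b, s), (y, True)] @ w)"
    by (intro adj_cong step adj_refl w)
  moreover have "adj_eq Q ([(b, s)] @ (y, True) # w) ([(b, s)] @ w @ [(word_act Q y w, True)])"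
    using b by (intro adj_cong Cons.IH y w adj_refl) simp
  ultimately show ?case by (auto simp: l y_def intro: adj_trans)
qed

lemma adj_class_eq_iff:
  assumes "u \<in> words Q" shows "adj_class Q u = adj_class Q v \<longleftrightarrow> adj_eq Q u v"
proof
  assume "adj_class Q u = adj_class Q v"
  with assms show "adj_eq Q u v" by (metis adj_refl adj_sym mem_adj_class)
next
  assume "adj_eq Q u v"
  then show "adj_class Q u = adj_class Q v"
    by (auto simp: mem_adj_class) (blast intro: adj_sym adj_trans)+
qed

lemma self_mem_adj_class: "w \<in> words Q \<Longrightarrow> w \<in> adj_class Q w"
  by (simp add: mem_adj_class adj_refl)

lemma carrier_Adj: "carrier (Adj Q) = adj_class Q ` words Q"
  by (auto simp: Adj_def quotient_def adj_class_def)

lemma mult_Adj: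
  assumes "u \<in> words Q" "v \<in> words Q"
  shows "adj_class Q u \<otimes>\<^bsub>Adj Q\<^esub> adj_class Q v = adj_class Q (u @ v)"
proof -
  have "x \<in> adj_rel Q `` {u' @ v' | u' v'. u' \<in> adj_class Q u \<and> v' \<in> adj_class Q v}
      \<longleftrightarrow> x \<in> adj_class Q (u @ v)" for x
  proof
    assume "x \<in> adj_class Q (u @ v)"
    then have "(u @ v, x) \<in> adj_rel Q" by (simp add: mem_adj_class)
    moreover have "u \<in> adj_class Q u" "v \<in> adj_class Q v" using assms by (auto simp: mem_adj_class adj_refl)
    ultimately show "x \<in> adj_rel Q `` {u' @ v' | u' v'. u' \<in> adj_class Q u \<and> v' \<in> adj_class Q v}"
      by blast
  qed (auto simp: mem_adj_class intro: adj_trans adj_cong)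
  then show ?thesis by (auto simp: Adj_def)
qed

lemma adj_deg_class:
  assumes "w \<in> words Q" shows "adj_deg (adj_class Q w) = word_deg w"
  unfolding adj_deg_def
proof (rule the_elem_image_unique)
  show "adj_class Q w \<noteq> {}" using self_mem_adj_class[OF assms] by blast
  show "word_deg v = word_deg w" if "v \<in> adj_class Q w" for v
    using adj_eq_deg[of Q w v] that by (simp add: mem_adj_class)
qed

lemma adj_act_class:
  assumes "w \<in> words Q" "x \<in> carrier Q" shows "adj_act Q x (adj_class Q w) = word_act Q x w"
  unfolding adj_act_def
proof (rule the_elem_image_unique)
  show "adj_class Q w \<noteq> {}" using self_mem_adj_class[OF assms(1)] by blast
  show "word_act Q x v = word_act Q x w" if "v \<in> adj_class Q w" for v
    using adj_eq_act[of w v x] that assms(2) by (simp add: mem_adj_class)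
qed

lemma carrier_pi1:
  assumes "x \<in> carrier Q" shows "carrier (pi1 Q x) = adj_class Q ` loops Q x"
  using assms by (auto simp: pi1_def carrier_Adj loops_def adj_deg_class adj_act_class image_iff)

lemma mult_pi1:
  assumes "u \<in> loops Q x" "v \<in> loops Q x"
  shows "adj_class Q u \<otimes>\<^bsub>pi1 Q x\<^esub> adj_class Q v = adj_class Q (u @ v)"
  using assms by (simp add: pi1_def mult_Adj loops_def)

lemma loops_append: "u \<in> loops Q x \<Longrightarrow> v \<in> loops Q x \<Longrightarrow> u @ v \<in> loops Q x"
  by (simp add: loops_def)

lemma adj_eq_loops:
  assumes "adj_eq Q u v" "u \<in> loops Q x" "x \<in> carrier Q" shows "v \<in> loops Q x"
  using assms adj_eq_words[OF assms(1)] adj_eq_act[OF assms(1,3)] adj_eq_deg[OF assms(1)] quandle_axioms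
  by (auto simp: loops_def)

end

section \<open>Components and degrees\<close>

context quandle
begin

lemma right_translation_Bij:
  assumes a: "a \<in> carrier Q"
  shows "(\<lambda>x\<in>carrier Q. x \<triangleright> a) \<in> Bij (carrier Q)"
    and "inv\<^bsub>BijGroup (carrier Q)\<^esub> (\<lambda>x\<in>carrier Q. x \<triangleright> a) = (\<lambda>x\<in>carrier Q. x \<triangleleft> a)"
proof -
  let ?t = "\<lambda>x\<in>carrier Q. x \<triangleright> a"
  have bij: "bij_betw ?t (carrier Q) (carrier Q)"
    by (rule bij_betw_byWitness[where f' = "\<lambda>x. x \<triangleleft> a"])
      (use a in \<open>auto simp: qop_qbar qbar_qop qop_closed qbar_closed\<close>)
  then show B: "?t \<in> Bij (carrier Q)" by (simp add: Bij_def)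
  have "inv_into (carrier Q) ?t x = x \<triangleleft> a" if "x \<in> carrier Q" for x
    using bij that a by (intro inv_into_f_eq) (auto simp: bij_betw_def qbar_closed qbar_qop)
  then show "inv\<^bsub>BijGroup (carrier Q)\<^esub> ?t = (\<lambda>x\<in>carrier Q. x \<triangleleft> a)"
    using inv_BijGroup[OF B] by (auto simp: fun_eq_iff)
qed

text \<open>Inner automorphisms are the actions of words, by this lemma and the next; the components are
  therefore the orbits of words, and inner automorphisms need not be mentioned again.\<close>

lemma Inn_word:
  assumes "\<sigma> \<in> Inn Q"
  shows "\<sigma> \<in> Bij (carrier Q) \<and> (\<exists>w\<in>words Q. \<forall>x\<in>carrier Q. \<sigma> x = word_act Q x w)"
  using assms unfolding Inn_def
proof (induction rule: generate.induct)
  case one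
  show ?case
  proof (intro conjI bexI ballI)
    show "\<one>\<^bsub>BijGroup (carrier Q)\<^esub> \<in> Bij (carrier Q)"
      using group.is_monoid[OF group_BijGroup[of "carrier Q"], THEN monoid.one_closed]
      by (simp add: BijGroup_def)
    show "\<one>\<^bsub>BijGroup (carrier Q)\<^esub> x = word_act Q x []" if "x \<in> carrier Q" for x
      using that by (simp add: BijGroup_def)
  qed simp
next
  case (incl h)
  then obtain a where a: "a \<in> carrier Q" "h = (\<lambda>x\<in>carrier Q. x \<triangleright> a)" by auto
  show ?case
  proof (intro conjI bexI ballI)
    show "h \<in> Bij (carrier Q)" unfolding a(2) by (rule right_translation_Bij(1)[OF a(1)])
    show "h x = word_act Q x [(a, True)]" if "x \<in> carrier Q" for x using that by (simp add: a(2))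
  qed (use a in simp)
next
  case (inv h)
  then obtain a where a: "a \<in> carrier Q" "h = (\<lambda>x\<in>carrier Q. x \<triangleright> a)" by auto
  have "inv\<^bsub>BijGroup (carrier Q)\<^esub> h \<in> carrier (BijGroup (carrier Q))"
    unfolding a(2) using right_translation_Bij(1)[OF a(1)]
    by (intro group.inv_closed[OF group_BijGroup]) (simp only: BijGroup_def partial_object.simps)
  moreover have "\<forall>x\<in>carrier Q. (inv\<^bsub>BijGroup (carrier Q)\<^esub> h) x = word_act Q x [(a, False)]"
    unfolding a(2) right_translation_Bij(2)[OF a(1)] by simp
  moreover have "[(a, False)] \<in> words Q" using a(1) by simp
  ultimately show ?case by (auto simp only: BijGroup_def partial_object.simps)
next
  case (eng h1 h2)
  then obtain u v where uv: "u \<in> words Q" "v \<in> words Q" "\<forall>x\<in>carrier Q. h1 x = word_act Q x u"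
    "\<forall>x\<in>carrier Q. h2 x = word_act Q x v" and B: "h1 \<in> Bij (carrier Q)" "h2 \<in> Bij (carrier Q)"
    by auto
  have "\<forall>x\<in>carrier Q. (h1 \<otimes>\<^bsub>BijGroup (carrier Q)\<^esub> h2) x = word_act Q x (v @ u)"
    using uv B by (simp add: BijGroup_def compose_def)
  moreover have "h1 \<otimes>\<^bsub>BijGroup (carrier Q)\<^esub> h2 \<in> Bij (carrier Q)"
    using compose_Bij[OF B] B by (simp add: BijGroup_def)
  ultimately show ?case using uv(1,2) by (metis words_simps(3))
qed

lemma word_Inn:
  assumes "w \<in> words Q"
  shows "\<exists>\<sigma>\<in>Inn Q. \<forall>x\<in>carrier Q. \<sigma> x = word_act Q x w"
  using assms
proof (induction w)
  case Nil
  have "\<one>\<^bsub>BijGroup (carrier Q)\<^esub> \<in> Inn Q" unfolding Inn_def by (rule generate.one)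
  moreover have "\<forall>x\<in>carrier Q. \<one>\<^bsub>BijGroup (carrier Q)\<^esub> x = word_act Q x []" by (simp add: BijGroup_def)
  ultimately show ?case by blast
next
  case (Cons l w)
  obtain a s where l: "l = (a, s)" by (cases l)
  have a: "a \<in> carrier Q" and w: "w \<in> words Q" using Cons.prems by (auto simp: l)
  obtain \<sigma> where \<sigma>: "\<sigma> \<in> Inn Q" "\<forall>x\<in>carrier Q. \<sigma> x = word_act Q x w" using Cons.IH[OF w] by blast
  define \<tau> where "\<tau> = (\<lambda>x\<in>carrier Q. if s then x \<triangleright> a else x \<triangleleft> a)"
  have "\<tau> = (if s then (\<lambda>x\<in>carrier Q. x \<triangleright> a) else inv\<^bsub>BijGroup (carrier Q)\<^esub> (\<lambda>x\<in>carrier Q. x \<triangleright> a))"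
    using right_translation_Bij(2)[OF a] by (simp add: \<tau>_def)
  then have \<tau>: "\<tau> \<in> Inn Q" unfolding Inn_def using a
    by (auto intro: generate.incl generate.inv)
  have "\<sigma> \<otimes>\<^bsub>BijGroup (carrier Q)\<^esub> \<tau> \<in> Inn Q"
    using \<sigma>(1) \<tau> unfolding Inn_def by (rule generate.eng)
  moreover have "\<forall>x\<in>carrier Q. (\<sigma> \<otimes>\<^bsub>BijGroup (carrier Q)\<^esub> \<tau>) x = word_act Q x (l # w)"
    using \<sigma>(2) Inn_word[OF \<sigma>(1)] Inn_word[OF \<tau>] a
    by (auto simp: BijGroup_def compose_def l \<tau>_def qop_closed qbar_closed)
  ultimately show ?case by blast
qed

lemma qcomponent_words:
  assumes "x \<in> carrier Q" shows "qcomponent Q x = word_act Q x ` words Q"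
proof
  show "qcomponent Q x \<subseteq> word_act Q x ` words Q"
    using assms Inn_word by (fastforce simp: qcomponent_def)
  show "word_act Q x ` words Q \<subseteq> qcomponent Q x"
  proof
    fix y assume "y \<in> word_act Q x ` words Q"
    then obtain w where "w \<in> words Q" "y = word_act Q x w" by blast
    with word_Inn[of w] assms obtain \<sigma> where "\<sigma> \<in> Inn Q" "y = \<sigma> x" by metis
    then show "y \<in> qcomponent Q x" unfolding qcomponent_def by blast
  qed
qed

lemma qcomponent_word_act:
  assumes x: "x \<in> carrier Q" and w: "w \<in> words Q"
  shows "qcomponent Q (word_act Q x w) = qcomponent Q x"
proof -
  have "word_act Q x u \<in> word_act Q (word_act Q x w) ` words Q" if "u \<in> words Q" for u
    by (rule image_eqI[of _ _ "word_inv w @ u"]) (use x w that in auto)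
  moreover have "word_act Q (word_act Q x w) u \<in> word_act Q x ` words Q" if "u \<in> words Q" for u
    by (rule image_eqI[of _ _ "w @ u"]) (use w that in auto)
  ultimately show ?thesis using x w by (auto simp: qcomponent_words)
qed

end

context well_pointed
begin

lemma grade_facts:
  assumes x: "x \<in> carrier W"
  shows grade_Ind: "grade W x \<in> Ind W" and mem_cpt_grade: "x \<in> cpt W (grade W x)"
    and grade_eq: "i \<in> Ind W \<Longrightarrow> x \<in> cpt W i \<Longrightarrow> grade W x = i"
proof -
  have comp: "qcomponent W x = cpt W i" if "i \<in> Ind W" "x \<in> cpt W i" for i
  proof -
    have "x \<in> word_act W (base W i) ` words W"
      using that by (simp add: cpt_def qcomponent_words base_closed)
    then show ?thesis using qcomponent_word_act[of "base W i"] that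
      by (auto simp: cpt_def base_closed)
  qed
  obtain i where i: "i \<in> Ind W" "qcomponent W x = cpt W i" using cpt_exhaust[OF x] by blast
  have "x \<in> qcomponent W x" using x by (auto simp: qcomponent_words image_iff intro: bexI[of _ "[]"])
  then have xi: "x \<in> cpt W i" using i by simp
  have uniq: "j = i" if "j \<in> Ind W" "x \<in> cpt W j" for j
    using cpt_distinct[OF that(1) i(1)] comp[OF that] i(2) by auto
  have g: "grade W x = i" unfolding grade_def using i(1) xi uniq by (intro the_equality) blast+
  show "grade W x \<in> Ind W" "x \<in> cpt W (grade W x)" unfolding g using i(1) xi by simp_all
  show "grade W x = j" if "j \<in> Ind W" "x \<in> cpt W j" for j unfolding g using uniq[OF that] by simp
qed

lemma cpt_words: "i \<in> Ind W \<Longrightarrow> cpt W i = word_act W (base W i) ` words W"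
  by (simp add: cpt_def qcomponent_words base_closed)

lemma cpt_eq: "i \<in> Ind W \<Longrightarrow> cpt W i = {x \<in> carrier W. grade W x = i}"
proof (intro subset_antisym subsetI)
  fix x assume i: "i \<in> Ind W" and x: "x \<in> cpt W i"
  then have "x \<in> carrier W" by (auto simp: cpt_words base_closed)
  then show "x \<in> {x \<in> carrier W. grade W x = i}" using grade_eq i x by simp
qed (use mem_cpt_grade in auto)

lemma grade_word_act [simp]:
  assumes "x \<in> carrier W" "w \<in> words W" shows "grade W (word_act W x w) = grade W x"
proof -
  have "x \<in> word_act W (base W (grade W x)) ` words W"
    using mem_cpt_grade[OF assms(1)] grade_Ind[OF assms(1)] by (simp add: cpt_words)
  then obtain u where u: "u \<in> words W" "x = word_act W (base W (grade W x)) u" by blast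
  then have "word_act W x w = word_act W (base W (grade W x)) (u @ w)" by (metis word_act_simps(3))
  then have "word_act W x w \<in> cpt W (grade W x)"
    unfolding cpt_words[OF grade_Ind[OF assms(1)]]
    by (rule image_eqI) (use assms u(1) in simp)
  then show ?thesis using assms grade_Ind by (intro grade_eq) auto
qed

lemma grade_qop [simp]:
  assumes "x \<in> carrier W" "a \<in> carrier W" shows "grade W (x \<triangleright> a) = grade W x" "grade W (x \<triangleleft> a) = grade W x"
  using grade_word_act[of x "[(a, True)]"] grade_word_act[of x "[(a, False)]"] assms by simp_all

lemma grade_base [simp]: "i \<in> Ind W \<Longrightarrow> grade W (base W i) = i"
  by (rule grade_eq) (auto simp: base_closed cpt_words intro!: image_eqI[of _ _ "[]"])

lemma base_connected:
  assumes "a \<in> carrier W" shows "\<exists>w\<in>words W. word_act W (base W (grade W a)) w = a"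
  using mem_cpt_grade[OF assms] unfolding cpt_words[OF grade_Ind[OF assms]] by (metis imageE)

end

section \<open>Loops at the base point and their degree\<close>

text \<open>The word for \<open>adj(q)\<^sup>n\<close>.\<close>

definition letter_power :: "'a \<Rightarrow> int \<Rightarrow> 'a word" where
  "letter_power q n = replicate (nat \<bar>n\<bar>) (q, 0 \<le> n)"

text \<open>On the stabiliser of \<open>q\<close> in the adjoint group this is the projection to the fundamental
  group along the powers of \<open>adj(q)\<close>.\<close>

definition degree_zero :: "'a \<Rightarrow> 'a word \<Rightarrow> 'a word" where
  "degree_zero q w = w @ letter_power q (- word_deg w)"

lemma letter_power_words: "q \<in> carrier Q \<Longrightarrow> letter_power q n \<in> words Q"
  by (auto simp: letter_power_def words_def in_lists_conv_set)

lemma word_deg_letter_power [simp]: "word_deg (letter_power q n) = n"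
proof -
  have "word_deg (replicate k (q, s)) = (if s then int k else - int k)" for k s
    by (induction k) auto
  then show ?thesis by (simp add: letter_power_def)
qed

lemma set_letter_power: "set (letter_power q n) \<subseteq> {q} \<times> UNIV"
  by (auto simp: letter_power_def)

context quandle
begin

lemma qbar_idem: "q \<in> carrier Q \<Longrightarrow> q \<triangleleft> q = q"
  using qop_qbar[of q q] by (simp add: idem)

lemma word_act_letters:
  "q \<in> carrier Q \<Longrightarrow> set v \<subseteq> {q} \<times> UNIV \<Longrightarrow> word_act Q q v = q"
  by (induction v) (auto simp: idem qbar_idem)

lemma letters_words: "q \<in> carrier Q \<Longrightarrow> set v \<subseteq> {q} \<times> UNIV \<Longrightarrow> v \<in> words Q"
  by (auto simp: words_def in_lists_conv_set)

lemma adj_eq_letter_power_Cons: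
  assumes q: "q \<in> carrier Q"
  shows "adj_eq Q ((q, s) # letter_power q n) (letter_power q (n + (if s then 1 else - 1)))"
proof -
  have rw: "replicate k (q, t) \<in> words Q" for k t using q by (induction k) auto
  have same: "?thesis" if "(q, s) # letter_power q n = letter_power q (n + (if s then 1 else - 1))"
    unfolding that by (intro adj_refl letter_power_words q)
  show ?thesis
  proof (cases "if s then 0 \<le> n else n \<le> 0")
    case True
    then have "(q, s) # letter_power q n = letter_power q (n + (if s then 1 else - 1))"
    proof (cases "n = 0")
      case True
      then show ?thesis by (auto simp: letter_power_def)
    next
      case False
      with True have "nat \<bar>n + (if s then 1 else - 1)\<bar> = Suc (nat \<bar>n\<bar>)" "(0 \<le> n) = s"
        "(0 \<le> n + (if s then 1 else - 1)) = s"
        by (simp_all split: if_splits)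
      then show ?thesis by (simp add: letter_power_def)
    qed
    then show ?thesis by (rule same)
  next
    case False
    define k where "k = nat \<bar>n\<bar> - 1"
    have "letter_power q n = (q, \<not> s) # replicate k (q, \<not> s)"
    proof -
      have "nat \<bar>n\<bar> = Suc k" "(0 \<le> n) = (\<not> s)" using False unfolding k_def by (simp_all split: if_splits)
      then show ?thesis by (simp add: letter_power_def)
    qed
    moreover have "letter_power q (n + (if s then 1 else - 1)) = replicate k (q, \<not> s)"
    proof (cases "k = 0")
      case True
      then have "n + (if s then 1 else - 1) = 0" using False unfolding k_def by (auto split: if_splits)
      then show ?thesis using True by (simp add: letter_power_def)
    next
      case False': False
      have "nat \<bar>n + (if s then 1 else - 1)\<bar> = k" "(0 \<le> n + (if s then 1 else - 1)) = (\<not> s)"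
        using False False' unfolding k_def by (auto split: if_splits)
      then show ?thesis unfolding letter_power_def by simp
    qed
    ultimately show ?thesis using adj_eq_cancel[OF q words_simps(1) rw, of s k "\<not> s"] by simp
  qed
qed

lemma adj_eq_letters_power:
  assumes q: "q \<in> carrier Q" and "set v \<subseteq> {q} \<times> UNIV"
  shows "adj_eq Q (v @ letter_power q n) (letter_power q (word_deg v + n))"
  using assms(2)
proof (induction v)
  case Nil
  then show ?case by (simp add: adj_refl letter_power_words q)
next
  case (Cons l v)
  obtain s where l: "l = (q, s)" using Cons.prems by auto
  have "adj_eq Q ([(q, s)] @ (v @ letter_power q n)) ([(q, s)] @ letter_power q (word_deg v + n))"
    using Cons q by (intro adj_cong adj_refl) auto
  moreover have "adj_eq Q ([(q, s)] @ letter_power q (word_deg v + n))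
      (letter_power q (word_deg (l # v) + n))"
    using adj_eq_letter_power_Cons[OF q, of s "word_deg v + n"] by (simp add: l algebra_simps)
  ultimately have "adj_eq Q ([(q, s)] @ (v @ letter_power q n)) (letter_power q (word_deg (l # v) + n))"
    by (rule adj_trans)
  then show ?case by (simp add: l)
qed

text \<open>The element \<open>adj(q)\<close> is central in the stabiliser of \<open>q\<close>: for \<open>g\<close> in the stabiliser,
  \<open>g\<inverse> adj(q) g = adj(q\<^sup>g) = adj(q)\<close>.\<close>

lemma adj_eq_commute_letters:
  assumes q: "q \<in> carrier Q" and v: "v \<in> words Q" "word_act Q q v = q" and "set u \<subseteq> {q} \<times> UNIV"
  shows "adj_eq Q (u @ v) (v @ u)"
  using assms(4)
proof (induction u)
  case Nil
  then show ?case by (simp add: adj_refl v)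
next
  case (Cons l u)
  obtain s where l: "l = (q, s)" using Cons.prems by auto
  have u: "u \<in> words Q" using Cons.prems q by (intro letters_words) auto
  have pos: "adj_eq Q ([(q, True)] @ v) (v @ [(q, True)])" using adj_eq_conj[OF q v(1)] v(2) by simp
  have "adj_eq Q ([(q, s)] @ v) (v @ [(q, s)])"
  proof (cases s)
    case True
    then show ?thesis using pos by simp
  next
    case False
    have 1: "adj_eq Q ([(q, False)] @ ([(q, True)] @ v) @ [(q, False)]) ([(q, False)] @ (v @ [(q, True)]) @ [(q, False)])"
      by (intro adj_cong pos adj_refl) (simp_all add: q)
    have 2: "adj_eq Q ([(q, False)] @ ([(q, True)] @ v) @ [(q, False)]) (v @ [(q, False)])"
      using adj_eq_cancel[OF q words_simps(1), of "v @ [(q, False)]" False] q v by simp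
    have 3: "adj_eq Q ([(q, False)] @ (v @ [(q, True)]) @ [(q, False)]) ([(q, False)] @ v)"
      using adj_eq_cancel[OF q _ words_simps(1), of "[(q, False)] @ v" True] q v by simp
    show ?thesis using adj_trans[OF adj_sym[OF 3] adj_trans[OF adj_sym[OF 1] 2]] by (simp add: False)
  qed
  then have "adj_eq Q (([(q, s)] @ v) @ u) ((v @ [(q, s)]) @ u)"
    by (rule adj_cong) (rule adj_refl[OF u])
  moreover have "adj_eq Q ([(q, s)] @ (u @ v)) ([(q, s)] @ (v @ u))"
    by (rule adj_cong[OF adj_refl]) (use Cons q in auto)
  then have "adj_eq Q ([(q, s)] @ (u @ v)) (([(q, s)] @ v) @ u)" by simp
  ultimately have "adj_eq Q ([(q, s)] @ (u @ v)) ((v @ [(q, s)]) @ u)"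
    by (rule adj_trans[rotated])
  then show ?case by (simp add: l)
qed

lemma degree_zero_loops:
  assumes "q \<in> carrier Q" "w \<in> words Q" "word_act Q q w = q"
  shows "degree_zero q w \<in> loops Q q"
  using assms word_act_letters[OF assms(1) set_letter_power] letter_power_words[OF assms(1)]
  by (simp add: degree_zero_def loops_def)

text \<open>The correcting power of \<open>adj(q)\<close> between the two factors can be moved to the end.\<close>

lemma degree_zero_append:
  assumes q: "q \<in> carrier Q" and u: "u \<in> words Q" and v: "v \<in> words Q" "word_act Q q v = q"
  shows "adj_eq Q (degree_zero q (u @ v)) (degree_zero q u @ degree_zero q v)"
proof -
  let ?p = "\<lambda>w. letter_power q (- word_deg w)"
  have 1: "adj_eq Q ((u @ v) @ ?p u @ ?p v) ((u @ v) @ ?p (u @ v))"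
    using adj_eq_letters_power[OF q set_letter_power, of "- word_deg u" "- word_deg v"] u v
    by (intro adj_cong adj_refl) (auto simp: algebra_simps)
  have "adj_eq Q (u @ (?p u @ v) @ ?p v) (u @ (v @ ?p u) @ ?p v)"
    by (rule adj_cong[OF adj_refl[OF u] adj_cong[OF adj_eq_commute_letters[OF q v set_letter_power]
          adj_refl[OF letter_power_words[OF q]]]])
  then have 2: "adj_eq Q ((u @ ?p u) @ v @ ?p v) ((u @ v) @ ?p u @ ?p v)" by simp
  show ?thesis unfolding degree_zero_def by (rule adj_sym[OF adj_trans[OF 2 1]])
qed

lemma degree_zero_cong:
  assumes "q \<in> carrier Q" "adj_eq Q u v" shows "adj_eq Q (degree_zero q u) (degree_zero q v)"
  unfolding degree_zero_def adj_eq_deg[OF assms(2)]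
  by (intro adj_cong assms adj_refl letter_power_words)

lemma degree_zero_base: "q \<in> carrier Q \<Longrightarrow> adj_eq Q (degree_zero q [(q, True)]) []"
  using adj_inverse[of q Q True] by (simp add: degree_zero_def letter_power_def)

end

section \<open>Holonomy of cocycles\<close>

locale wp_coeffs = well_pointed W
  for W :: "('a, 'i, 'z) wpquandle_scheme" (structure) +
  fixes \<Lambda> :: "'i \<Rightarrow> ('l, 'g) monoid_scheme"
  assumes graded: "graded_group (Ind W) \<Lambda>"

text \<open>In the extension given by \<open>f\<close>, with underlying set \<open>\<Union>\<^sub>a {a} \<times> \<Lambda>\<^sub>a\<close>, the word \<open>w\<close> takes
  \<open>(x, l)\<close> to \<open>(x\<^sup>w, l k)\<close>, where \<open>k\<close> is the holonomy.\<close>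

fun holonomy ::
  "('a, 'i, 'z) wpquandle_scheme \<Rightarrow> ('i \<Rightarrow> ('l, 'g) monoid_scheme) \<Rightarrow> ('a \<times> 'a \<Rightarrow> 'l)
     \<Rightarrow> 'a \<Rightarrow> 'a word \<Rightarrow> 'l" where
  "holonomy W \<Lambda> f x [] = \<one>\<^bsub>\<Lambda> (grade W x)\<^esub>"
| "holonomy W \<Lambda> f x ((a, s) # w) =
     (if s then f (x, a) \<otimes>\<^bsub>\<Lambda> (grade W x)\<^esub> holonomy W \<Lambda> f (x \<triangleright>\<^bsub>W\<^esub> a) w
      else inv\<^bsub>\<Lambda> (grade W x)\<^esub> f (x \<triangleleft>\<^bsub>W\<^esub> a, a) \<otimes>\<^bsub>\<Lambda> (grade W x)\<^esub> holonomy W \<Lambda> f (x \<triangleleft>\<^bsub>W\<^esub> a) w)"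

definition loop_holonomy ::
  "('a, 'i, 'z) wpquandle_scheme \<Rightarrow> ('i \<Rightarrow> ('l, 'g) monoid_scheme) \<Rightarrow> ('a \<times> 'a \<Rightarrow> 'l)
     \<Rightarrow> 'i \<Rightarrow> 'a word set \<Rightarrow> 'l" where
  "loop_holonomy W \<Lambda> f = (\<lambda>i\<in>Ind W. \<lambda>g\<in>carrier (pi1 W (base W i)).
     holonomy W \<Lambda> f (base W i) (SOME w. w \<in> g))"

context group
begin

lemma mult_eq_one_imp_inv:
  "x \<in> carrier G \<Longrightarrow> y \<in> carrier G \<Longrightarrow> x \<otimes> y = \<one> \<Longrightarrow> y = inv x"
  using inv_equality inv_inv by fastforce

lemma idem_imp_one: "x \<in> carrier G \<Longrightarrow> x \<otimes> x = x \<Longrightarrow> x = \<one>"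
  by simp

end

context wp_coeffs
begin

abbreviation \<L> :: "'a \<Rightarrow> ('l, 'g) monoid_scheme" where
  "\<L> a \<equiv> \<Lambda> (grade W a)"

lemma group_Ind: "i \<in> Ind W \<Longrightarrow> group (\<Lambda> i)"
  using graded by (simp add: graded_group_def)

lemma group_grade: "x \<in> carrier W \<Longrightarrow> group (\<L> x)"
  by (rule group_Ind[OF grade_Ind])

lemma cochain_closed:
  "f \<in> cochains2 W \<Lambda> \<Longrightarrow> a \<in> carrier W \<Longrightarrow> b \<in> carrier W \<Longrightarrow> f (a, b) \<in> carrier (\<L> a)"
  by (auto simp: cochains2_def)

lemma Z2_cochain: "f \<in> Z2 W \<Lambda> \<Longrightarrow> f \<in> cochains2 W \<Lambda>"
  by (simp add: Z2_def)

lemmas Z2_closed = cochain_closed[OF Z2_cochain]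

lemma Z2_diag: "f \<in> Z2 W \<Lambda> \<Longrightarrow> a \<in> carrier W \<Longrightarrow> f (a, a) = \<one>\<^bsub>\<L> a\<^esub>"
  by (simp add: Z2_def)

lemma Z2_cocycle:
  "f \<in> Z2 W \<Lambda> \<Longrightarrow> a \<in> carrier W \<Longrightarrow> b \<in> carrier W \<Longrightarrow> c \<in> carrier W \<Longrightarrow>
     f (a, b) \<otimes>\<^bsub>\<L> a\<^esub> f (a \<triangleright> b, c)
       = f (a, c) \<otimes>\<^bsub>\<L> a\<^esub> f (a \<triangleright> c, b \<triangleright> c)"
  by (simp add: Z2_def)

lemma cochains2_restrict:
  "(\<lambda>(a, b)\<in>carrier W \<times> carrier W. F a b) \<in> cochains2 W \<Lambda> \<longleftrightarrow>
     (\<forall>a\<in>carrier W. \<forall>b\<in>carrier W. F a b \<in> carrier (\<L> a))"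
  by (auto simp: cochains2_def PiE_iff extensional_def)

lemma cochains2_eqI:
  assumes "f \<in> cochains2 W \<Lambda>" "f' \<in> cochains2 W \<Lambda>"
    and "\<And>a b. a \<in> carrier W \<Longrightarrow> b \<in> carrier W \<Longrightarrow> f (a, b) = f' (a, b)"
  shows "f = f'"
  using assms unfolding cochains2_def by (intro PiE_ext) auto

lemma holonomy_closed:
  assumes f: "f \<in> cochains2 W \<Lambda>"
  shows "x \<in> carrier W \<Longrightarrow> w \<in> words W \<Longrightarrow> holonomy W \<Lambda> f x w \<in> carrier (\<L> x)"
proof (induction w arbitrary: x)
  case Nil
  then show ?case using group_grade by (simp add: group.is_monoid monoid.one_closed)
next
  case (Cons l w)
  obtain a s where l: "l = (a, s)" by (cases l)
  interpret G: group "\<L> x" by (rule group_grade[OF Cons.prems(1)])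
  have a: "a \<in> carrier W" "x \<triangleright> a \<in> carrier W" "x \<triangleleft> a \<in> carrier W"
    using Cons.prems by (auto simp: l qop_closed qbar_closed)
  show ?case
    using Cons.prems a Cons.IH[OF a(2)] Cons.IH[OF a(3)] cochain_closed[OF f, of x a]
      cochain_closed[OF f, of "x \<triangleleft> a" a] by (simp add: l)
qed

lemma holonomy_append:
  assumes f: "f \<in> cochains2 W \<Lambda>"
  shows "x \<in> carrier W \<Longrightarrow> u \<in> words W \<Longrightarrow> v \<in> words W \<Longrightarrow>
    holonomy W \<Lambda> f x (u @ v) = holonomy W \<Lambda> f x u \<otimes>\<^bsub>\<L> x\<^esub> holonomy W \<Lambda> f (word_act W x u) v"
proof (induction u arbitrary: x)
  case Nil
  interpret G: group "\<L> x" by (rule group_grade[OF Nil.prems(1)])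
  show ?case using Nil holonomy_closed[OF f] by simp
next
  case (Cons l u)
  obtain a s where l: "l = (a, s)" by (cases l)
  interpret G: group "\<L> x" by (rule group_grade[OF Cons.prems(1)])
  have a: "a \<in> carrier W" "x \<triangleright> a \<in> carrier W" "x \<triangleleft> a \<in> carrier W" and u: "u \<in> words W"
    using Cons.prems by (auto simp: l qop_closed qbar_closed)
  note cl = holonomy_closed[OF f a(2) u] holonomy_closed[OF f a(3) u]
    holonomy_closed[OF f word_act_closed[OF a(2) u] Cons.prems(3)]
    holonomy_closed[OF f word_act_closed[OF a(3) u] Cons.prems(3)]
  show ?case
    using Cons.prems a u Cons.IH[OF a(2)] Cons.IH[OF a(3)] cochain_closed[OF f, of x a] cl
      cochain_closed[OF f, of "x \<triangleleft> a" a] by (simp add: l G.m_assoc)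
qed

text \<open>The defining relation of the adjoint group holds for the holonomy because of the cocycle
  equation at \<open>x \<triangleleft> b\<close>.\<close>

lemma holonomy_adj_eq:
  assumes f: "f \<in> Z2 W \<Lambda>"
  shows "adj_eq W u v \<Longrightarrow> x \<in> carrier W \<Longrightarrow> holonomy W \<Lambda> f x u = holonomy W \<Lambda> f x v"
proof (induction arbitrary: x rule: adj_eq.induct)
  case (adj_cong u u' v v')
  then show ?case
    using adj_eq_words[OF adj_cong(1) quandle_axioms] adj_eq_words[OF adj_cong(2) quandle_axioms]
      adj_eq_act[OF adj_cong(1)] by (simp add: holonomy_append[OF Z2_cochain[OF f]])
next
  case (adj_inverse a s)
  interpret G: group "\<L> x" by (rule group_grade[OF adj_inverse.prems])
  show ?case using adj_inverse Z2_closed[OF f, of x a] Z2_closed[OF f, of "x \<triangleleft> a" a]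
    by (simp add: qop_closed qbar_closed qop_qbar qbar_qop)
next
  case (adj_relation a b)
  interpret G: group "\<L> x" by (rule group_grade[OF adj_relation.prems])
  let ?y = "x \<triangleleft> b"
  have y: "?y \<in> carrier W" "?y \<triangleright> b = x" "?y \<triangleright> a \<in> carrier W" "a \<triangleright> b \<in> carrier W"
    using adj_relation by (simp_all add: qbar_closed qop_closed qbar_qop)
  have cl: "f (?y, b) \<in> carrier (\<L> x)" "f (x, a \<triangleright> b) \<in> carrier (\<L> x)"
     "f (?y, a) \<in> carrier (\<L> x)" "f (?y \<triangleright> a, b) \<in> carrier (\<L> x)"
    using Z2_closed[OF f y(1), of b] Z2_closed[OF f y(1), of a] Z2_closed[OF f y(3), of b]
      Z2_closed[OF f adj_relation.prems y(4)] y adj_relation by simp_all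
  have "f (?y, b) \<otimes>\<^bsub>\<L> x\<^esub> f (x, a \<triangleright> b)
      = f (?y, a) \<otimes>\<^bsub>\<L> x\<^esub> f (?y \<triangleright> a, b)"
    using Z2_cocycle[OF f y(1), of a b] y adj_relation by simp
  then have "f (x, a \<triangleright> b) = inv\<^bsub>\<L> x\<^esub> f (?y, b)
      \<otimes>\<^bsub>\<L> x\<^esub> (f (?y, a) \<otimes>\<^bsub>\<L> x\<^esub> f (?y \<triangleright> a, b))"
    using cl by (metis G.inv_solve_left G.m_closed)
  then show ?case using cl y adj_relation by (simp add: qop_closed)
qed auto

lemma holonomy_word_inv:
  assumes f: "f \<in> Z2 W \<Lambda>" and x: "x \<in> carrier W" and w: "w \<in> words W" and y: "word_act W x w = y"
  shows "holonomy W \<Lambda> f y (word_inv w) = inv\<^bsub>\<L> x\<^esub> holonomy W \<Lambda> f x w"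
proof -
  interpret G: group "\<L> x" by (rule group_grade[OF x])
  have "holonomy W \<Lambda> f x (w @ word_inv w) = \<one>\<^bsub>\<L> x\<^esub>"
    using holonomy_adj_eq[OF f adj_eq_right_inv[OF w] x] by simp
  moreover have "holonomy W \<Lambda> f y (word_inv w) \<in> carrier (\<L> x)"
    using holonomy_closed[OF Z2_cochain[OF f], of y "word_inv w"] x w y by auto
  ultimately show ?thesis
    using holonomy_append[OF Z2_cochain[OF f] x w, of "word_inv w"] w y x
      holonomy_closed[OF Z2_cochain[OF f] x w] by (intro G.mult_eq_one_imp_inv) auto
qed

lemma holonomy_letters:
  assumes f: "f \<in> Z2 W \<Lambda>" and q: "q \<in> carrier W"
  shows "set v \<subseteq> {q} \<times> UNIV \<Longrightarrow> holonomy W \<Lambda> f q v = \<one>\<^bsub>\<L> q\<^esub>"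
proof (induction v)
  case (Cons l v)
  interpret G: group "\<L> q" by (rule group_grade[OF q])
  show ?case using Cons Z2_diag[OF f q] q by (cases l) (auto simp: idem qbar_idem)
qed simp

text \<open>The letter at \<open>q\<close> fixes \<open>q\<close> and has trivial holonomy there, because \<open>f (q, q) = \<one>\<close>; so
  a closed word of any degree can be brought to degree zero without changing its holonomy.\<close>

lemma holonomy_degree_zero:
  assumes f: "f \<in> Z2 W \<Lambda>" and q: "q \<in> carrier W" and w: "w \<in> words W" "word_act W q w = q"
  shows "holonomy W \<Lambda> f q (degree_zero q w) = holonomy W \<Lambda> f q w"
proof -
  interpret G: group "\<L> q" by (rule group_grade[OF q])
  show ?thesis using holonomy_append[OF Z2_cochain[OF f] q w(1) letter_power_words[OF q]]
     holonomy_letters[OF f q set_letter_power] w holonomy_closed[OF Z2_cochain[OF f] q w(1)]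
    by (simp add: degree_zero_def)
qed

lemma some_word:
  assumes "w \<in> words W" shows "adj_eq W w (SOME v. v \<in> adj_class W w)"
  using someI[of "\<lambda>v. v \<in> adj_class W w" w] self_mem_adj_class[OF assms] by (simp add: mem_adj_class)

lemma loop_holonomy_class:
  assumes f: "f \<in> Z2 W \<Lambda>" and i: "i \<in> Ind W" and w: "w \<in> loops W (base W i)"
  shows "loop_holonomy W \<Lambda> f i (adj_class W w) = holonomy W \<Lambda> f (base W i) w"
  using w holonomy_adj_eq[OF f some_word base_closed[OF i]] i
  by (simp add: loop_holonomy_def carrier_pi1 base_closed loops_def)

lemma HomI:
  assumes "h \<in> extensional (Ind W)"
    and "\<And>i. i \<in> Ind W \<Longrightarrow> h i \<in> extensional (carrier (pi1 W (base W i)))"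
    and "\<And>i u. i \<in> Ind W \<Longrightarrow> u \<in> loops W (base W i) \<Longrightarrow> h i (adj_class W u) \<in> carrier (\<Lambda> i)"
    and "\<And>i u v. i \<in> Ind W \<Longrightarrow> u \<in> loops W (base W i) \<Longrightarrow> v \<in> loops W (base W i) \<Longrightarrow>
       h i (adj_class W (u @ v)) = h i (adj_class W u) \<otimes>\<^bsub>\<Lambda> i\<^esub> h i (adj_class W v)"
  shows "h \<in> Hom W \<Lambda>"
  using assms by (auto simp: Hom_def PiE_iff hom_def carrier_pi1 base_closed mult_pi1)

lemma Hom_closed:
  "h \<in> Hom W \<Lambda> \<Longrightarrow> i \<in> Ind W \<Longrightarrow> u \<in> loops W (base W i) \<Longrightarrow> h i (adj_class W u) \<in> carrier (\<Lambda> i)"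
  by (auto simp: Hom_def PiE_iff hom_def carrier_pi1 base_closed Pi_iff)

lemma Hom_mult:
  "h \<in> Hom W \<Lambda> \<Longrightarrow> i \<in> Ind W \<Longrightarrow> u \<in> loops W (base W i) \<Longrightarrow> v \<in> loops W (base W i) \<Longrightarrow>
     h i (adj_class W (u @ v)) = h i (adj_class W u) \<otimes>\<^bsub>\<Lambda> i\<^esub> h i (adj_class W v)"
  by (auto simp: Hom_def PiE_iff hom_def carrier_pi1 base_closed mult_pi1[symmetric])

lemma Hom_eqI:
  assumes "h \<in> Hom W \<Lambda>" "h' \<in> Hom W \<Lambda>"
    and "\<And>i w. i \<in> Ind W \<Longrightarrow> w \<in> loops W (base W i) \<Longrightarrow> h i (adj_class W w) = h' i (adj_class W w)"
  shows "h = h'"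
proof (rule PiE_ext)
  show "h \<in> Pi\<^sub>E (Ind W) (\<lambda>i. {h \<in> hom (pi1 W (base W i)) (\<Lambda> i). h \<in> extensional (carrier (pi1 W (base W i)))})"
    "h' \<in> Pi\<^sub>E (Ind W) (\<lambda>i. {h \<in> hom (pi1 W (base W i)) (\<Lambda> i). h \<in> extensional (carrier (pi1 W (base W i)))})"
    using assms(1,2) by (simp_all add: Hom_def)
  fix i assume i: "i \<in> Ind W"
  show "h i = h' i"
    by (rule extensionalityI[of _ "carrier (pi1 W (base W i))"])
      (use assms i in \<open>auto simp: Hom_def PiE_iff carrier_pi1 base_closed\<close>)
qed

lemma loop_holonomy_Hom:
  assumes f: "f \<in> Z2 W \<Lambda>" shows "loop_holonomy W \<Lambda> f \<in> Hom W \<Lambda>"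
proof (rule HomI)
  show "loop_holonomy W \<Lambda> f \<in> extensional (Ind W)" by (simp add: loop_holonomy_def)
  show "loop_holonomy W \<Lambda> f i \<in> extensional (carrier (pi1 W (base W i)))" if "i \<in> Ind W" for i
    using that by (simp add: loop_holonomy_def)
  fix i u assume i: "i \<in> Ind W" and u: "u \<in> loops W (base W i)"
  show "loop_holonomy W \<Lambda> f i (adj_class W u) \<in> carrier (\<Lambda> i)"
    using holonomy_closed[OF Z2_cochain[OF f] base_closed[OF i], of u] u i
    by (simp add: loop_holonomy_class[OF f i u] loops_def)
  fix v assume v: "v \<in> loops W (base W i)"
  show "loop_holonomy W \<Lambda> f i (adj_class W (u @ v))
      = loop_holonomy W \<Lambda> f i (adj_class W u) \<otimes>\<^bsub>\<Lambda> i\<^esub> loop_holonomy W \<Lambda> f i (adj_class W v)"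
  proof -
    have "u \<in> words W" "v \<in> words W" "word_act W (base W i) u = base W i" using u v by (simp_all add: loops_def)
    then show ?thesis using holonomy_append[OF Z2_cochain[OF f] base_closed[OF i], of u v] i
      by (simp add: loop_holonomy_class[OF f i] u v loops_append)
  qed
qed

text \<open>The factors \<open>g\<close> cancel between consecutive letters; only those at the two ends of the word
  remain.\<close>

lemma holonomy_cohomologous:
  assumes f: "f \<in> Z2 W \<Lambda>" and f': "f' \<in> Z2 W \<Lambda>"
    and g: "\<And>a. a \<in> carrier W \<Longrightarrow> g a \<in> carrier (\<L> a)"
    and eq: "\<And>a b. a \<in> carrier W \<Longrightarrow> b \<in> carrier W \<Longrightarrow>
      f (a, b) = inv\<^bsub>\<L> a\<^esub> g a \<otimes>\<^bsub>\<L> a\<^esub> f' (a, b) \<otimes>\<^bsub>\<L> a\<^esub> g (a \<triangleright> b)"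
  shows "x \<in> carrier W \<Longrightarrow> w \<in> words W \<Longrightarrow> holonomy W \<Lambda> f x w
      = inv\<^bsub>\<L> x\<^esub> g x \<otimes>\<^bsub>\<L> x\<^esub> holonomy W \<Lambda> f' x w
          \<otimes>\<^bsub>\<L> x\<^esub> g (word_act W x w)"
proof (induction w arbitrary: x)
  case Nil
  interpret G: group "\<L> x" by (rule group_grade[OF Nil.prems(1)])
  show ?case using g Nil by simp
next
  case (Cons l w)
  obtain a s where l: "l = (a, s)" by (cases l)
  interpret G: group "\<L> x" by (rule group_grade[OF Cons.prems(1)])
  note x = Cons.prems(1)
  have a: "a \<in> carrier W" "x \<triangleright> a \<in> carrier W" "x \<triangleleft> a \<in> carrier W" and w: "w \<in> words W"
    using Cons.prems by (auto simp: l qop_closed qbar_closed)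
  have gr: "grade W (x \<triangleright> a) = grade W x" "grade W (x \<triangleleft> a) = grade W x" using x a by simp_all
  note cl = g[OF x] g[OF a(2), unfolded gr] g[OF a(3), unfolded gr] Z2_closed[OF f' x a(1)]
    Z2_closed[OF f' a(3,1), unfolded gr] holonomy_closed[OF Z2_cochain[OF f'] a(2) w, unfolded gr]
    holonomy_closed[OF Z2_cochain[OF f'] a(3) w, unfolded gr]
    g[OF word_act_closed[OF a(2) w], unfolded grade_word_act[OF a(2) w] gr]
    g[OF word_act_closed[OF a(3) w], unfolded grade_word_act[OF a(3) w] gr]
  have cancel: "g y \<otimes>\<^bsub>\<L> x\<^esub> (inv\<^bsub>\<L> x\<^esub> g y \<otimes>\<^bsub>\<L> x\<^esub> z) = z"
    if "g y \<in> carrier (\<L> x)" "z \<in> carrier (\<L> x)" for y z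
    using that by (simp add: G.m_assoc[symmetric])
  have "inv\<^bsub>\<L> x\<^esub> (inv\<^bsub>\<L> x\<^esub> g (x \<triangleleft> a) \<otimes>\<^bsub>\<L> x\<^esub> f' (x \<triangleleft> a, a) \<otimes>\<^bsub>\<L> x\<^esub> g x)
     = inv\<^bsub>\<L> x\<^esub> g x \<otimes>\<^bsub>\<L> x\<^esub> (inv\<^bsub>\<L> x\<^esub> f' (x \<triangleleft> a, a) \<otimes>\<^bsub>\<L> x\<^esub> g (x \<triangleleft> a))"
    using cl by (simp add: G.inv_mult_group)
  then show ?case using Cons.IH[OF a(2) w] Cons.IH[OF a(3) w] eq[OF x a(1)] eq[OF a(3,1)] cl x a
    by (simp add: l qbar_qop G.m_assoc cancel)
qed

end

section \<open>Cocycles up to cohomology are homomorphisms up to conjugation\<close>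

context wp_coeffs
begin

lemma Z2I:
  assumes "f \<in> cochains2 W \<Lambda>"
    and "\<And>a. a \<in> carrier W \<Longrightarrow> f (a, a) = \<one>\<^bsub>\<L> a\<^esub>"
    and "\<And>a b c. a \<in> carrier W \<Longrightarrow> b \<in> carrier W \<Longrightarrow> c \<in> carrier W \<Longrightarrow>
       f (a, b) \<otimes>\<^bsub>\<L> a\<^esub> f (a \<triangleright> b, c)
       = f (a, c) \<otimes>\<^bsub>\<L> a\<^esub> f (a \<triangleright> c, b \<triangleright> c)"
  shows "f \<in> Z2 W \<Lambda>"
  using assms by (simp add: Z2_def)

definition cobounds :: "('a \<Rightarrow> 'l) \<Rightarrow> ('a \<times> 'a \<Rightarrow> 'l) \<Rightarrow> ('a \<times> 'a \<Rightarrow> 'l) \<Rightarrow> bool" where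
  "cobounds g f f' \<longleftrightarrow> (\<forall>a\<in>carrier W. g a \<in> carrier (\<L> a)) \<and>
     (\<forall>a\<in>carrier W. \<forall>b\<in>carrier W. f (a, b) =
        inv\<^bsub>\<L> a\<^esub> g a \<otimes>\<^bsub>\<L> a\<^esub> f' (a, b) \<otimes>\<^bsub>\<L> a\<^esub> g (a \<triangleright> b))"

lemma cobounds_closed: "cobounds g f f' \<Longrightarrow> a \<in> carrier W \<Longrightarrow> g a \<in> carrier (\<L> a)"
  and cobounds_eq: "cobounds g f f' \<Longrightarrow> a \<in> carrier W \<Longrightarrow> b \<in> carrier W \<Longrightarrow> f (a, b) =
     inv\<^bsub>\<L> a\<^esub> g a \<otimes>\<^bsub>\<L> a\<^esub> f' (a, b) \<otimes>\<^bsub>\<L> a\<^esub> g (a \<triangleright> b)"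
  by (simp_all add: cobounds_def)

lemma cohom_rel_iff:
  "(f, f') \<in> cohom_rel W \<Lambda> \<longleftrightarrow> f \<in> Z2 W \<Lambda> \<and> f' \<in> Z2 W \<Lambda> \<and> (\<exists>g. cobounds g f f')"
  by (auto simp: cohom_rel_def cobounds_def Pi_iff)

lemma cohom_relI:
  assumes "f \<in> Z2 W \<Lambda>" "f' \<in> Z2 W \<Lambda>"
    and "\<And>a. a \<in> carrier W \<Longrightarrow> g a \<in> carrier (\<L> a)"
    and "\<And>a b. a \<in> carrier W \<Longrightarrow> b \<in> carrier W \<Longrightarrow>
      f (a, b) = inv\<^bsub>\<L> a\<^esub> g a \<otimes>\<^bsub>\<L> a\<^esub> f' (a, b) \<otimes>\<^bsub>\<L> a\<^esub> g (a \<triangleright> b)"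
  shows "(f, f') \<in> cohom_rel W \<Lambda>"
  using assms unfolding cohom_rel_def by blast

definition conjugates ::
  "('i \<Rightarrow> 'l) \<Rightarrow> ('i \<Rightarrow> 'a word set \<Rightarrow> 'l) \<Rightarrow> ('i \<Rightarrow> 'a word set \<Rightarrow> 'l) \<Rightarrow> bool" where
  "conjugates c h h' \<longleftrightarrow> (\<forall>i\<in>Ind W. c i \<in> carrier (\<Lambda> i)) \<and>
     (\<forall>i\<in>Ind W. \<forall>w\<in>loops W (base W i).
        h' i (adj_class W w) = c i \<otimes>\<^bsub>\<Lambda> i\<^esub> h i (adj_class W w) \<otimes>\<^bsub>\<Lambda> i\<^esub> inv\<^bsub>\<Lambda> i\<^esub> c i)"

lemma conjugates_closed: "conjugates c h h' \<Longrightarrow> i \<in> Ind W \<Longrightarrow> c i \<in> carrier (\<Lambda> i)"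
  and conjugates_eq: "conjugates c h h' \<Longrightarrow> i \<in> Ind W \<Longrightarrow> w \<in> loops W (base W i) \<Longrightarrow>
     h' i (adj_class W w) = c i \<otimes>\<^bsub>\<Lambda> i\<^esub> h i (adj_class W w) \<otimes>\<^bsub>\<Lambda> i\<^esub> inv\<^bsub>\<Lambda> i\<^esub> c i"
  by (simp_all add: conjugates_def)

lemma conj_rel_iff:
  "(h, h') \<in> conj_rel W \<Lambda> \<longleftrightarrow> h \<in> Hom W \<Lambda> \<and> h' \<in> Hom W \<Lambda> \<and> (\<exists>c. conjugates c h h')"
  by (auto simp: conj_rel_def conjugates_def Pi_iff carrier_pi1 base_closed)

lemma conj_relI:
  assumes "h \<in> Hom W \<Lambda>" "h' \<in> Hom W \<Lambda>"
    and "\<And>i. i \<in> Ind W \<Longrightarrow> c i \<in> carrier (\<Lambda> i)"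
    and "\<And>i w. i \<in> Ind W \<Longrightarrow> w \<in> loops W (base W i) \<Longrightarrow>
        h' i (adj_class W w) = c i \<otimes>\<^bsub>\<Lambda> i\<^esub> h i (adj_class W w) \<otimes>\<^bsub>\<Lambda> i\<^esub> inv\<^bsub>\<Lambda> i\<^esub> c i"
  shows "(h, h') \<in> conj_rel W \<Lambda>"
  using assms unfolding conj_rel_def by (auto simp: carrier_pi1 base_closed intro!: bexI[of _ c])

lemma equiv_cohom_rel: "equiv (Z2 W \<Lambda>) (cohom_rel W \<Lambda>)"
proof (rule equivI)
  show "cohom_rel W \<Lambda> \<subseteq> Z2 W \<Lambda> \<times> Z2 W \<Lambda>" by (auto simp: cohom_rel_def)
  show "refl_on (Z2 W \<Lambda>) (cohom_rel W \<Lambda>)"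
  proof (rule refl_onI)
    fix f assume f: "f \<in> Z2 W \<Lambda>"
    show "(f, f) \<in> cohom_rel W \<Lambda>"
    proof (rule cohom_relI[OF f f, of "\<lambda>a. \<one>\<^bsub>\<L> a\<^esub>"])
      fix a assume a: "a \<in> carrier W"
      interpret G: group "\<L> a" by (rule group_grade[OF a])
      show "\<one>\<^bsub>\<L> a\<^esub> \<in> carrier (\<L> a)" by simp
      fix b assume b: "b \<in> carrier W"
      show "f (a, b) = inv\<^bsub>\<L> a\<^esub> \<one>\<^bsub>\<L> a\<^esub> \<otimes>\<^bsub>\<L> a\<^esub> f (a, b)
          \<otimes>\<^bsub>\<L> a\<^esub> \<one>\<^bsub>\<L> (a \<triangleright> b)\<^esub>"
        using a b Z2_closed[OF f a b] by simp
    qed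
  qed
  show "sym (cohom_rel W \<Lambda>)"
  proof (rule symI)
    fix f f' assume "(f, f') \<in> cohom_rel W \<Lambda>"
    then obtain g where f: "f \<in> Z2 W \<Lambda>" "f' \<in> Z2 W \<Lambda>"
      and cob: "cobounds g f f'"
      by (auto simp: cohom_rel_iff)
    note g = cobounds_closed[OF cob] and eq = cobounds_eq[OF cob]
    show "(f', f) \<in> cohom_rel W \<Lambda>"
    proof (rule cohom_relI[OF f(2,1), of "\<lambda>a. inv\<^bsub>\<L> a\<^esub> g a"])
      fix a assume a: "a \<in> carrier W"
      interpret G: group "\<L> a" by (rule group_grade[OF a])
      show "inv\<^bsub>\<L> a\<^esub> g a \<in> carrier (\<L> a)" using g[OF a] by simp
      fix b assume b: "b \<in> carrier W"
      have "g (a \<triangleright> b) \<in> carrier (\<L> a)" using g[of "a \<triangleright> b"] a b by (simp add: qop_closed)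
      then show "f' (a, b) = inv\<^bsub>\<L> a\<^esub> (inv\<^bsub>\<L> a\<^esub> g a) \<otimes>\<^bsub>\<L> a\<^esub> f (a, b)
          \<otimes>\<^bsub>\<L> a\<^esub> inv\<^bsub>\<L> (a \<triangleright> b)\<^esub> g (a \<triangleright> b)"
        using a b Z2_closed[OF f(2) a b] g[OF a] eq[OF a b]
        by (simp add: G.m_assoc[symmetric]) (simp add: G.m_assoc)
    qed
  qed
  show "trans (cohom_rel W \<Lambda>)"
  proof (rule transI)
    fix f f' f'' assume "(f, f') \<in> cohom_rel W \<Lambda>" "(f', f'') \<in> cohom_rel W \<Lambda>"
    then obtain g g' where f: "f \<in> Z2 W \<Lambda>" "f'' \<in> Z2 W \<Lambda>"
      and cob: "cobounds g f f'" "cobounds g' f' f''" by (auto simp: cohom_rel_iff)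
    note g = cobounds_closed[OF cob(1)] and g' = cobounds_closed[OF cob(2)]
      and eq = cobounds_eq[OF cob(1)] and eq' = cobounds_eq[OF cob(2)]
    show "(f, f'') \<in> cohom_rel W \<Lambda>"
    proof (rule cohom_relI[OF f, of "\<lambda>a. g' a \<otimes>\<^bsub>\<L> a\<^esub> g a"])
      fix a assume a: "a \<in> carrier W"
      interpret G: group "\<L> a" by (rule group_grade[OF a])
      show "g' a \<otimes>\<^bsub>\<L> a\<^esub> g a \<in> carrier (\<L> a)" using g[OF a] g'[OF a] by simp
      fix b assume b: "b \<in> carrier W"
      have "g (a \<triangleright> b) \<in> carrier (\<L> a)" "g' (a \<triangleright> b) \<in> carrier (\<L> a)"
        using g[of "a \<triangleright> b"] g'[of "a \<triangleright> b"] a b by (simp_all add: qop_closed)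
      then show "f (a, b) = inv\<^bsub>\<L> a\<^esub> (g' a \<otimes>\<^bsub>\<L> a\<^esub> g a) \<otimes>\<^bsub>\<L> a\<^esub> f'' (a, b)
          \<otimes>\<^bsub>\<L> a\<^esub> (g' (a \<triangleright> b) \<otimes>\<^bsub>\<L> (a \<triangleright> b)\<^esub> g (a \<triangleright> b))"
        using a b Z2_closed[OF f(2) a b] g[OF a] eq[OF a b] eq'[OF a b] g'[OF a]
        by (simp add: G.m_assoc G.inv_mult_group)
    qed
  qed
qed

lemma equiv_conj_rel: "equiv (Hom W \<Lambda>) (conj_rel W \<Lambda>)"
proof (rule equivI)
  show "conj_rel W \<Lambda> \<subseteq> Hom W \<Lambda> \<times> Hom W \<Lambda>" by (auto simp: conj_rel_def)
  show "refl_on (Hom W \<Lambda>) (conj_rel W \<Lambda>)"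
  proof (rule refl_onI)
    fix h assume h: "h \<in> Hom W \<Lambda>"
    show "(h, h) \<in> conj_rel W \<Lambda>"
    proof (rule conj_relI[OF h h, of "\<lambda>i. \<one>\<^bsub>\<Lambda> i\<^esub>"])
      fix i assume i: "i \<in> Ind W"
      interpret G: group "\<Lambda> i" by (rule group_Ind[OF i])
      show "\<one>\<^bsub>\<Lambda> i\<^esub> \<in> carrier (\<Lambda> i)" by simp
      fix w assume w: "w \<in> loops W (base W i)"
      show "h i (adj_class W w) = \<one>\<^bsub>\<Lambda> i\<^esub> \<otimes>\<^bsub>\<Lambda> i\<^esub> h i (adj_class W w) \<otimes>\<^bsub>\<Lambda> i\<^esub> inv\<^bsub>\<Lambda> i\<^esub> \<one>\<^bsub>\<Lambda> i\<^esub>"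
        using Hom_closed[OF h i w] by simp
    qed
  qed
  show "sym (conj_rel W \<Lambda>)"
  proof (rule symI)
    fix h h' assume "(h, h') \<in> conj_rel W \<Lambda>"
    then obtain c where h: "h \<in> Hom W \<Lambda>" "h' \<in> Hom W \<Lambda>"
      and conj: "conjugates c h h'"
      by (auto simp: conj_rel_iff)
    note c = conjugates_closed[OF conj] and eq = conjugates_eq[OF conj]
    show "(h', h) \<in> conj_rel W \<Lambda>"
    proof (rule conj_relI[OF h(2,1), of "\<lambda>i. inv\<^bsub>\<Lambda> i\<^esub> c i"])
      fix i assume i: "i \<in> Ind W"
      interpret G: group "\<Lambda> i" by (rule group_Ind[OF i])
      show "inv\<^bsub>\<Lambda> i\<^esub> c i \<in> carrier (\<Lambda> i)" using c[OF i] by simp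
      fix w assume w: "w \<in> loops W (base W i)"
      show "h i (adj_class W w) = inv\<^bsub>\<Lambda> i\<^esub> c i \<otimes>\<^bsub>\<Lambda> i\<^esub> h' i (adj_class W w)
          \<otimes>\<^bsub>\<Lambda> i\<^esub> inv\<^bsub>\<Lambda> i\<^esub> (inv\<^bsub>\<Lambda> i\<^esub> c i)"
        using Hom_closed[OF h(1) i w] c[OF i] eq[OF i w]
        by (simp add: G.m_assoc[symmetric]) (simp add: G.m_assoc)
    qed
  qed
  show "trans (conj_rel W \<Lambda>)"
  proof (rule transI)
    fix h h' h'' assume "(h, h') \<in> conj_rel W \<Lambda>" "(h', h'') \<in> conj_rel W \<Lambda>"
    then obtain c c' where h: "h \<in> Hom W \<Lambda>" "h'' \<in> Hom W \<Lambda>"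
      and conj: "conjugates c h h'" "conjugates c' h' h''" by (auto simp: conj_rel_iff)
    note c = conjugates_closed[OF conj(1)] and c' = conjugates_closed[OF conj(2)]
      and eq = conjugates_eq[OF conj(1)] and eq' = conjugates_eq[OF conj(2)]
    show "(h, h'') \<in> conj_rel W \<Lambda>"
    proof (rule conj_relI[OF h, of "\<lambda>i. c' i \<otimes>\<^bsub>\<Lambda> i\<^esub> c i"])
      fix i assume i: "i \<in> Ind W"
      interpret G: group "\<Lambda> i" by (rule group_Ind[OF i])
      show "c' i \<otimes>\<^bsub>\<Lambda> i\<^esub> c i \<in> carrier (\<Lambda> i)" using c[OF i] c'[OF i] by simp
      fix w assume w: "w \<in> loops W (base W i)"
      show "h'' i (adj_class W w) = c' i \<otimes>\<^bsub>\<Lambda> i\<^esub> c i \<otimes>\<^bsub>\<Lambda> i\<^esub> h i (adj_class W w)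
          \<otimes>\<^bsub>\<Lambda> i\<^esub> inv\<^bsub>\<Lambda> i\<^esub> (c' i \<otimes>\<^bsub>\<Lambda> i\<^esub> c i)"
        using Hom_closed[OF h(1) i w] c[OF i] c'[OF i] eq[OF i w] eq'[OF i w]
        by (simp add: G.m_assoc G.inv_mult_group)
    qed
  qed
qed

lemma Hom_cong:
  assumes "adj_eq W u v" shows "h (adj_class W u) = h (adj_class W v)"
  using assms adj_eq_words[OF assms quandle_axioms] by (metis adj_class_eq_iff)

text \<open>At a closed word the two ends coincide, so a change of section conjugates the holonomy, by
  its value at the base point.\<close>

lemma cohom_imp_conj:
  assumes "(f, f') \<in> cohom_rel W \<Lambda>"
  shows "(loop_holonomy W \<Lambda> f, loop_holonomy W \<Lambda> f') \<in> conj_rel W \<Lambda>"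
proof -
  obtain g where f: "f \<in> Z2 W \<Lambda>" "f' \<in> Z2 W \<Lambda>"
    and cob: "cobounds g f f'"
    using assms by (auto simp: cohom_rel_iff)
  note g = cobounds_closed[OF cob] and eq = cobounds_eq[OF cob]
  show ?thesis
  proof (rule conj_relI[OF loop_holonomy_Hom[OF f(1)] loop_holonomy_Hom[OF f(2)], of "\<lambda>i. g (base W i)"])
    fix i assume i: "i \<in> Ind W"
    interpret G: group "\<Lambda> i" by (rule group_Ind[OF i])
    note q = base_closed[OF i]
    show gi: "g (base W i) \<in> carrier (\<Lambda> i)" using g[OF q] i by simp
    fix w assume w: "w \<in> loops W (base W i)"
    have w': "w \<in> words W" "word_act W (base W i) w = base W i" using w by (simp_all add: loops_def)
    have "holonomy W \<Lambda> f (base W i) w = inv\<^bsub>\<Lambda> i\<^esub> g (base W i) \<otimes>\<^bsub>\<Lambda> i\<^esub> holonomy W \<Lambda> f' (base W i) w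
        \<otimes>\<^bsub>\<Lambda> i\<^esub> g (base W i)"
      using holonomy_cohomologous[OF f g eq q w'(1)] w'(2) i by simp
    then show "loop_holonomy W \<Lambda> f' i (adj_class W w) = g (base W i) \<otimes>\<^bsub>\<Lambda> i\<^esub>
        loop_holonomy W \<Lambda> f i (adj_class W w) \<otimes>\<^bsub>\<Lambda> i\<^esub> inv\<^bsub>\<Lambda> i\<^esub> g (base W i)"
      using holonomy_closed[OF Z2_cochain[OF f(2)] q w'(1)] gi i
      by (simp add: loop_holonomy_class[OF f(1) i w] loop_holonomy_class[OF f(2) i w] G.m_assoc[symmetric])
        (simp add: G.m_assoc)
  qed
qed

text \<open>Write \<open>F(a)\<close> and \<open>F'(a)\<close> for the holonomies of \<open>f\<close> and \<open>f'\<close> along a chosen word from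
  \<open>q\<^sub>i\<close> to \<open>a\<close>. Going from \<open>q\<^sub>i\<close> to \<open>a\<close>, then by the letter \<open>b\<close>, then back to \<open>q\<^sub>i\<close> is a closed
  word, on which the two holonomies are conjugate by \<open>c\<^sub>i\<close>; so \<open>F'(a)\<inverse> c\<^sub>i F(a)\<close> is a cochain
  that relates \<open>f\<close> to \<open>f'\<close>.\<close>

lemma conj_imp_cohom:
  assumes f: "f \<in> Z2 W \<Lambda>" and f': "f' \<in> Z2 W \<Lambda>"
    and conj: "(loop_holonomy W \<Lambda> f, loop_holonomy W \<Lambda> f') \<in> conj_rel W \<Lambda>"
  shows "(f, f') \<in> cohom_rel W \<Lambda>"
proof -
  obtain c where conj: "conjugates c (loop_holonomy W \<Lambda> f) (loop_holonomy W \<Lambda> f')"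
    using conj by (auto simp: conj_rel_iff)
  note c = conjugates_closed[OF conj] and c_eq = conjugates_eq[OF conj]
  let ?q = "\<lambda>a. base W (grade W a)"
  define \<gamma> where "\<gamma> a = (SOME w. w \<in> words W \<and> word_act W (?q a) w = a)" for a
  have \<gamma>: "\<gamma> a \<in> words W" "word_act W (?q a) (\<gamma> a) = a" if "a \<in> carrier W" for a
    using someI_ex[OF base_connected[OF that, unfolded Bex_def]] unfolding \<gamma>_def by blast+
  define g where "g a = inv\<^bsub>\<L> a\<^esub> holonomy W \<Lambda> f' (?q a) (\<gamma> a) \<otimes>\<^bsub>\<L> a\<^esub> c (grade W a)
      \<otimes>\<^bsub>\<L> a\<^esub> holonomy W \<Lambda> f (?q a) (\<gamma> a)" for a
  have F: "holonomy W \<Lambda> k (?q a) (\<gamma> a) \<in> carrier (\<L> a)" if "k \<in> Z2 W \<Lambda>" "a \<in> carrier W" for k a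
    using holonomy_closed[OF Z2_cochain[OF that(1)] base_closed[OF grade_Ind[OF that(2)]] \<gamma>(1)[OF that(2)]]
      grade_Ind[OF that(2)] by simp
  show ?thesis
  proof (rule cohom_relI[OF f f', of g])
    fix a assume a: "a \<in> carrier W"
    let ?i = "grade W a"
    have i: "?i \<in> Ind W" by (rule grade_Ind[OF a])
    interpret G: group "\<Lambda> ?i" by (rule group_Ind[OF i])
    note q = base_closed[OF i]
    show "g a \<in> carrier (\<Lambda> ?i)"
      unfolding g_def using F[OF f a] F[OF f' a] c[OF i] by simp
    fix b assume b: "b \<in> carrier W"
    have ab: "a \<triangleright> b \<in> carrier W" "grade W (a \<triangleright> b) = ?i" using a b by (simp_all add: qop_closed)
    let ?w = "(\<gamma> a @ [(b, True)]) @ word_inv (\<gamma> (a \<triangleright> b))"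
    have w: "?w \<in> words W" "word_act W (?q a) ?w = ?q a"
      using \<gamma>[OF a] \<gamma>[OF ab(1)] b ab q by (auto simp: word_act_inv2)
    have hw: "holonomy W \<Lambda> k (?q a) ?w = holonomy W \<Lambda> k (?q a) (\<gamma> a) \<otimes>\<^bsub>\<Lambda> ?i\<^esub> k (a, b)
        \<otimes>\<^bsub>\<Lambda> ?i\<^esub> inv\<^bsub>\<Lambda> ?i\<^esub> holonomy W \<Lambda> k (?q a) (\<gamma> (a \<triangleright> b))" if k: "k \<in> Z2 W \<Lambda>" for k
    proof -
      have "holonomy W \<Lambda> k (a \<triangleright> b) (word_inv (\<gamma> (a \<triangleright> b)))
          = inv\<^bsub>\<Lambda> ?i\<^esub> holonomy W \<Lambda> k (?q a) (\<gamma> (a \<triangleright> b))"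
        using holonomy_word_inv[OF k q \<gamma>(1)[OF ab(1)]] \<gamma>(2)[OF ab(1)] ab(2) i by simp
      then show ?thesis
        using \<gamma>[OF a] \<gamma>[OF ab(1)] b ab q i Z2_closed[OF k a b]
        by (subst holonomy_append[OF Z2_cochain[OF k] q]) (auto simp: holonomy_append[OF Z2_cochain[OF k] q])
    qed
    have lp: "degree_zero (?q a) ?w \<in> loops W (?q a)" by (rule degree_zero_loops[OF q w])
    have "holonomy W \<Lambda> f' (?q a) ?w = c ?i \<otimes>\<^bsub>\<Lambda> ?i\<^esub> holonomy W \<Lambda> f (?q a) ?w \<otimes>\<^bsub>\<Lambda> ?i\<^esub> inv\<^bsub>\<Lambda> ?i\<^esub> c ?i"
      using c_eq[OF i lp]
      unfolding loop_holonomy_class[OF f i lp] loop_holonomy_class[OF f' i lp]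
        holonomy_degree_zero[OF f q w] holonomy_degree_zero[OF f' q w] .
    then have *: "holonomy W \<Lambda> f' (?q a) (\<gamma> a) \<otimes>\<^bsub>\<Lambda> ?i\<^esub> f' (a, b)
        \<otimes>\<^bsub>\<Lambda> ?i\<^esub> inv\<^bsub>\<Lambda> ?i\<^esub> holonomy W \<Lambda> f' (?q a) (\<gamma> (a \<triangleright> b))
      = c ?i \<otimes>\<^bsub>\<Lambda> ?i\<^esub> (holonomy W \<Lambda> f (?q a) (\<gamma> a) \<otimes>\<^bsub>\<Lambda> ?i\<^esub> f (a, b)
        \<otimes>\<^bsub>\<Lambda> ?i\<^esub> inv\<^bsub>\<Lambda> ?i\<^esub> holonomy W \<Lambda> f (?q a) (\<gamma> (a \<triangleright> b))) \<otimes>\<^bsub>\<Lambda> ?i\<^esub> inv\<^bsub>\<Lambda> ?i\<^esub> c ?i"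
      unfolding hw[OF f] hw[OF f'] .
    have cancel: "v = inv\<^bsub>\<Lambda> ?i\<^esub> (inv\<^bsub>\<Lambda> ?i\<^esub> x' \<otimes>\<^bsub>\<Lambda> ?i\<^esub> d \<otimes>\<^bsub>\<Lambda> ?i\<^esub> x)
        \<otimes>\<^bsub>\<Lambda> ?i\<^esub> v' \<otimes>\<^bsub>\<Lambda> ?i\<^esub> (inv\<^bsub>\<Lambda> ?i\<^esub> y' \<otimes>\<^bsub>\<Lambda> ?i\<^esub> d \<otimes>\<^bsub>\<Lambda> ?i\<^esub> y)"
      if cl: "x \<in> carrier (\<Lambda> ?i)" "x' \<in> carrier (\<Lambda> ?i)" "y \<in> carrier (\<Lambda> ?i)" "y' \<in> carrier (\<Lambda> ?i)"
         "d \<in> carrier (\<Lambda> ?i)" "v \<in> carrier (\<Lambda> ?i)" "v' \<in> carrier (\<Lambda> ?i)"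
        and e: "x' \<otimes>\<^bsub>\<Lambda> ?i\<^esub> v' \<otimes>\<^bsub>\<Lambda> ?i\<^esub> inv\<^bsub>\<Lambda> ?i\<^esub> y'
          = d \<otimes>\<^bsub>\<Lambda> ?i\<^esub> (x \<otimes>\<^bsub>\<Lambda> ?i\<^esub> v \<otimes>\<^bsub>\<Lambda> ?i\<^esub> inv\<^bsub>\<Lambda> ?i\<^esub> y) \<otimes>\<^bsub>\<Lambda> ?i\<^esub> inv\<^bsub>\<Lambda> ?i\<^esub> d"
      for x x' y y' d v v'
    proof -
      have "inv\<^bsub>\<Lambda> ?i\<^esub> (inv\<^bsub>\<Lambda> ?i\<^esub> x' \<otimes>\<^bsub>\<Lambda> ?i\<^esub> d \<otimes>\<^bsub>\<Lambda> ?i\<^esub> x)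
        \<otimes>\<^bsub>\<Lambda> ?i\<^esub> v' \<otimes>\<^bsub>\<Lambda> ?i\<^esub> (inv\<^bsub>\<Lambda> ?i\<^esub> y' \<otimes>\<^bsub>\<Lambda> ?i\<^esub> d \<otimes>\<^bsub>\<Lambda> ?i\<^esub> y)
        = inv\<^bsub>\<Lambda> ?i\<^esub> x \<otimes>\<^bsub>\<Lambda> ?i\<^esub> inv\<^bsub>\<Lambda> ?i\<^esub> d \<otimes>\<^bsub>\<Lambda> ?i\<^esub> (x' \<otimes>\<^bsub>\<Lambda> ?i\<^esub> v' \<otimes>\<^bsub>\<Lambda> ?i\<^esub> inv\<^bsub>\<Lambda> ?i\<^esub> y')
           \<otimes>\<^bsub>\<Lambda> ?i\<^esub> d \<otimes>\<^bsub>\<Lambda> ?i\<^esub> y"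
        using cl by (simp add: G.m_assoc G.inv_mult_group)
      also have "\<dots> = v"
        unfolding e using cl
        by (simp add: G.m_assoc) (simp add: G.m_assoc[symmetric])
      finally show ?thesis by simp
    qed
    have Fab: "holonomy W \<Lambda> k (?q a) (\<gamma> (a \<triangleright> b)) \<in> carrier (\<Lambda> ?i)" if "k \<in> Z2 W \<Lambda>" for k
      using F[OF that ab(1)] ab(2) by simp
    show "f (a, b) = inv\<^bsub>\<Lambda> ?i\<^esub> g a \<otimes>\<^bsub>\<Lambda> ?i\<^esub> f' (a, b) \<otimes>\<^bsub>\<Lambda> ?i\<^esub> g (a \<triangleright> b)"
      unfolding g_def ab(2)
      by (rule cancel[OF F[OF f a] F[OF f' a] Fab[OF f] Fab[OF f'] c[OF i] Z2_closed[OF f a b] Z2_closed[OF f' a b] *])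
  qed
qed

text \<open>The converse construction. The homomorphism \<open>h\<^sub>i\<close> extends to the whole stabiliser of \<open>q\<^sub>i\<close>
  in the adjoint group by \<open>H(w) = h\<^sub>i(w adj(q\<^sub>i)\<^bsup>-deg w\<^esup>)\<close>, since \<open>adj(q\<^sub>i)\<close> is
  central there. With chosen words \<open>\<gamma>(a)\<close> from \<open>q\<^sub>i\<close> to \<open>a\<close> the cocycle is
  \<open>f(a, b) = H(\<gamma>(a) b \<gamma>(a \<triangleright> b)\<inverse>)\<close>. It is \<open>\<one>\<close> on the diagonal as \<open>\<gamma>(a) a \<gamma>(a)\<inverse> = q\<^sub>i\<close>, and
  the cocycle equation expresses \<open>b c = c (b \<triangleright> c)\<close>.\<close>

lemma loop_holonomy_surj:
  assumes h: "h \<in> Hom W \<Lambda>"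
  shows "\<exists>f\<in>Z2 W \<Lambda>. loop_holonomy W \<Lambda> f = h"
proof -
  let ?q = "\<lambda>a. base W (grade W a)"
  \<comment> \<open>The empty word at base points makes the holonomy equal to \<open>h\<close>, and not merely conjugate to it.\<close>
  define \<gamma> where "\<gamma> a = (if a = ?q a then [] else SOME w. w \<in> words W \<and> word_act W (?q a) w = a)" for a
  have \<gamma>: "\<gamma> a \<in> words W" "word_act W (?q a) (\<gamma> a) = a" if "a \<in> carrier W" for a
    using someI_ex[OF base_connected[OF that, unfolded Bex_def]] unfolding \<gamma>_def by auto
  have \<gamma>_base: "\<gamma> (base W i) = []" if "i \<in> Ind W" for i using that by (simp add: \<gamma>_def)
  define H where "H i w = h i (adj_class W (degree_zero (base W i) w))" for i w
  have H_closed: "H i w \<in> carrier (\<Lambda> i)" if "i \<in> Ind W" "w \<in> words W" "word_act W (base W i) w = base W i" for i w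
    unfolding H_def by (rule Hom_closed[OF h that(1) degree_zero_loops[OF base_closed[OF that(1)] that(2,3)]])
  have H_mult: "H i (u @ v) = H i u \<otimes>\<^bsub>\<Lambda> i\<^esub> H i v"
    if i: "i \<in> Ind W" and u: "u \<in> words W" "word_act W (base W i) u = base W i"
      and v: "v \<in> words W" "word_act W (base W i) v = base W i" for i u v
    unfolding H_def Hom_cong[OF degree_zero_append[OF base_closed[OF i] u(1) v]]
    by (rule Hom_mult[OF h i degree_zero_loops[OF base_closed[OF i] u] degree_zero_loops[OF base_closed[OF i] v]])
  have H_cong: "H i u = H i v" if "i \<in> Ind W" "adj_eq W u v" for i u v
    unfolding H_def by (rule Hom_cong[OF degree_zero_cong[OF base_closed[OF that(1)] that(2)]])
  have H_Nil: "H i [] = \<one>\<^bsub>\<Lambda> i\<^esub>" if i: "i \<in> Ind W" for i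
  proof -
    interpret G: group "\<Lambda> i" by (rule group_Ind[OF i])
    show ?thesis using H_mult[OF i, of "[]" "[]"] H_closed[OF i, of "[]"] by (intro G.idem_imp_one) simp_all
  qed
  have H_q: "H i [(base W i, True)] = \<one>\<^bsub>\<Lambda> i\<^esub>" if i: "i \<in> Ind W" for i
    using Hom_cong[OF degree_zero_base[OF base_closed[OF i]], of "h i"] H_Nil[OF i]
    by (simp add: H_def degree_zero_def letter_power_def)
  \<comment> \<open>\<open>P x w\<close> closes up \<open>w\<close>, read from \<open>x\<close>, to a word from \<open>q\<^sub>i\<close> to \<open>q\<^sub>i\<close>. Then \<open>H (P x w)\<close> will turn
    out to be the holonomy of \<open>f\<close> along \<open>w\<close>.\<close>
  define P where "P x w = \<gamma> x @ w @ word_inv (\<gamma> (word_act W x w))" for x w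
  have P: "P x w \<in> words W" "word_act W (?q x) (P x w) = ?q x"
    if "x \<in> carrier W" "w \<in> words W" for x w
  proof -
    have y: "word_act W x w \<in> carrier W" and gr: "grade W (word_act W x w) = grade W x" using that by simp_all
    show "P x w \<in> words W" using that \<gamma>[OF that(1)] \<gamma>[OF y] by (simp add: P_def)
    show "word_act W (?q x) (P x w) = ?q x"
      using word_act_inv2[OF base_closed[OF grade_Ind[OF that(1)]] \<gamma>(1)[OF y]] \<gamma>(2)[OF y] \<gamma>(2)[OF that(1)] gr
      by (simp add: P_def)
  qed
  have P_append: "adj_eq W (P x u @ P (word_act W x u) v) (P x (u @ v))"
    if "x \<in> carrier W" "u \<in> words W" "v \<in> words W" for x u v
  proof -
    have y: "word_act W x u \<in> carrier W" "word_act W x (u @ v) \<in> carrier W" using that by simp_all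
    have "adj_eq W ((\<gamma> x @ u) @ (word_inv (\<gamma> (word_act W x u)) @ \<gamma> (word_act W x u))
        @ (v @ word_inv (\<gamma> (word_act W x (u @ v)))))
       ((\<gamma> x @ u) @ [] @ (v @ word_inv (\<gamma> (word_act W x (u @ v)))))"
      using that \<gamma>(1)[OF that(1)] \<gamma>(1)[OF y(1)] \<gamma>(1)[OF y(2)]
      by (intro adj_cong[OF adj_refl adj_cong[OF adj_eq_left_inv adj_refl]]) simp_all
    then show ?thesis by (simp add: P_def)
  qed
  have P_cong: "adj_eq W (P x u) (P x v)" if "x \<in> carrier W" "adj_eq W u v" for x u v
  proof -
    have "word_act W x v \<in> carrier W" using that adj_eq_words[OF that(2) quandle_axioms] by simp
    then show ?thesis
      unfolding P_def adj_eq_act[OF that(2,1)] using that \<gamma>(1)[OF that(1)] \<gamma>(1)[of "word_act W x v"]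
      by (intro adj_cong[OF adj_refl adj_cong[OF that(2) adj_refl]]) simp_all
  qed
  have HP_append: "H (grade W x) (P x (u @ v)) = H (grade W x) (P x u) \<otimes>\<^bsub>\<L> x\<^esub> H (grade W x) (P (word_act W x u) v)"
    if "x \<in> carrier W" "u \<in> words W" "v \<in> words W" for x u v
    using H_mult[OF grade_Ind[OF that(1)] P[OF that(1,2)], of "P (word_act W x u) v"] P[of "word_act W x u" v] that
      H_cong[OF grade_Ind[OF that(1)] P_append[OF that]] by simp
  define f where "f = (\<lambda>(a, b)\<in>carrier W \<times> carrier W. H (grade W a) (P a [(b, True)]))"
  have f_app: "f (a, b) = H (grade W a) (P a [(b, True)])" if "a \<in> carrier W" "b \<in> carrier W" for a b
    using that by (simp add: f_def)
  have fZ: "f \<in> Z2 W \<Lambda>"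
  proof (rule Z2I)
    show "f \<in> cochains2 W \<Lambda>"
      unfolding f_def cochains2_restrict using H_closed[OF grade_Ind P] by simp
    fix a assume a: "a \<in> carrier W"
    have "adj_eq W (P a [(a, True)]) [(?q a, True)]"
    proof -
      have "adj_eq W ((?q a, True) # \<gamma> a) (\<gamma> a @ [(a, True)])"
        using adj_eq_conj[OF base_closed[OF grade_Ind[OF a]] \<gamma>(1)[OF a]] \<gamma>(2)[OF a] by simp
      from adj_cong[OF adj_sym[OF this] adj_refl[of "word_inv (\<gamma> a)"]]
      have 1: "adj_eq W (P a [(a, True)]) ([(?q a, True)] @ (\<gamma> a @ word_inv (\<gamma> a)))"
        using a \<gamma>(1)[OF a] by (simp add: P_def idem)
      have 2: "adj_eq W ([(?q a, True)] @ (\<gamma> a @ word_inv (\<gamma> a))) ([(?q a, True)] @ [])"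
        by (rule adj_cong[OF adj_refl adj_eq_right_inv[OF \<gamma>(1)[OF a]]])
          (simp add: base_closed[OF grade_Ind[OF a]])
      show ?thesis using adj_trans[OF 1 2] by simp
    qed
    then show "f (a, a) = \<one>\<^bsub>\<L> a\<^esub>"
      using H_cong[OF grade_Ind[OF a]] H_q[OF grade_Ind[OF a]] a by (simp add: f_app)
    fix b c assume b: "b \<in> carrier W" and c: "c \<in> carrier W"
    have "adj_eq W [(b, True), (c, True)] [(c, True), (b \<triangleright> c, True)]"
      using adj_eq_conj[OF b, of "[(c, True)]"] c by simp
    from H_cong[OF grade_Ind[OF a] P_cong[OF a this]]
    have "H (grade W a) (P a ([(b, True)] @ [(c, True)])) = H (grade W a) (P a ([(c, True)] @ [(b \<triangleright> c, True)]))"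
      by simp
    then show "f (a, b) \<otimes>\<^bsub>\<L> a\<^esub> f (a \<triangleright> b, c) = f (a, c) \<otimes>\<^bsub>\<L> a\<^esub> f (a \<triangleright> c, b \<triangleright> c)"
      using HP_append[OF a, of "[(b, True)]" "[(c, True)]"] HP_append[OF a, of "[(c, True)]" "[(b \<triangleright> c, True)]"] a b c
      by (simp add: f_app qop_closed)
  qed
  have hol: "holonomy W \<Lambda> f x w = H (grade W x) (P x w)" if "x \<in> carrier W" "w \<in> words W" for x w
    using that
  proof (induction w arbitrary: x)
    case Nil
    have "adj_eq W (P x []) []" using adj_eq_right_inv[OF \<gamma>(1)[OF Nil(1)]] by (simp add: P_def)
    then show ?case using H_cong[OF grade_Ind[OF Nil(1)]] H_Nil[OF grade_Ind[OF Nil(1)]] by simp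
  next
    case (Cons l w)
    obtain b s where l: "l = (b, s)" by (cases l)
    note x = Cons.prems(1)
    interpret G: group "\<L> x" by (rule group_grade[OF x])
    have b: "b \<in> carrier W" "x \<triangleright> b \<in> carrier W" "x \<triangleleft> b \<in> carrier W" and w: "w \<in> words W"
      using Cons.prems by (auto simp: l qop_closed qbar_closed)
    have "holonomy W \<Lambda> f x [(b, s)] = H (grade W x) (P x [(b, s)])"
    proof (cases s)
      case True
      then show ?thesis using f_app[OF x b(1)] Z2_closed[OF fZ x b(1)] x b by simp
    next
      case False
      have cl: "H (grade W x) (P x [(b, False)]) \<in> carrier (\<L> x)"
        using H_closed[OF grade_Ind[OF x] P[OF x]] b by simp
      have cl': "f (x \<triangleleft> b, b) \<in> carrier (\<L> x)"
        using Z2_closed[OF fZ b(3,1)] x b by simp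
      have "adj_eq W (P (x \<triangleleft> b) ([(b, True)] @ [(b, False)])) (P (x \<triangleleft> b) [])"
        using P_cong[OF b(3) adj_inverse[OF b(1), of True]] by simp
      moreover have "adj_eq W (P (x \<triangleleft> b) []) []"
        using adj_eq_right_inv[OF \<gamma>(1)[OF b(3)]] by (simp add: P_def)
      ultimately have "H (grade W x) (P (x \<triangleleft> b) ([(b, True)] @ [(b, False)])) = \<one>\<^bsub>\<L> x\<^esub>"
        using H_cong[OF grade_Ind[OF x]] H_Nil[OF grade_Ind[OF x]] by metis
      then have "f (x \<triangleleft> b, b) \<otimes>\<^bsub>\<L> x\<^esub> H (grade W x) (P x [(b, False)]) = \<one>\<^bsub>\<L> x\<^esub>"
        using HP_append[OF b(3), of "[(b, True)]" "[(b, False)]"] x b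
        by (simp add: f_app qbar_qop)
      from G.mult_eq_one_imp_inv[OF cl' cl this] show ?thesis
        using False cl' x b by simp
    qed
    then show ?case
      using holonomy_append[OF Z2_cochain[OF fZ] x, of "[(b, s)]" w] HP_append[OF x, of "[(b, s)]" w]
        Cons.IH[OF b(2) w] Cons.IH[OF b(3) w] x b w by (cases s) (simp_all add: l)
  qed
  have "loop_holonomy W \<Lambda> f = h"
  proof (rule Hom_eqI[OF loop_holonomy_Hom[OF fZ] h])
    fix i w assume i: "i \<in> Ind W" and w: "w \<in> loops W (base W i)"
    have w': "w \<in> words W" "word_act W (base W i) w = base W i" "word_deg w = 0"
      using w by (simp_all add: loops_def)
    have "holonomy W \<Lambda> f (base W i) w = H i w"
      using hol[OF base_closed[OF i] w'(1)] i \<gamma>_base[OF i] w'(2) by (simp add: P_def)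
    then show "loop_holonomy W \<Lambda> f i (adj_class W w) = h i (adj_class W w)"
      using w' by (simp add: loop_holonomy_class[OF fZ i w] H_def degree_zero_def letter_power_def)
  qed
  with fZ show ?thesis by blast
qed

end

section \<open>Extensions and their cocycles\<close>

locale wp_ext = wp_coeffs W \<Lambda> + graded_ext W \<Lambda> E
  for W :: "('a, 'i, 'z) wpquandle_scheme" (structure)
    and \<Lambda> :: "'i \<Rightarrow> ('l, 'g) monoid_scheme"
    and E :: "('e, 'a, 'l) qext"
begin

sublocale T: quandle "total E"
  by (rule total_quandle)

abbreviation gr :: "'e \<Rightarrow> 'i" where
  "gr x \<equiv> grade W (proj E x)"

lemma mem_fibre: "x \<in> fibres E {a} \<longleftrightarrow> x \<in> carrier (total E) \<and> proj E x = a"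
  by (simp add: fibres_def)

lemma proj_closed [simp]: "x \<in> carrier (total E) \<Longrightarrow> proj E x \<in> carrier W"
  using proj_hom by (auto simp: quandle_hom_def)

lemma proj_qop [simp]:
  "x \<in> carrier (total E) \<Longrightarrow> y \<in> carrier (total E) \<Longrightarrow> proj E (x \<triangleright>\<^bsub>total E\<^esub> y) = proj E x \<triangleright> proj E y"
  using proj_hom by (auto simp: quandle_hom_def)

lemma proj_qbar [simp]:
  assumes "x \<in> carrier (total E)" "y \<in> carrier (total E)"
  shows "proj E (x \<triangleleft>\<^bsub>total E\<^esub> y) = proj E x \<triangleleft> proj E y"
proof -
  have "proj E (x \<triangleleft>\<^bsub>total E\<^esub> y) \<triangleright> proj E y = proj E x"
    using assms by (simp flip: proj_qop add: T.qbar_closed T.qbar_qop)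
  then show ?thesis using assms qop_qbar[of "proj E (x \<triangleleft>\<^bsub>total E\<^esub> y)" "proj E y"] by (simp add: T.qbar_closed)
qed

lemma mem_fibres_cpt:
  "i \<in> Ind W \<Longrightarrow> x \<in> fibres E (cpt W i) \<longleftrightarrow> x \<in> carrier (total E) \<and> gr x = i"
  by (auto simp: fibres_def cpt_eq)

lemma
  assumes x: "x \<in> carrier (total E)" and l: "l \<in> carrier (\<Lambda> (gr x))"
  shows act_closed: "eact E l x \<in> carrier (total E)" and proj_act: "proj E (eact E l x) = proj E x"
  using E2_fibre[OF grade_Ind[OF proj_closed[OF x]] mem_cpt_grade[OF proj_closed[OF x]] l, of x] x
  by (simp_all add: mem_fibre)

lemma act_one:
  assumes x: "x \<in> carrier (total E)" shows "eact E \<one>\<^bsub>\<Lambda> (gr x)\<^esub> x = x"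
proof -
  have i: "gr x \<in> Ind W" by (rule grade_Ind[OF proj_closed[OF x]])
  have xf: "x \<in> fibres E (cpt W (gr x))" using x i by (simp add: mem_fibres_cpt)
  show ?thesis using fun_cong[OF group_action.id_eq_one[OF action[OF i]], of x] xf by simp
qed

lemma act_mult:
  assumes x: "x \<in> carrier (total E)" and l: "l \<in> carrier (\<Lambda> (gr x))" and m: "m \<in> carrier (\<Lambda> (gr x))"
  shows "eact E (l \<otimes>\<^bsub>\<Lambda> (gr x)\<^esub> m) x = eact E l (eact E m x)"
proof -
  have i: "gr x \<in> Ind W" by (rule grade_Ind[OF proj_closed[OF x]])
  have xf: "x \<in> fibres E (cpt W (gr x))" "eact E m x \<in> fibres E (cpt W (gr x))"
    using x i m by (simp_all add: mem_fibres_cpt act_closed proj_act)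
  show ?thesis using group_action.composition_rule[OF action[OF i] xf(1) l m] xf by simp
qed

lemma act_free:
  assumes x: "x \<in> carrier (total E)" and l: "l \<in> carrier (\<Lambda> (gr x))" and m: "m \<in> carrier (\<Lambda> (gr x))"
    and eq: "eact E l x = eact E m x"
  shows "l = m"
proof -
  have i: "gr x \<in> Ind W" by (rule grade_Ind[OF proj_closed[OF x]])
  interpret G: group "\<Lambda> (gr x)" by (rule group_Ind[OF i])
  have "eact E (inv\<^bsub>\<Lambda> (gr x)\<^esub> m \<otimes>\<^bsub>\<Lambda> (gr x)\<^esub> l) x = eact E (inv\<^bsub>\<Lambda> (gr x)\<^esub> m \<otimes>\<^bsub>\<Lambda> (gr x)\<^esub> m) x"
    using x l m eq by (simp only: act_mult G.inv_closed)
  then have "eact E (inv\<^bsub>\<Lambda> (gr x)\<^esub> m \<otimes>\<^bsub>\<Lambda> (gr x)\<^esub> l) x = x" using x m by (simp add: act_one)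
  then have "inv\<^bsub>\<Lambda> (gr x)\<^esub> m \<otimes>\<^bsub>\<Lambda> (gr x)\<^esub> l = \<one>\<^bsub>\<Lambda> (gr x)\<^esub>"
    using E2_free[OF i mem_cpt_grade[OF proj_closed[OF x]], of _ x] x l m by (simp add: mem_fibre)
  then show ?thesis using l m by (metis G.inv_closed G.mult_eq_one_imp_inv G.inv_inv)
qed

lemma act_transitive:
  assumes "x \<in> carrier (total E)" "y \<in> carrier (total E)" "proj E x = proj E y"
  shows "\<exists>l\<in>carrier (\<Lambda> (gr x)). eact E l x = y"
  using E2_transitive[OF grade_Ind[OF proj_closed[OF assms(1)]] mem_cpt_grade[OF proj_closed[OF assms(1)]], of x y]
    assms by (simp add: mem_fibre)

lemma act_qop:
  assumes "x \<in> carrier (total E)" "y \<in> carrier (total E)" "l \<in> carrier (\<Lambda> (gr x))"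
  shows "eact E l x \<triangleright>\<^bsub>total E\<^esub> y = eact E l (x \<triangleright>\<^bsub>total E\<^esub> y)"
  using E1_left[OF grade_Ind[OF proj_closed[OF assms(1)]] assms(3)] assms
  by (simp add: mem_fibres_cpt grade_Ind)

text \<open>Since \<open>x \<triangleright> l y = x \<triangleright> y\<close> and the action is transitive on fibres, the translations of the total
  space only depend on the projection of the translating element.\<close>

lemma qop_cong_proj:
  assumes "x \<in> carrier (total E)" "y \<in> carrier (total E)" "z \<in> carrier (total E)" "proj E y = proj E z"
  shows "x \<triangleright>\<^bsub>total E\<^esub> y = x \<triangleright>\<^bsub>total E\<^esub> z"
proof -
  obtain l where "l \<in> carrier (\<Lambda> (gr y))" "eact E l y = z" using act_transitive[OF assms(2-4)] by blast
  then show ?thesis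
    using E1_right[OF grade_Ind[OF proj_closed[OF assms(2)]], of l x y] assms
    by (simp add: mem_fibres_cpt grade_Ind)
qed

lemma qbar_cong_proj:
  assumes "x \<in> carrier (total E)" "y \<in> carrier (total E)" "z \<in> carrier (total E)" "proj E y = proj E z"
  shows "x \<triangleleft>\<^bsub>total E\<^esub> y = x \<triangleleft>\<^bsub>total E\<^esub> z"
  using qop_cong_proj[of "x \<triangleleft>\<^bsub>total E\<^esub> y" y z] T.qop_qbar[of "x \<triangleleft>\<^bsub>total E\<^esub> y" z] assms
  by (simp add: T.qbar_closed T.qbar_qop)

lemma act_qbar:
  assumes "x \<in> carrier (total E)" "y \<in> carrier (total E)" "l \<in> carrier (\<Lambda> (gr x))"
  shows "eact E l x \<triangleleft>\<^bsub>total E\<^esub> y = eact E l (x \<triangleleft>\<^bsub>total E\<^esub> y)"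
proof -
  have "eact E l (x \<triangleleft>\<^bsub>total E\<^esub> y) \<triangleright>\<^bsub>total E\<^esub> y = eact E l x"
    using assms by (simp add: act_qop T.qbar_closed T.qbar_qop)
  moreover have "eact E l (x \<triangleleft>\<^bsub>total E\<^esub> y) \<in> carrier (total E)"
    using assms by (intro act_closed) (simp_all add: T.qbar_closed)
  ultimately show ?thesis using T.qop_qbar assms(2) by metis
qed

lemma word_act_act:
  "x \<in> carrier (total E) \<Longrightarrow> w \<in> words (total E) \<Longrightarrow> l \<in> carrier (\<Lambda> (gr x)) \<Longrightarrow>
     word_act (total E) (eact E l x) w = eact E l (word_act (total E) x w)"
  by (induction w arbitrary: x) (auto simp: T.qop_closed T.qbar_closed act_qop act_qbar)

lemma map_word_proj_words: "w \<in> words (total E) \<Longrightarrow> map_word (proj E) w \<in> words W"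
  by (rule map_word_words) auto

lemma lift_word:
  assumes "w \<in> words W" shows "\<exists>v\<in>words (total E). map_word (proj E) v = w"
  using assms
proof (induction w)
  case Nil
  then show ?case by (intro bexI[of _ "[]"]) auto
next
  case (Cons l w)
  obtain a s where l: "l = (a, s)" by (cases l)
  then have "a \<in> proj E ` carrier (total E)" using Cons.prems proj_surj by simp
  then obtain y v where "y \<in> carrier (total E)" "proj E y = a" "v \<in> words (total E)" "map_word (proj E) v = w"
    using Cons l by auto
  then show ?case by (intro bexI[of _ "(y, s) # v"]) (auto simp: l)
qed

definition is_section :: "('a \<Rightarrow> 'e) \<Rightarrow> bool" where
  "is_section s \<longleftrightarrow> (\<forall>a\<in>carrier W. s a \<in> carrier (total E) \<and> proj E (s a) = a)"

definition section_cocycle :: "('a \<Rightarrow> 'e) \<Rightarrow> ('a \<times> 'a \<Rightarrow> 'l) \<Rightarrow> bool" where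
  "section_cocycle s f \<longleftrightarrow> is_section s \<and> f \<in> cochains2 W \<Lambda> \<and>
     (\<forall>a\<in>carrier W. \<forall>b\<in>carrier W. s a \<triangleright>\<^bsub>total E\<^esub> s b = eact E (f (a, b)) (s (a \<triangleright> b)))"

lemma ext_cocycles_iff: "f \<in> ext_cocycles W \<Lambda> E \<longleftrightarrow> (\<exists>s. section_cocycle s f)"
  by (auto simp: ext_cocycles_def section_cocycle_def is_section_def Pi_iff mem_fibre Bex_def)

lemma section_exists: "\<exists>s. is_section s"
proof -
  have "\<forall>a\<in>carrier W. \<exists>x. x \<in> carrier (total E) \<and> proj E x = a"
    using proj_surj by (metis imageE)
  then show ?thesis unfolding is_section_def by metis
qed

lemma is_sectionD: "is_section s \<Longrightarrow> a \<in> carrier W \<Longrightarrow> s a \<in> carrier (total E) \<and> proj E (s a) = a"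
  by (simp add: is_section_def)

lemma section_cocycle_exists:
  assumes s: "is_section s" shows "\<exists>f. section_cocycle s f"
proof -
  have "\<exists>l\<in>carrier (\<L> a). eact E l (s (a \<triangleright> b)) = s a \<triangleright>\<^bsub>total E\<^esub> s b"
    if "a \<in> carrier W" "b \<in> carrier W" for a b
    using act_transitive[of "s (a \<triangleright> b)" "s a \<triangleright>\<^bsub>total E\<^esub> s b"] that is_sectionD[OF s]
    by (simp add: qop_closed T.qop_closed)
  then obtain F where F: "\<And>a b. a \<in> carrier W \<Longrightarrow> b \<in> carrier W \<Longrightarrow>
      F a b \<in> carrier (\<L> a) \<and> eact E (F a b) (s (a \<triangleright> b)) = s a \<triangleright>\<^bsub>total E\<^esub> s b"
    by metis
  have "section_cocycle s (\<lambda>(a, b)\<in>carrier W \<times> carrier W. F a b)"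
    unfolding section_cocycle_def cochains2_restrict using s F by simp
  then show ?thesis by blast
qed

lemma ext_cocycles_nonempty: "\<exists>f. f \<in> ext_cocycles W \<Lambda> E"
  using section_exists section_cocycle_exists ext_cocycles_iff by blast

end

locale ext_section = wp_ext W \<Lambda> E
  for W :: "('a, 'i, 'z) wpquandle_scheme" (structure)
    and \<Lambda> :: "'i \<Rightarrow> ('l, 'g) monoid_scheme"
    and E :: "('e, 'a, 'l) qext" +
  fixes s :: "'a \<Rightarrow> 'e" and f :: "'a \<times> 'a \<Rightarrow> 'l"
  assumes sf: "section_cocycle s f"
begin

lemma s_closed [simp]: "a \<in> carrier W \<Longrightarrow> s a \<in> carrier (total E)"
  and proj_s [simp]: "a \<in> carrier W \<Longrightarrow> proj E (s a) = a"
  and f_cochain: "f \<in> cochains2 W \<Lambda>"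
  and s_qop: "a \<in> carrier W \<Longrightarrow> b \<in> carrier W \<Longrightarrow> s a \<triangleright>\<^bsub>total E\<^esub> s b = eact E (f (a, b)) (s (a \<triangleright> b))"
  using sf by (simp_all add: section_cocycle_def is_section_def)

lemma f_closed: "a \<in> carrier W \<Longrightarrow> b \<in> carrier W \<Longrightarrow> f (a, b) \<in> carrier (\<L> a)"
  by (rule cochain_closed[OF f_cochain])

lemma s_free:
  assumes "a \<in> carrier W" "l \<in> carrier (\<L> a)" "m \<in> carrier (\<L> a)"
    "eact E l (s a) = eact E m (s a)"
  shows "l = m"
  using act_free[of "s a" l m] assms by simp

text \<open>The cocycle equation is self-distributivity of the total space for \<open>s(a)\<close>, \<open>s(b)\<close>, \<open>s(c)\<close>;
  freeness of the action allows to compare coefficients.\<close>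

lemma f_Z2: "f \<in> Z2 W \<Lambda>"
proof (rule Z2I[OF f_cochain])
  fix a assume a: "a \<in> carrier W"
  interpret G: group "\<L> a" by (rule group_grade[OF a])
  have "eact E (f (a, a)) (s a) = eact E \<one>\<^bsub>\<L> a\<^esub> (s a)"
    using s_qop[OF a a] a act_one[of "s a"] by (simp add: idem T.idem)
  then show "f (a, a) = \<one>\<^bsub>\<L> a\<^esub>" by (intro s_free[OF a f_closed[OF a a]]) simp_all
  fix b c assume b: "b \<in> carrier W" and c: "c \<in> carrier W"
  let ?x = "(a \<triangleright> b) \<triangleright> c"
  have cl: "a \<triangleright> b \<in> carrier W" "a \<triangleright> c \<in> carrier W" "b \<triangleright> c \<in> carrier W" "?x \<in> carrier W"
    using a b c by (simp_all add: qop_closed)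
  have fcl: "f (a, b) \<in> carrier (\<L> a)" "f (a, c) \<in> carrier (\<L> a)"
    "f (a \<triangleright> b, c) \<in> carrier (\<L> a)" "f (a \<triangleright> c, b \<triangleright> c) \<in> carrier (\<L> a)"
    "f (b, c) \<in> carrier (\<L> b)"
    using f_closed[OF a b] f_closed[OF a c] f_closed[OF cl(1) c] f_closed[OF cl(2,3)] f_closed[OF b c] a b c by simp_all
  have "(s a \<triangleright>\<^bsub>total E\<^esub> s b) \<triangleright>\<^bsub>total E\<^esub> s c = eact E (f (a, b)) (eact E (f (a \<triangleright> b, c)) (s ?x))"
    using a b c cl fcl by (simp add: s_qop act_qop)
  moreover have "(s a \<triangleright>\<^bsub>total E\<^esub> s c) \<triangleright>\<^bsub>total E\<^esub> (s b \<triangleright>\<^bsub>total E\<^esub> s c)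
      = (s a \<triangleright>\<^bsub>total E\<^esub> s c) \<triangleright>\<^bsub>total E\<^esub> s (b \<triangleright> c)"
    using a b c cl by (intro qop_cong_proj) (simp_all add: T.qop_closed)
  moreover have "(s a \<triangleright>\<^bsub>total E\<^esub> s c) \<triangleright>\<^bsub>total E\<^esub> s (b \<triangleright> c)
      = eact E (f (a, c)) (eact E (f (a \<triangleright> c, b \<triangleright> c)) (s ?x))"
    using a b c cl fcl by (simp add: s_qop act_qop self_distrib)
  ultimately have "eact E (f (a, b) \<otimes>\<^bsub>\<L> a\<^esub> f (a \<triangleright> b, c)) (s ?x)
      = eact E (f (a, c) \<otimes>\<^bsub>\<L> a\<^esub> f (a \<triangleright> c, b \<triangleright> c)) (s ?x)"
    using act_mult[of "s ?x" "f (a, b)" "f (a \<triangleright> b, c)"] act_mult[of "s ?x" "f (a, c)" "f (a \<triangleright> c, b \<triangleright> c)"]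
      T.self_distrib[of "s a" "s b" "s c"] a b c cl fcl by simp
  then show "f (a, b) \<otimes>\<^bsub>\<L> a\<^esub> f (a \<triangleright> b, c) = f (a, c) \<otimes>\<^bsub>\<L> a\<^esub> f (a \<triangleright> c, b \<triangleright> c)"
    using a b c cl fcl by (intro s_free[OF cl(4)]) simp_all
qed

lemma s_word_act:
  "x \<in> carrier W \<Longrightarrow> w \<in> words (total E) \<Longrightarrow>
     word_act (total E) (s x) w
       = eact E (holonomy W \<Lambda> f x (map_word (proj E) w)) (s (word_act W x (map_word (proj E) w)))"
proof (induction w arbitrary: x)
  case Nil
  then show ?case using act_one[of "s x"] by simp
next
  case (Cons l w)
  obtain y t where l: "l = (y, t)" by (cases l)
  note x = Cons.prems(1)
  interpret G: group "\<L> x" by (rule group_grade[OF x])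
  define a where "a = proj E y"
  have y: "y \<in> carrier (total E)" and w: "w \<in> words (total E)" using Cons.prems by (auto simp: l)
  have a: "a \<in> carrier W" "x \<triangleright> a \<in> carrier W" "x \<triangleleft> a \<in> carrier W"
    using x y by (simp_all add: a_def qop_closed qbar_closed)
  note pw = map_word_proj_words[OF w]
  let ?w = "map_word (proj E) w"
  show ?case
  proof (cases t)
    case True
    have "s x \<triangleright>\<^bsub>total E\<^esub> y = eact E (f (x, a)) (s (x \<triangleright> a))"
      using qop_cong_proj[OF s_closed[OF x] y s_closed[OF a(1)]] proj_s[OF a(1)] s_qop[OF x a(1)]
      by (metis a_def)
    then have "word_act (total E) (s x) (l # w)
        = eact E (f (x, a)) (eact E (holonomy W \<Lambda> f (x \<triangleright> a) ?w) (s (word_act W (x \<triangleright> a) ?w)))"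
      using True a w x f_closed[OF x a(1)] Cons.IH[OF a(2) w] by (simp add: l word_act_act)
    also have "\<dots> = eact E (f (x, a) \<otimes>\<^bsub>\<L> x\<^esub> holonomy W \<Lambda> f (x \<triangleright> a) ?w) (s (word_act W (x \<triangleright> a) ?w))"
      using act_mult[of "s (word_act W (x \<triangleright> a) ?w)" "f (x, a)" "holonomy W \<Lambda> f (x \<triangleright> a) ?w"]
        f_closed[OF x a(1)] holonomy_closed[OF f_cochain a(2) pw] a x pw by simp
    finally show ?thesis using True by (simp add: l a_def)
  next
    case False
    let ?k = "inv\<^bsub>\<L> x\<^esub> f (x \<triangleleft> a, a)"
    have fc: "f (x \<triangleleft> a, a) \<in> carrier (\<L> x)" using f_closed[OF a(3,1)] x a by simp
    have cl: "eact E ?k (s (x \<triangleleft> a)) \<in> carrier (total E)" using a x fc by (intro act_closed) simp_all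
    have "eact E ?k (s (x \<triangleleft> a)) \<triangleright>\<^bsub>total E\<^esub> s a = eact E ?k (eact E (f (x \<triangleleft> a, a)) (s x))"
      using a x fc by (simp add: act_qop s_qop qbar_qop)
    also have "\<dots> = s x"
      using act_mult[of "s x" ?k "f (x \<triangleleft> a, a)"] a x fc act_one[of "s x"] by simp
    finally have "s x \<triangleleft>\<^bsub>total E\<^esub> s a = eact E ?k (s (x \<triangleleft> a))"
      using T.qop_qbar[OF cl s_closed[OF a(1)]] by simp
    then have "s x \<triangleleft>\<^bsub>total E\<^esub> y = eact E ?k (s (x \<triangleleft> a))"
      using qbar_cong_proj[OF s_closed[OF x] y s_closed[OF a(1)]] proj_s[OF a(1)] by (metis a_def)
    then have "word_act (total E) (s x) (l # w)
        = eact E ?k (eact E (holonomy W \<Lambda> f (x \<triangleleft> a) ?w) (s (word_act W (x \<triangleleft> a) ?w)))"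
      using False a w x fc Cons.IH[OF a(3) w] by (simp add: l word_act_act)
    also have "\<dots> = eact E (?k \<otimes>\<^bsub>\<L> x\<^esub> holonomy W \<Lambda> f (x \<triangleleft> a) ?w) (s (word_act W (x \<triangleleft> a) ?w))"
      using act_mult[of "s (word_act W (x \<triangleleft> a) ?w)" ?k "holonomy W \<Lambda> f (x \<triangleleft> a) ?w"]
        fc holonomy_closed[OF f_cochain a(3) pw] a x pw by simp
    finally show ?thesis using False by (simp add: l a_def)
  qed
qed

text \<open>The coefficient of \<open>x\<close> relative to the section; it is unique because the action is free.\<close>

definition coord :: "'e \<Rightarrow> 'l" where
  "coord x = (SOME l. l \<in> carrier (\<Lambda> (gr x)) \<and> eact E l (s (proj E x)) = x)"

lemma coord:
  assumes "x \<in> carrier (total E)"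
  shows coord_closed: "coord x \<in> carrier (\<Lambda> (gr x))" and act_coord: "eact E (coord x) (s (proj E x)) = x"
proof -
  have "\<exists>l. l \<in> carrier (\<Lambda> (gr x)) \<and> eact E l (s (proj E x)) = x"
    using act_transitive[of "s (proj E x)" x] assms by auto
  from someI_ex[OF this] show "coord x \<in> carrier (\<Lambda> (gr x))" "eact E (coord x) (s (proj E x)) = x"
    unfolding coord_def by blast+
qed

lemma coord_eq:
  assumes "a \<in> carrier W" "l \<in> carrier (\<L> a)" shows "coord (eact E l (s a)) = l"
proof -
  have x: "eact E l (s a) \<in> carrier (total E)" "proj E (eact E l (s a)) = a"
    using assms by (simp_all add: act_closed proj_act)
  show ?thesis using coord[OF x(1)] assms x by (intro s_free[OF assms(1)]) simp_all
qed

lemma coord_act: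
  assumes "x \<in> carrier (total E)" "l \<in> carrier (\<Lambda> (gr x))"
  shows "coord (eact E l x) = l \<otimes>\<^bsub>\<Lambda> (gr x)\<^esub> coord x"
proof -
  interpret G: group "\<Lambda> (gr x)" by (rule group_grade[OF proj_closed[OF assms(1)]])
  have "eact E l x = eact E (l \<otimes>\<^bsub>\<Lambda> (gr x)\<^esub> coord x) (s (proj E x))"
    using act_mult[of "s (proj E x)" l "coord x"] coord[OF assms(1)] assms by simp
  then show ?thesis using coord_eq[of "proj E x" "l \<otimes>\<^bsub>\<Lambda> (gr x)\<^esub> coord x"] coord(1)[OF assms(1)] assms by simp
qed

lemma coord_qop:
  assumes x: "x \<in> carrier (total E)" and y: "y \<in> carrier (total E)"
  shows "coord (x \<triangleright>\<^bsub>total E\<^esub> y) = coord x \<otimes>\<^bsub>\<Lambda> (gr x)\<^esub> f (proj E x, proj E y)"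
proof -
  let ?a = "proj E x" and ?b = "proj E y"
  interpret G: group "\<Lambda> (gr x)" by (rule group_grade[OF proj_closed[OF x]])
  have ab: "?a \<in> carrier W" "?b \<in> carrier W" "?a \<triangleright> ?b \<in> carrier W" using x y by (simp_all add: qop_closed)
  have "x \<triangleright>\<^bsub>total E\<^esub> y = eact E (coord x) (s ?a) \<triangleright>\<^bsub>total E\<^esub> s ?b"
    using qop_cong_proj[of x y "s ?b"] x y act_coord[OF x] by simp
  also have "\<dots> = eact E (coord x) (eact E (f (?a, ?b)) (s (?a \<triangleright> ?b)))"
    using ab coord_closed[OF x] by (simp add: act_qop s_qop)
  also have "\<dots> = eact E (coord x \<otimes>\<^bsub>\<Lambda> (gr x)\<^esub> f (?a, ?b)) (s (?a \<triangleright> ?b))"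
    using act_mult[of "s (?a \<triangleright> ?b)" "coord x" "f (?a, ?b)"] ab coord_closed[OF x] f_closed[OF ab(1,2)] by simp
  finally show ?thesis
    using coord_eq[OF ab(3), of "coord x \<otimes>\<^bsub>\<Lambda> (gr x)\<^esub> f (?a, ?b)"] ab coord_closed[OF x] f_closed[OF ab(1,2)] by simp
qed

end

lemma wp_id: "id \<in> wp_hom W W"
  by (simp add: wp_hom_def quandle_hom_def)

definition push_cochain ::
  "('a, 'i, 'z) wpquandle_scheme \<Rightarrow> ('i \<Rightarrow> 'l \<Rightarrow> 'm) \<Rightarrow> ('a \<times> 'a \<Rightarrow> 'l) \<Rightarrow> ('a \<times> 'a \<Rightarrow> 'm)" where
  "push_cochain W \<psi> f = (\<lambda>(a, b)\<in>carrier W \<times> carrier W. \<psi> (grade W a) (f (a, b)))"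

definition pull_cochain ::
  "('a, 'i, 'z) wpquandle_scheme \<Rightarrow> ('a \<Rightarrow> 'b) \<Rightarrow> ('b \<times> 'b \<Rightarrow> 'l) \<Rightarrow> ('a \<times> 'a \<Rightarrow> 'l)" where
  "pull_cochain V \<phi> f = (\<lambda>(a, b)\<in>carrier V \<times> carrier V. f (\<phi> a, \<phi> b))"

lemma push_cochain_app [simp]:
  "a \<in> carrier W \<Longrightarrow> b \<in> carrier W \<Longrightarrow> push_cochain W \<psi> f (a, b) = \<psi> (grade W a) (f (a, b))"
  by (simp add: push_cochain_def)

lemma pull_cochain_app [simp]:
  "a \<in> carrier V \<Longrightarrow> b \<in> carrier V \<Longrightarrow> pull_cochain V \<phi> f (a, b) = f (\<phi> a, \<phi> b)"
  by (simp add: pull_cochain_def)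

section \<open>Homomorphisms of extensions are relations between cocycles\<close>

context wp_ext
begin

lemma mem_ext_hom:
  "F \<in> ext_hom W \<Lambda> \<phi> \<psi> E E' \<longleftrightarrow>
    (\<forall>x\<in>carrier (total E). F x \<in> carrier (total E') \<and> proj E' (F x) = \<phi> (proj E x)) \<and>
    (\<forall>x\<in>carrier (total E). \<forall>y\<in>carrier (total E). F (x \<triangleright>\<^bsub>total E\<^esub> y) = F x \<triangleright>\<^bsub>total E'\<^esub> F y) \<and>
    (\<forall>x\<in>carrier (total E). \<forall>l\<in>carrier (\<Lambda> (gr x)). F (eact E l x) = eact E' (\<psi> (gr x) l) (F x))"
proof -
  have "(\<forall>i\<in>Ind W. \<forall>l\<in>carrier (\<Lambda> i). \<forall>x\<in>fibres E (cpt W i). F (eact E l x) = eact E' (\<psi> i l) (F x))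
     \<longleftrightarrow> (\<forall>x\<in>carrier (total E). \<forall>l\<in>carrier (\<Lambda> (gr x)). F (eact E l x) = eact E' (\<psi> (gr x) l) (F x))"
    using mem_fibres_cpt grade_Ind[OF proj_closed] by auto
  then show ?thesis by (auto simp: ext_hom_def quandle_hom_def Pi_iff)
qed

end

locale wp_map = V: well_pointed V + W: well_pointed W
  for V :: "('a, 'i, 'y) wpquandle_scheme" and W :: "('b, 'i, 'z) wpquandle_scheme" +
  fixes \<phi> :: "'a \<Rightarrow> 'b"
  assumes \<phi>: "\<phi> \<in> wp_hom V W"
begin

lemma Ind_eq: "Ind V = Ind W"
  and base_map: "i \<in> Ind W \<Longrightarrow> \<phi> (base V i) = base W i"
  and map_closed [simp]: "a \<in> carrier V \<Longrightarrow> \<phi> a \<in> carrier W"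
  and map_qop: "a \<in> carrier V \<Longrightarrow> b \<in> carrier V \<Longrightarrow> \<phi> (a \<triangleright>\<^bsub>V\<^esub> b) = \<phi> a \<triangleright>\<^bsub>W\<^esub> \<phi> b"
  using \<phi> by (auto simp: wp_hom_def quandle_hom_def)

lemma map_qbar:
  assumes "a \<in> carrier V" "b \<in> carrier V" shows "\<phi> (a \<triangleleft>\<^bsub>V\<^esub> b) = \<phi> a \<triangleleft>\<^bsub>W\<^esub> \<phi> b"
  using W.qop_qbar[of "\<phi> (a \<triangleleft>\<^bsub>V\<^esub> b)" "\<phi> b"] map_qop[of "a \<triangleleft>\<^bsub>V\<^esub> b" b] assms
  by (simp add: V.qbar_closed V.qbar_qop)

lemma map_word_act:
  "x \<in> carrier V \<Longrightarrow> w \<in> words V \<Longrightarrow> \<phi> (word_act V x w) = word_act W (\<phi> x) (map_word \<phi> w)"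
  by (induction w arbitrary: x) (auto simp: map_qop map_qbar V.qop_closed V.qbar_closed)

lemma map_words: "w \<in> words V \<Longrightarrow> map_word \<phi> w \<in> words W"
  by (rule map_word_words) auto

lemma grade_map [simp]:
  assumes "a \<in> carrier V" shows "grade W (\<phi> a) = grade V a"
proof -
  note i = V.grade_Ind[OF assms]
  obtain w where w: "w \<in> words V" "word_act V (base V (grade V a)) w = a"
    using V.base_connected[OF assms] by blast
  have "\<phi> a = word_act W (base W (grade V a)) (map_word \<phi> w)"
    using map_word_act[OF V.base_closed[OF i] w(1)] w(2) base_map i Ind_eq by simp
  then show ?thesis
    using W.grade_word_act[OF W.base_closed map_words[OF w(1)], of "grade V a"] W.grade_base i Ind_eq by simp
qed

lemma map_adj_eq: "adj_eq V u v \<Longrightarrow> adj_eq W (map_word \<phi> u) (map_word \<phi> v)"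
proof (induction rule: adj_eq.induct)
  case (adj_refl u)
  then show ?case by (intro adj_eq.adj_refl map_words)
next
  case (adj_relation a b)
  then show ?case using adj_eq.adj_relation[of "\<phi> a" W "\<phi> b"] by (simp add: map_qop)
next
  case (adj_trans u v w)
  show ?case by (rule adj_eq.adj_trans[OF adj_trans.IH])
qed (auto intro: adj_sym adj_cong adj_eq.adj_inverse)

lemma map_loops: "i \<in> Ind W \<Longrightarrow> w \<in> loops V (base V i) \<Longrightarrow> map_word \<phi> w \<in> loops W (base W i)"
  using map_word_act[of "base V i" w] V.base_closed[of i]
  by (auto simp: loops_def map_words Ind_eq base_map)

lemma Adj_map_class:
  assumes "w \<in> words V" shows "Adj_map \<phi> W (adj_class V w) = adj_class W (map_word \<phi> w)"
proof
  show "Adj_map \<phi> W (adj_class V w) \<subseteq> adj_class W (map_word \<phi> w)"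
  proof
    fix u assume "u \<in> Adj_map \<phi> W (adj_class V w)"
    then obtain v where v: "adj_eq V w v" "adj_eq W (map_word \<phi> v) u"
      by (auto simp: Adj_map_def mem_adj_class)
    show "u \<in> adj_class W (map_word \<phi> w)"
      unfolding mem_adj_class by (rule adj_trans[OF map_adj_eq[OF v(1)] v(2)])
  qed
  show "adj_class W (map_word \<phi> w) \<subseteq> Adj_map \<phi> W (adj_class V w)"
    using V.self_mem_adj_class[OF assms] by (auto simp: Adj_map_def mem_adj_class)
qed

lemma graded_coeffs: "wp_coeffs W \<Lambda> \<Longrightarrow> wp_coeffs V \<Lambda>"
  by (simp add: wp_coeffs_def wp_coeffs_axioms_def Ind_eq V.well_pointed_axioms)

lemma Z2_pull:
  assumes "wp_coeffs W \<Lambda>" and f: "f \<in> Z2 W \<Lambda>" shows "pull_cochain V \<phi> f \<in> Z2 V \<Lambda>"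
proof -
  interpret C: wp_coeffs W \<Lambda> by (rule assms(1))
  interpret D: wp_coeffs V \<Lambda> by (rule graded_coeffs[OF assms(1)])
  show ?thesis
  proof (rule D.Z2I)
    show "pull_cochain V \<phi> f \<in> cochains2 V \<Lambda>"
      unfolding pull_cochain_def D.cochains2_restrict using C.Z2_closed[OF f map_closed map_closed] by simp
    fix a b c assume a: "a \<in> carrier V" and b: "b \<in> carrier V" and c: "c \<in> carrier V"
    show "pull_cochain V \<phi> f (a, a) = \<one>\<^bsub>\<Lambda> (grade V a)\<^esub>"
      using C.Z2_diag[OF f, of "\<phi> a"] a by simp
    show "pull_cochain V \<phi> f (a, b) \<otimes>\<^bsub>\<Lambda> (grade V a)\<^esub> pull_cochain V \<phi> f (a \<triangleright>\<^bsub>V\<^esub> b, c)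
       = pull_cochain V \<phi> f (a, c) \<otimes>\<^bsub>\<Lambda> (grade V a)\<^esub> pull_cochain V \<phi> f (a \<triangleright>\<^bsub>V\<^esub> c, b \<triangleright>\<^bsub>V\<^esub> c)"
      using C.Z2_cocycle[OF f, of "\<phi> a" "\<phi> b" "\<phi> c"] a b c by (simp add: V.qop_closed map_qop)
  qed
qed

lemma holonomy_pull:
  "x \<in> carrier V \<Longrightarrow> w \<in> words V \<Longrightarrow>
     holonomy V \<Lambda> (pull_cochain V \<phi> f) x w = holonomy W \<Lambda> f (\<phi> x) (map_word \<phi> w)"
  by (induction w arbitrary: x) (auto simp: V.qop_closed V.qbar_closed map_qop map_qbar)

end

lemma wp_map_id: "well_pointed W \<Longrightarrow> wp_map W W id"
  by (simp add: wp_map_def wp_map_axioms_def wp_id)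

locale coeff_map = wp_coeffs W \<Lambda> + C': wp_coeffs W \<Lambda>'
  for W :: "('a, 'i, 'z) wpquandle_scheme" (structure)
    and \<Lambda> :: "'i \<Rightarrow> ('l, 'g) monoid_scheme" and \<Lambda>' :: "'i \<Rightarrow> ('m, 'h) monoid_scheme" +
  fixes \<psi> :: "'i \<Rightarrow> 'l \<Rightarrow> 'm"
  assumes \<psi>: "\<psi> \<in> graded_hom (Ind W) \<Lambda> \<Lambda>'"
begin

lemma
  assumes i: "i \<in> Ind W"
  shows push_closed: "l \<in> carrier (\<Lambda> i) \<Longrightarrow> \<psi> i l \<in> carrier (\<Lambda>' i)"
    and push_mult: "l \<in> carrier (\<Lambda> i) \<Longrightarrow> m \<in> carrier (\<Lambda> i) \<Longrightarrow> \<psi> i (l \<otimes>\<^bsub>\<Lambda> i\<^esub> m) = \<psi> i l \<otimes>\<^bsub>\<Lambda>' i\<^esub> \<psi> i m"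
    and push_one: "\<psi> i \<one>\<^bsub>\<Lambda> i\<^esub> = \<one>\<^bsub>\<Lambda>' i\<^esub>"
    and push_inv: "l \<in> carrier (\<Lambda> i) \<Longrightarrow> \<psi> i (inv\<^bsub>\<Lambda> i\<^esub> l) = inv\<^bsub>\<Lambda>' i\<^esub> \<psi> i l"
proof -
  interpret H: group_hom "\<Lambda> i" "\<Lambda>' i" "\<psi> i"
    using \<psi> i group_Ind C'.group_Ind by (simp add: group_hom_def group_hom_axioms_def graded_hom_def)
  show "l \<in> carrier (\<Lambda> i) \<Longrightarrow> \<psi> i l \<in> carrier (\<Lambda>' i)"
    "l \<in> carrier (\<Lambda> i) \<Longrightarrow> m \<in> carrier (\<Lambda> i) \<Longrightarrow> \<psi> i (l \<otimes>\<^bsub>\<Lambda> i\<^esub> m) = \<psi> i l \<otimes>\<^bsub>\<Lambda>' i\<^esub> \<psi> i m"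
    "\<psi> i \<one>\<^bsub>\<Lambda> i\<^esub> = \<one>\<^bsub>\<Lambda>' i\<^esub>"
    "l \<in> carrier (\<Lambda> i) \<Longrightarrow> \<psi> i (inv\<^bsub>\<Lambda> i\<^esub> l) = inv\<^bsub>\<Lambda>' i\<^esub> \<psi> i l"
    by simp_all
qed

lemma Z2_push:
  assumes f: "f \<in> Z2 W \<Lambda>" shows "push_cochain W \<psi> f \<in> Z2 W \<Lambda>'"
proof (rule C'.Z2I)
  show "push_cochain W \<psi> f \<in> cochains2 W \<Lambda>'"
    unfolding push_cochain_def C'.cochains2_restrict using push_closed[OF grade_Ind] Z2_closed[OF f] by simp
  fix a b c assume a: "a \<in> carrier W" and b: "b \<in> carrier W" and c: "c \<in> carrier W"
  note i = grade_Ind[OF a]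
  show "push_cochain W \<psi> f (a, a) = \<one>\<^bsub>\<Lambda>' (grade W a)\<^esub>"
    using a Z2_diag[OF f a] push_one[OF i] by simp
  have "f (a \<triangleright> b, c) \<in> carrier (\<L> a)" "f (a \<triangleright> c, b \<triangleright> c) \<in> carrier (\<L> a)"
    using Z2_closed[OF f, of "a \<triangleright> b" c] Z2_closed[OF f, of "a \<triangleright> c" "b \<triangleright> c"] a b c by (simp_all add: qop_closed)
  then show "push_cochain W \<psi> f (a, b) \<otimes>\<^bsub>\<Lambda>' (grade W a)\<^esub> push_cochain W \<psi> f (a \<triangleright> b, c)
       = push_cochain W \<psi> f (a, c) \<otimes>\<^bsub>\<Lambda>' (grade W a)\<^esub> push_cochain W \<psi> f (a \<triangleright> c, b \<triangleright> c)"
    using arg_cong[OF Z2_cocycle[OF f a b c], of "\<psi> (grade W a)"] a b c Z2_closed[OF f a b] Z2_closed[OF f a c]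
    by (simp add: qop_closed push_mult[OF i])
qed

lemma holonomy_push:
  assumes f: "f \<in> Z2 W \<Lambda>"
  shows "x \<in> carrier W \<Longrightarrow> w \<in> words W \<Longrightarrow>
     holonomy W \<Lambda>' (push_cochain W \<psi> f) x w = \<psi> (grade W x) (holonomy W \<Lambda> f x w)"
proof (induction w arbitrary: x)
  case Nil
  then show ?case using push_one[OF grade_Ind] by simp
next
  case (Cons l w)
  obtain a s where l: "l = (a, s)" by (cases l)
  note x = Cons.prems(1)
  interpret G: group "\<L> x" by (rule group_grade[OF x])
  have a: "a \<in> carrier W" "x \<triangleright> a \<in> carrier W" "x \<triangleleft> a \<in> carrier W" and w: "w \<in> words W"
    using Cons.prems by (auto simp: l qop_closed qbar_closed)
  have "holonomy W \<Lambda> f (x \<triangleright> a) w \<in> carrier (\<L> x)" "holonomy W \<Lambda> f (x \<triangleleft> a) w \<in> carrier (\<L> x)"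
    "f (x \<triangleleft> a, a) \<in> carrier (\<L> x)"
    using holonomy_closed[OF Z2_cochain[OF f] a(2) w] holonomy_closed[OF Z2_cochain[OF f] a(3) w]
      Z2_closed[OF f a(3,1)] x a by simp_all
  then show ?case
    using Cons.IH[OF a(2) w] Cons.IH[OF a(3) w] x a Z2_closed[OF f x a(1)]
    by (simp add: l push_mult[OF grade_Ind[OF x]] push_inv[OF grade_Ind[OF x]])
qed

end

text \<open>A homomorphism over \<open>\<phi>\<close> and \<open>\<psi>\<close> is determined by the cochain \<open>g\<close> that compares the image of
  the section \<open>s\<close> with the section \<open>s'\<close>; it respects \<open>\<triangleright>\<close> if and only if \<open>g\<close> is a cohomology between
  the pushed and the pulled back cocycle. Pullback, pushforward and equivalence of extensions are
  all instances.\<close>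

lemma ext_hom_iff_cohomologous:
  fixes V :: "('a, 'i, 'y) wpquandle_scheme" and W :: "('b, 'i, 'z) wpquandle_scheme"
    and E :: "('e, 'a, 'l) qext" and E' :: "('f, 'b, 'm) qext"
  assumes "ext_section V \<Lambda> E s f" and "ext_section W \<Lambda>' E' s' f'" and "wp_map V W \<phi>"
    and \<psi>: "\<psi> \<in> graded_hom (Ind V) \<Lambda> \<Lambda>'"
  shows "ext_hom V \<Lambda> \<phi> \<psi> E E' \<noteq> {} \<longleftrightarrow>
    (pull_cochain V \<phi> f', push_cochain V \<psi> f) \<in> cohom_rel V \<Lambda>'"
proof -
  interpret E: ext_section V \<Lambda> E s f by (rule assms(1))
  interpret E': ext_section W \<Lambda>' E' s' f' by (rule assms(2))
  interpret m: wp_map V W \<phi> by (rule assms(3))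
  interpret C: coeff_map V \<Lambda> \<Lambda>' \<psi>
    by (intro coeff_map.intro coeff_map_axioms.intro \<psi> E.wp_coeffs_axioms m.graded_coeffs E'.wp_coeffs_axioms)
  show ?thesis
  proof
    assume "ext_hom V \<Lambda> \<phi> \<psi> E E' \<noteq> {}"
    then obtain F where F_hom: "F \<in> ext_hom V \<Lambda> \<phi> \<psi> E E'" by blast
    have F: "F x \<in> carrier (total E') \<and> proj E' (F x) = \<phi> (proj E x)" if "x \<in> carrier (total E)" for x
      using F_hom[unfolded E.mem_ext_hom] that by blast
    have F_op: "F (x \<triangleright>\<^bsub>total E\<^esub> y) = F x \<triangleright>\<^bsub>total E'\<^esub> F y"
      if "x \<in> carrier (total E)" "y \<in> carrier (total E)" for x y
      using F_hom[unfolded E.mem_ext_hom] that by blast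
    have F_act: "F (eact E l x) = eact E' (\<psi> (E.gr x) l) (F x)"
      if "x \<in> carrier (total E)" "l \<in> carrier (\<Lambda> (E.gr x))" for x l
      using F_hom[unfolded E.mem_ext_hom] that by blast
    define g where "g a = E'.coord (F (s a))" for a
    have g: "g a \<in> carrier (\<Lambda>' (grade V a))" "eact E' (g a) (s' (\<phi> a)) = F (s a)" if "a \<in> carrier V" for a
      using E'.coord[of "F (s a)"] F[of "s a"] that by (simp_all add: g_def)
    show "(pull_cochain V \<phi> f', push_cochain V \<psi> f) \<in> cohom_rel V \<Lambda>'"
    proof (rule C.C'.cohom_relI[OF m.Z2_pull[OF E'.wp_coeffs_axioms E'.f_Z2] C.Z2_push[OF E.f_Z2], of g])
      fix a assume a: "a \<in> carrier V"
      show "g a \<in> carrier (\<Lambda>' (grade V a))" by (rule g(1)[OF a])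
      fix b assume b: "b \<in> carrier V"
      interpret G: group "\<Lambda>' (grade V a)" by (rule C.C'.group_grade[OF a])
      have ab: "a \<triangleright>\<^bsub>V\<^esub> b \<in> carrier V" "grade V (a \<triangleright>\<^bsub>V\<^esub> b) = grade V a" using a b by (simp_all add: E.qop_closed)
      note ff = E.f_closed[OF a b]
      have ff': "f' (\<phi> a, \<phi> b) \<in> carrier (\<Lambda>' (grade V a))" using E'.f_closed[of "\<phi> a" "\<phi> b"] a b by simp
      have gab: "g (a \<triangleright>\<^bsub>V\<^esub> b) \<in> carrier (\<Lambda>' (grade V a))" using g(1)[OF ab(1)] ab(2) by simp
      have pf: "\<psi> (grade V a) (f (a, b)) \<in> carrier (\<Lambda>' (grade V a))" by (rule C.push_closed[OF E.grade_Ind[OF a] ff])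
      have "E'.coord (F (s a \<triangleright>\<^bsub>total E\<^esub> s b)) = g a \<otimes>\<^bsub>\<Lambda>' (grade V a)\<^esub> f' (\<phi> a, \<phi> b)"
        using E'.coord_qop[of "F (s a)" "F (s b)"] F[of "s a"] F[of "s b"] a b by (simp add: F_op g_def)
      moreover have "E'.coord (F (s a \<triangleright>\<^bsub>total E\<^esub> s b)) = \<psi> (grade V a) (f (a, b)) \<otimes>\<^bsub>\<Lambda>' (grade V a)\<^esub> g (a \<triangleright>\<^bsub>V\<^esub> b)"
        using F[of "s (a \<triangleright>\<^bsub>V\<^esub> b)"] a b ab ff pf
        by (simp add: E.s_qop F_act g_def E'.coord_act m.map_qop)
      ultimately have "g a \<otimes>\<^bsub>\<Lambda>' (grade V a)\<^esub> f' (\<phi> a, \<phi> b)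
          = \<psi> (grade V a) (f (a, b)) \<otimes>\<^bsub>\<Lambda>' (grade V a)\<^esub> g (a \<triangleright>\<^bsub>V\<^esub> b)" by simp
      then have "f' (\<phi> a, \<phi> b) = inv\<^bsub>\<Lambda>' (grade V a)\<^esub> g a \<otimes>\<^bsub>\<Lambda>' (grade V a)\<^esub>
          (\<psi> (grade V a) (f (a, b)) \<otimes>\<^bsub>\<Lambda>' (grade V a)\<^esub> g (a \<triangleright>\<^bsub>V\<^esub> b))"
        using g(1)[OF a] ff' gab pf by (metis G.inv_solve_left G.m_closed)
      then show "pull_cochain V \<phi> f' (a, b) = inv\<^bsub>\<Lambda>' (grade V a)\<^esub> g a \<otimes>\<^bsub>\<Lambda>' (grade V a)\<^esub>
          push_cochain V \<psi> f (a, b) \<otimes>\<^bsub>\<Lambda>' (grade V a)\<^esub> g (a \<triangleright>\<^bsub>V\<^esub> b)"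
        using a b g(1)[OF a] gab pf by (simp add: G.m_assoc)
    qed
  next
    assume "(pull_cochain V \<phi> f', push_cochain V \<psi> f) \<in> cohom_rel V \<Lambda>'"
    then obtain g where cob: "C.C'.cobounds g (pull_cochain V \<phi> f') (push_cochain V \<psi> f)"
      by (auto simp: C.C'.cohom_rel_iff)
    note g = C.C'.cobounds_closed[OF cob] and eq = C.C'.cobounds_eq[OF cob]
    define F where "F x = eact E' (\<psi> (E.gr x) (E.coord x) \<otimes>\<^bsub>\<Lambda>' (E.gr x)\<^esub> g (proj E x)) (s' (\<phi> (proj E x)))" for x
    have k: "\<psi> (E.gr x) (E.coord x) \<in> carrier (\<Lambda>' (E.gr x))"
        "\<psi> (E.gr x) (E.coord x) \<otimes>\<^bsub>\<Lambda>' (E.gr x)\<^esub> g (proj E x) \<in> carrier (\<Lambda>' (E.gr x))"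
      if x: "x \<in> carrier (total E)" for x
    proof -
      interpret G: group "\<Lambda>' (E.gr x)" by (rule C.C'.group_grade[OF E.proj_closed[OF x]])
      show "\<psi> (E.gr x) (E.coord x) \<in> carrier (\<Lambda>' (E.gr x))"
        by (rule C.push_closed[OF E.grade_Ind[OF E.proj_closed[OF x]] E.coord_closed[OF x]])
      then show "\<psi> (E.gr x) (E.coord x) \<otimes>\<^bsub>\<Lambda>' (E.gr x)\<^esub> g (proj E x) \<in> carrier (\<Lambda>' (E.gr x))"
        using g[OF E.proj_closed[OF x]] by simp
    qed
    have F: "F x \<in> carrier (total E') \<and> proj E' (F x) = \<phi> (proj E x)" if x: "x \<in> carrier (total E)" for x
      unfolding F_def using k(2)[OF x] x by (simp add: E'.act_closed E'.proj_act)
    have "F \<in> ext_hom V \<Lambda> \<phi> \<psi> E E'"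
    proof -
      have op: "F (x \<triangleright>\<^bsub>total E\<^esub> y) = F x \<triangleright>\<^bsub>total E'\<^esub> F y"
        if x: "x \<in> carrier (total E)" and y: "y \<in> carrier (total E)" for x y
      proof -
        let ?a = "proj E x" and ?b = "proj E y"
        interpret G: group "\<Lambda>' (E.gr x)" by (rule C.C'.group_grade[OF E.proj_closed[OF x]])
        have ab: "?a \<in> carrier V" "?b \<in> carrier V" "?a \<triangleright>\<^bsub>V\<^esub> ?b \<in> carrier V" using x y by (simp_all add: E.qop_closed)
        note ff = E.f_closed[OF ab(1,2)]
        have ff': "f' (\<phi> ?a, \<phi> ?b) \<in> carrier (\<Lambda>' (E.gr x))" using E'.f_closed[of "\<phi> ?a" "\<phi> ?b"] ab by simp
        have pf: "\<psi> (E.gr x) (f (?a, ?b)) \<in> carrier (\<Lambda>' (E.gr x))"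
          by (rule C.push_closed[OF E.grade_Ind[OF ab(1)] ff])
        have gab: "g (?a \<triangleright>\<^bsub>V\<^esub> ?b) \<in> carrier (\<Lambda>' (E.gr x))" using g[OF ab(3)] ab by simp
        have e: "g ?a \<otimes>\<^bsub>\<Lambda>' (E.gr x)\<^esub> f' (\<phi> ?a, \<phi> ?b)
            = \<psi> (E.gr x) (f (?a, ?b)) \<otimes>\<^bsub>\<Lambda>' (E.gr x)\<^esub> g (?a \<triangleright>\<^bsub>V\<^esub> ?b)"
          using eq[OF ab(1,2)] g[OF ab(1)] pf gab ab by (simp add: G.m_assoc[symmetric])
        have "F x \<triangleright>\<^bsub>total E'\<^esub> F y = F x \<triangleright>\<^bsub>total E'\<^esub> s' (\<phi> ?b)"
          using F[OF x] F[OF y] ab by (intro E'.qop_cong_proj) simp_all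
        also have "\<dots> = eact E' (\<psi> (E.gr x) (E.coord x) \<otimes>\<^bsub>\<Lambda>' (E.gr x)\<^esub> g ?a)
            (eact E' (f' (\<phi> ?a, \<phi> ?b)) (s' (\<phi> (?a \<triangleright>\<^bsub>V\<^esub> ?b))))"
          unfolding F_def using k(2)[OF x] ab by (simp add: E'.act_qop E'.s_qop m.map_qop)
        also have "\<dots> = eact E' (\<psi> (E.gr x) (E.coord x) \<otimes>\<^bsub>\<Lambda>' (E.gr x)\<^esub> g ?a \<otimes>\<^bsub>\<Lambda>' (E.gr x)\<^esub> f' (\<phi> ?a, \<phi> ?b))
            (s' (\<phi> (?a \<triangleright>\<^bsub>V\<^esub> ?b)))"
          using E'.act_mult[of "s' (\<phi> (?a \<triangleright>\<^bsub>V\<^esub> ?b))" "\<psi> (E.gr x) (E.coord x) \<otimes>\<^bsub>\<Lambda>' (E.gr x)\<^esub> g ?a"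
              "f' (\<phi> ?a, \<phi> ?b)"] k(2)[OF x] ab ff' by simp
        also have "\<psi> (E.gr x) (E.coord x) \<otimes>\<^bsub>\<Lambda>' (E.gr x)\<^esub> g ?a \<otimes>\<^bsub>\<Lambda>' (E.gr x)\<^esub> f' (\<phi> ?a, \<phi> ?b)
            = \<psi> (E.gr x) (E.coord x \<otimes>\<^bsub>\<Lambda> (E.gr x)\<^esub> f (?a, ?b)) \<otimes>\<^bsub>\<Lambda>' (E.gr x)\<^esub> g (?a \<triangleright>\<^bsub>V\<^esub> ?b)"
          using k(1)[OF x] g[OF ab(1)] ff' e pf gab E.coord_closed[OF x] ff
          by (simp add: G.m_assoc C.push_mult[OF E.grade_Ind[OF ab(1)]])
        finally show ?thesis
          using x y ab by (simp add: F_def[of "x \<triangleright>\<^bsub>total E\<^esub> y"] E.coord_qop)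
      qed
      have act: "F (eact E l x) = eact E' (\<psi> (E.gr x) l) (F x)"
        if x: "x \<in> carrier (total E)" and l: "l \<in> carrier (\<Lambda> (E.gr x))" for x l
      proof -
        have a: "proj E x \<in> carrier V" using x by simp
        interpret G: group "\<Lambda>' (E.gr x)" by (rule C.C'.group_grade[OF a])
        have pl: "\<psi> (E.gr x) l \<in> carrier (\<Lambda>' (E.gr x))" by (rule C.push_closed[OF E.grade_Ind[OF a] l])
        have "eact E' (\<psi> (E.gr x) l) (F x) = eact E' (\<psi> (E.gr x) l \<otimes>\<^bsub>\<Lambda>' (E.gr x)\<^esub>
           (\<psi> (E.gr x) (E.coord x) \<otimes>\<^bsub>\<Lambda>' (E.gr x)\<^esub> g (proj E x))) (s' (\<phi> (proj E x)))"
          unfolding F_def using E'.act_mult[of "s' (\<phi> (proj E x))" "\<psi> (E.gr x) l"] a pl k(2)[OF x] by simp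
        then show ?thesis
          using x l pl k(1)[OF x] g[OF a] E.coord_closed[OF x]
          by (simp add: F_def[of "eact E l x"] E.act_closed E.proj_act E.coord_act G.m_assoc
              C.push_mult[OF E.grade_Ind[OF a]])
      qed
      show ?thesis
        unfolding E.mem_ext_hom using F op act by blast
    qed
    then show "ext_hom V \<Lambda> \<phi> \<psi> E E' \<noteq> {}" by blast
  qed
qed

section \<open>Every cocycle comes from an extension\<close>

lemma (in group) group_actionI:
  assumes closed: "\<And>g x. g \<in> carrier G \<Longrightarrow> x \<in> S \<Longrightarrow> \<alpha> g x \<in> S"
    and one: "\<And>x. x \<in> S \<Longrightarrow> \<alpha> \<one> x = x"
    and mult: "\<And>g h x. g \<in> carrier G \<Longrightarrow> h \<in> carrier G \<Longrightarrow> x \<in> S \<Longrightarrow> \<alpha> (g \<otimes> h) x = \<alpha> g (\<alpha> h x)"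
  shows "group_action G S (\<lambda>g. restrict (\<alpha> g) S)"
proof -
  have Bij: "restrict (\<alpha> g) S \<in> Bij S" if g: "g \<in> carrier G" for g
  proof -
    have "bij_betw (restrict (\<alpha> g) S) S S"
    proof (rule bij_betw_byWitness[where f' = "\<alpha> (inv g)"])
      show "\<forall>x\<in>S. \<alpha> (inv g) (restrict (\<alpha> g) S x) = x" "\<forall>x\<in>S. restrict (\<alpha> g) S (\<alpha> (inv g) x) = x"
        using g closed by (auto simp: mult[symmetric] one)
    qed (use g closed in auto)
    then show ?thesis by (simp add: Bij_def)
  qed
  show ?thesis
  proof (intro group_action.intro group_hom.intro group_hom_axioms.intro is_group group_BijGroup homI)
    show "restrict (\<alpha> g) S \<in> carrier (BijGroup S)" if "g \<in> carrier G" for g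
      using Bij[OF that] by (simp add: BijGroup_def)
    show "restrict (\<alpha> (g \<otimes> h)) S = restrict (\<alpha> g) S \<otimes>\<^bsub>BijGroup S\<^esub> restrict (\<alpha> h) S"
      if g: "g \<in> carrier G" and h: "h \<in> carrier G" for g h
    proof -
      have "restrict (\<alpha> (g \<otimes> h)) S = compose S (restrict (\<alpha> g) S) (restrict (\<alpha> h) S)"
        by (rule extensionalityI[OF restrict_extensional compose_extensional])
          (use g h closed mult in \<open>auto simp: compose_def\<close>)
      then show ?thesis using Bij[OF g] Bij[OF h] by (simp add: BijGroup_def)
    qed
  qed
qed

definition cocycle_ext ::
  "('a, 'i, 'z) wpquandle_scheme \<Rightarrow> ('i \<Rightarrow> ('l, 'g) monoid_scheme) \<Rightarrow> ('a \<times> 'a \<Rightarrow> 'l) \<Rightarrow> ('a, 'l) extn"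
  where
  "cocycle_ext W \<Lambda> f = \<lparr>
     total = \<lparr>carrier = (SIGMA a:carrier W. carrier (\<Lambda> (grade W a))),
        qop = \<lambda>(a, l) (b, m). (a \<triangleright>\<^bsub>W\<^esub> b, l \<otimes>\<^bsub>\<Lambda> (grade W a)\<^esub> f (a, b)),
        qbar = \<lambda>(a, l) (b, m). (a \<triangleleft>\<^bsub>W\<^esub> b, l \<otimes>\<^bsub>\<Lambda> (grade W a)\<^esub> inv\<^bsub>\<Lambda> (grade W a)\<^esub> f (a \<triangleleft>\<^bsub>W\<^esub> b, b))\<rparr>,
     proj = fst,
     eact = \<lambda>m (a, l). (a, m \<otimes>\<^bsub>\<Lambda> (grade W a)\<^esub> l)\<rparr>"

context wp_coeffs
begin

text \<open>The operations are prescribed on the carrier only, so that the lemma also applies to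
  \<open>trivial_ext\<close>.\<close>

lemma ext_from_cocycle:
  fixes E :: "('a, 'l) extn"
  assumes f: "f \<in> Z2 W \<Lambda>"
    and carr: "carrier (total E) = (SIGMA a:carrier W. carrier (\<L> a))"
    and op: "\<And>a l b m. a \<in> carrier W \<Longrightarrow> b \<in> carrier W \<Longrightarrow> l \<in> carrier (\<L> a) \<Longrightarrow>
      (a, l) \<triangleright>\<^bsub>total E\<^esub> (b, m) = (a \<triangleright> b, l \<otimes>\<^bsub>\<L> a\<^esub> f (a, b))"
    and bar: "\<And>a l b m. a \<in> carrier W \<Longrightarrow> b \<in> carrier W \<Longrightarrow> l \<in> carrier (\<L> a) \<Longrightarrow>
      (a, l) \<triangleleft>\<^bsub>total E\<^esub> (b, m)
        = (a \<triangleleft> b, l \<otimes>\<^bsub>\<L> a\<^esub> inv\<^bsub>\<L> a\<^esub> f (a \<triangleleft> b, b))"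
    and pr: "\<And>a l. proj E (a, l) = a"
    and ac: "\<And>a l m. eact E m (a, l) = (a, m \<otimes>\<^bsub>\<L> a\<^esub> l)"
  shows "E \<in> exts W \<Lambda>" and "f \<in> ext_cocycles W \<Lambda> E"
proof -
  have mul: "l \<otimes>\<^bsub>\<L> a\<^esub> m \<in> carrier (\<L> a)"
    if "a \<in> carrier W" "l \<in> carrier (\<L> a)" "m \<in> carrier (\<L> a)" for a l m
    using that group_grade by (simp add: group.is_monoid monoid.m_closed)
  have fc: "f (a, b) \<in> carrier (\<L> a)" if "a \<in> carrier W" "b \<in> carrier W" for a b
    by (rule Z2_closed[OF f that])
  have fb: "f (a \<triangleleft> b, b) \<in> carrier (\<L> a)" if "a \<in> carrier W" "b \<in> carrier W" for a b
    using fc[of "a \<triangleleft> b" b] that by (simp add: qbar_closed)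
  have fib: "fibres E {a} = {a} \<times> carrier (\<L> a)" if "a \<in> carrier W" for a
    using that by (auto simp: fibres_def carr pr)
  have fibc: "fibres E (cpt W i) = (SIGMA a:{a \<in> carrier W. grade W a = i}. carrier (\<Lambda> i))" if "i \<in> Ind W" for i
    using that by (auto simp: fibres_def carr pr cpt_eq)
  show "E \<in> exts W \<Lambda>"
    unfolding exts_def mem_Collect_eq
  proof (rule graded_ext.intro)
    show "quandle (total E)"
    proof (rule quandle.intro; unfold carr; clarify)
      fix a l b m assume a: "a \<in> carrier W" and l: "l \<in> carrier (\<L> a)"
        and b: "b \<in> carrier W" and m: "m \<in> carrier (\<L> b)"
      interpret G: group "\<L> a" by (rule group_grade[OF a])
      show "(a, l) \<triangleright>\<^bsub>total E\<^esub> (b, m) \<in> (SIGMA a:carrier W. carrier (\<L> a))"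
        using a b l fc by (simp add: op qop_closed)
      show "(a, l) \<triangleleft>\<^bsub>total E\<^esub> (b, m) \<in> (SIGMA a:carrier W. carrier (\<L> a))"
        using a b l fb by (simp add: bar qbar_closed)
      show "((a, l) \<triangleright>\<^bsub>total E\<^esub> (b, m)) \<triangleleft>\<^bsub>total E\<^esub> (b, m) = (a, l)"
        using a b l fc[OF a b] by (simp add: op bar qop_closed qop_qbar G.m_assoc)
      show "((a, l) \<triangleleft>\<^bsub>total E\<^esub> (b, m)) \<triangleright>\<^bsub>total E\<^esub> (b, m) = (a, l)"
        using a b l fb[OF a b] by (simp add: op bar qbar_closed qbar_qop G.m_assoc)
      fix c n assume c: "c \<in> carrier W" and n: "n \<in> carrier (\<L> c)"
      have "f (a \<triangleright> b, c) \<in> carrier (\<L> a)" "f (a \<triangleright> c, b \<triangleright> c) \<in> carrier (\<L> a)"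
        using fc[of "a \<triangleright> b" c] fc[of "a \<triangleright> c" "b \<triangleright> c"] a b c by (simp_all add: qop_closed)
      then show "((a, l) \<triangleright>\<^bsub>total E\<^esub> (b, m)) \<triangleright>\<^bsub>total E\<^esub> (c, n)
          = ((a, l) \<triangleright>\<^bsub>total E\<^esub> (c, n)) \<triangleright>\<^bsub>total E\<^esub> ((b, m) \<triangleright>\<^bsub>total E\<^esub> (c, n))"
        using a b c l m fc[OF a b] fc[OF a c] Z2_cocycle[OF f a b c]
        by (simp add: op qop_closed mul self_distrib[symmetric] G.m_assoc)
    next
      fix a l assume a: "a \<in> carrier W" and l: "l \<in> carrier (\<L> a)"
      interpret G: group "\<L> a" by (rule group_grade[OF a])
      show "(a, l) \<triangleright>\<^bsub>total E\<^esub> (a, l) = (a, l)" using a l by (simp add: op Z2_diag[OF f] idem)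
    qed
    show "proj E \<in> quandle_hom (total E) W"
      by (auto simp: quandle_hom_def carr op pr)
    show "proj E ` carrier (total E) = carrier W"
    proof -
      have "a \<in> proj E ` carrier (total E)" if "a \<in> carrier W" for a
        using that group_grade[OF that]
        by (intro image_eqI[of _ _ "(a, \<one>\<^bsub>\<L> a\<^esub>)"])
          (simp_all add: pr carr group.is_monoid monoid.one_closed)
      then show ?thesis by (auto simp: carr pr)
    qed
    fix i assume i: "i \<in> Ind W"
    interpret G: group "\<Lambda> i" by (rule group_Ind[OF i])
    show "group_action (\<Lambda> i) (fibres E (cpt W i)) (\<lambda>l. restrict (eact E l) (fibres E (cpt W i)))"
      unfolding fibc[OF i]
    proof (rule G.group_actionI)
      fix x assume "x \<in> (SIGMA a:{a \<in> carrier W. grade W a = i}. carrier (\<Lambda> i))"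
      then obtain a l where x: "x = (a, l)" "a \<in> carrier W" "grade W a = i" "l \<in> carrier (\<Lambda> i)" by blast
      show "eact E \<one>\<^bsub>\<Lambda> i\<^esub> x = x" using x by (simp add: ac)
      fix g assume g: "g \<in> carrier (\<Lambda> i)"
      show "eact E g x \<in> (SIGMA a:{a \<in> carrier W. grade W a = i}. carrier (\<Lambda> i))" using x g by (simp add: ac)
      fix h assume "h \<in> carrier (\<Lambda> i)"
      then show "eact E (g \<otimes>\<^bsub>\<Lambda> i\<^esub> h) x = eact E g (eact E h x)" using x g by (simp add: ac G.m_assoc)
    qed
    show "eact E l x \<triangleright>\<^bsub>total E\<^esub> y = eact E l (x \<triangleright>\<^bsub>total E\<^esub> y)"
      if "l \<in> carrier (\<Lambda> i)" "x \<in> fibres E (cpt W i)" "y \<in> carrier (total E)" for l x y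
    proof -
      obtain a m where x: "x = (a, m)" "a \<in> carrier W" "grade W a = i" "m \<in> carrier (\<Lambda> i)"
        using \<open>x \<in> fibres E (cpt W i)\<close> unfolding fibc[OF i] by blast
      obtain b n where y: "y = (b, n)" "b \<in> carrier W" using \<open>y \<in> carrier (total E)\<close> unfolding carr by blast
      show ?thesis using x y fc[OF x(2) y(2)] \<open>l \<in> carrier (\<Lambda> i)\<close> by (simp add: ac op G.m_assoc)
    qed
    show "x \<triangleright>\<^bsub>total E\<^esub> eact E l y = x \<triangleright>\<^bsub>total E\<^esub> y"
      if "l \<in> carrier (\<Lambda> i)" "x \<in> carrier (total E)" "y \<in> fibres E (cpt W i)" for l x y
    proof -
      obtain a m where x: "x = (a, m)" "a \<in> carrier W" "m \<in> carrier (\<L> a)"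
        using \<open>x \<in> carrier (total E)\<close> unfolding carr by blast
      obtain b n where y: "y = (b, n)" "b \<in> carrier W"
        using \<open>y \<in> fibres E (cpt W i)\<close> unfolding fibc[OF i] by blast
      show ?thesis using x y by (simp add: ac op)
    qed
    fix a assume "a \<in> cpt W i"
    then have a: "a \<in> carrier W" "grade W a = i" using cpt_eq[OF i] by simp_all
    have fa: "fibres E {a} = {a} \<times> carrier (\<Lambda> i)" using fib[OF a(1)] a(2) by simp
    show "eact E l x \<in> fibres E {a}" if "l \<in> carrier (\<Lambda> i)" "x \<in> fibres E {a}" for l x
      using that unfolding fa by (auto simp: ac a(2))
    show "l = \<one>\<^bsub>\<Lambda> i\<^esub>" if "l \<in> carrier (\<Lambda> i)" "x \<in> fibres E {a}" "eact E l x = x" for l x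
      using that unfolding fa by (auto simp: ac a(2))
    show "\<exists>l\<in>carrier (\<Lambda> i). eact E l x = y" if "x \<in> fibres E {a}" "y \<in> fibres E {a}" for x y
    proof -
      obtain l m where "x = (a, l)" "y = (a, m)" "l \<in> carrier (\<Lambda> i)" "m \<in> carrier (\<Lambda> i)"
        using \<open>x \<in> fibres E {a}\<close> \<open>y \<in> fibres E {a}\<close> unfolding fa by blast
      then show ?thesis
        using a by (intro bexI[of _ "m \<otimes>\<^bsub>\<Lambda> i\<^esub> inv\<^bsub>\<Lambda> i\<^esub> l"]) (simp_all add: ac G.m_assoc)
    qed
  qed
  have one: "\<one>\<^bsub>\<L> a\<^esub> \<in> carrier (\<L> a)" if "a \<in> carrier W" for a
    using group_grade[OF that] by (simp add: group.is_monoid monoid.one_closed)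
  have s_op: "(a, \<one>\<^bsub>\<L> a\<^esub>) \<triangleright>\<^bsub>total E\<^esub> (b, \<one>\<^bsub>\<L> b\<^esub>)
      = eact E (f (a, b)) (a \<triangleright> b, \<one>\<^bsub>\<L> (a \<triangleright> b)\<^esub>)"
    if a: "a \<in> carrier W" and b: "b \<in> carrier W" for a b
  proof -
    interpret G: group "\<L> a" by (rule group_grade[OF a])
    show ?thesis using a b fc[OF a b] by (simp add: op ac)
  qed
  show "f \<in> ext_cocycles W \<Lambda> E"
    unfolding ext_cocycles_def mem_Collect_eq
  proof (intro conjI bexI ballI)
    show "(\<lambda>a. (a, \<one>\<^bsub>\<L> a\<^esub>)) \<in> (\<Pi> a\<in>carrier W. fibres E {a})"
      using one by (auto simp: fib)
  qed (use Z2_cochain[OF f] s_op in auto)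
qed

lemma cocycle_ext:
  assumes f: "f \<in> Z2 W \<Lambda>"
  shows "cocycle_ext W \<Lambda> f \<in> exts W \<Lambda>" and "f \<in> ext_cocycles W \<Lambda> (cocycle_ext W \<Lambda> f)"
  by (rule ext_from_cocycle[OF f]; simp add: cocycle_ext_def)+

end

section \<open>Representing the three kinds of classes by a cocycle\<close>

text \<open>Each of \<open>H\<^sup>2\<close>, \<open>Ext\<close> and \<open>Hom\<close> up to conjugation is the quotient of \<open>Z\<^sup>2\<close> by the same
  relation; the class of a cocycle \<open>f\<close> is \<open>coh_class f\<close>, \<open>ext_class f\<close> and the conjugacy class of
  its holonomy, respectively.\<close>

definition coh_class ::
  "('a, 'i, 'z) wpquandle_scheme \<Rightarrow> ('i \<Rightarrow> ('l, 'g) monoid_scheme) \<Rightarrow> ('a \<times> 'a \<Rightarrow> 'l) \<Rightarrow> ('a \<times> 'a \<Rightarrow> 'l) set"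
  where "coh_class W \<Lambda> f = cohom_rel W \<Lambda> `` {f}"

definition ext_class ::
  "('a, 'i, 'z) wpquandle_scheme \<Rightarrow> ('i \<Rightarrow> ('l, 'g) monoid_scheme) \<Rightarrow> ('a \<times> 'a \<Rightarrow> 'l) \<Rightarrow> ('a, 'l) extn set"
  where "ext_class W \<Lambda> f = {E \<in> exts W \<Lambda>. f \<in> ext_cocycles W \<Lambda> E}"

definition conj_class ::
  "('a, 'i, 'z) wpquandle_scheme \<Rightarrow> ('i \<Rightarrow> ('l, 'g) monoid_scheme) \<Rightarrow> ('i \<Rightarrow> 'a word set \<Rightarrow> 'l)
     \<Rightarrow> ('i \<Rightarrow> 'a word set \<Rightarrow> 'l) set"
  where "conj_class W \<Lambda> h = conj_rel W \<Lambda> `` {h}"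

context wp_coeffs
begin

lemma pull_id: "f \<in> cochains2 W \<Lambda> \<Longrightarrow> pull_cochain W id f = f"
  unfolding cochains2_def by (simp add: pull_cochain_def PiE_restrict)

lemma push_id: "f \<in> cochains2 W \<Lambda> \<Longrightarrow> push_cochain W (\<lambda>i. id) f = f"
  unfolding cochains2_def by (simp add: push_cochain_def PiE_restrict)

lemma graded_hom_id: "(\<lambda>i. id) \<in> graded_hom (Ind W) \<Lambda> \<Lambda>"
  by (auto simp: graded_hom_def hom_def)

lemma wp_extI: "graded_ext W \<Lambda> E \<Longrightarrow> wp_ext W \<Lambda> E"
  by (intro wp_ext.intro wp_coeffs_axioms)

lemma ext_sectionE:
  assumes "graded_ext W \<Lambda> E" "f \<in> ext_cocycles W \<Lambda> E" obtains s where "ext_section W \<Lambda> E s f"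
proof -
  interpret E: wp_ext W \<Lambda> E by (rule wp_extI[OF assms(1)])
  obtain s where "E.section_cocycle s f" using assms(2) E.ext_cocycles_iff by blast
  then have "ext_section W \<Lambda> E s f" by (intro ext_section.intro E.wp_ext_axioms ext_section_axioms.intro)
  then show thesis by (rule that)
qed

lemma ext_cocycles_Z2: "graded_ext W \<Lambda> E \<Longrightarrow> f \<in> ext_cocycles W \<Lambda> E \<Longrightarrow> f \<in> Z2 W \<Lambda>"
  by (metis ext_sectionE ext_section.f_Z2)

lemma ext_hom_id_iff:
  assumes E: "graded_ext W \<Lambda> E" and f: "f \<in> ext_cocycles W \<Lambda> E"
    and E': "graded_ext W \<Lambda> E'" and f': "f' \<in> ext_cocycles W \<Lambda> E'"
  shows "ext_hom W \<Lambda> id (\<lambda>i. id) E E' \<noteq> {} \<longleftrightarrow> (f', f) \<in> cohom_rel W \<Lambda>"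
proof -
  obtain s s' where "ext_section W \<Lambda> E s f" "ext_section W \<Lambda> E' s' f'"
    using ext_sectionE[OF E f] ext_sectionE[OF E' f'] by metis
  from ext_hom_iff_cohomologous[OF this wp_map_id[OF well_pointed_axioms] graded_hom_id]
  show ?thesis
    using Z2_cochain[OF ext_cocycles_Z2[OF E f]] Z2_cochain[OF ext_cocycles_Z2[OF E' f']]
    by (simp add: pull_id push_id)
qed

lemma id_ext_hom: "id \<in> ext_hom W \<Lambda> id (\<lambda>i. id) E E"
  by (simp add: ext_hom_def quandle_hom_def)

lemma mem_coh_class: "f' \<in> coh_class W \<Lambda> f \<longleftrightarrow> (f, f') \<in> cohom_rel W \<Lambda>"
  by (simp add: coh_class_def)

text \<open>Two sections of the same extension are compared by its identity homomorphism. Conversely, a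
  section can be multiplied by any cochain \<open>g\<close>, and this realises every cohomologous cocycle.\<close>

lemma ext_cocycles_eq:
  assumes E: "graded_ext W \<Lambda> E" and f: "f \<in> ext_cocycles W \<Lambda> E"
  shows "ext_cocycles W \<Lambda> E = coh_class W \<Lambda> f"
proof (intro subset_antisym subsetI)
  fix f' assume f': "f' \<in> ext_cocycles W \<Lambda> E"
  show "f' \<in> coh_class W \<Lambda> f"
    unfolding mem_coh_class using ext_hom_id_iff[OF E f' E f] id_ext_hom by blast
next
  fix f' assume "f' \<in> coh_class W \<Lambda> f"
  then obtain g where f': "f' \<in> Z2 W \<Lambda>"
    and cob: "cobounds g f f'"
    by (auto simp: mem_coh_class cohom_rel_iff)
  note g = cobounds_closed[OF cob] and eq = cobounds_eq[OF cob]
  obtain s where "ext_section W \<Lambda> E s f" using ext_sectionE[OF E f] .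
  then interpret E: ext_section W \<Lambda> E s f .
  have "E.section_cocycle (\<lambda>a. eact E (g a) (s a)) f'"
    unfolding E.section_cocycle_def E.is_section_def
  proof (intro conjI ballI)
    show "f' \<in> cochains2 W \<Lambda>" by (rule Z2_cochain[OF f'])
    fix a assume a: "a \<in> carrier W"
    show "eact E (g a) (s a) \<in> carrier (total E)" "proj E (eact E (g a) (s a)) = a"
      using a g[OF a] by (simp_all add: E.act_closed E.proj_act)
    fix b assume b: "b \<in> carrier W"
    interpret G: group "\<L> a" by (rule group_grade[OF a])
    have ab: "a \<triangleright> b \<in> carrier W" "grade W (a \<triangleright> b) = grade W a" using a b by (simp_all add: qop_closed)
    have gab: "g (a \<triangleright> b) \<in> carrier (\<L> a)" using g[OF ab(1)] ab(2) by simp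
    have gf: "g a \<otimes>\<^bsub>\<L> a\<^esub> f (a, b) = f' (a, b) \<otimes>\<^bsub>\<L> a\<^esub> g (a \<triangleright> b)"
      using eq[OF a b] g[OF a] gab Z2_closed[OF f' a b] by (simp add: G.m_assoc[symmetric])
    have "eact E (g a) (s a) \<triangleright>\<^bsub>total E\<^esub> eact E (g b) (s b) = eact E (g a) (s a) \<triangleright>\<^bsub>total E\<^esub> s b"
      using a b g[OF a] g[OF b] by (intro E.qop_cong_proj) (simp_all add: E.act_closed E.proj_act)
    also have "\<dots> = eact E (g a) (eact E (f (a, b)) (s (a \<triangleright> b)))"
      using a b g[OF a] by (simp add: E.act_qop E.s_qop)
    also have "\<dots> = eact E (f' (a, b)) (eact E (g (a \<triangleright> b)) (s (a \<triangleright> b)))"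
      using E.act_mult[of "s (a \<triangleright> b)" "g a" "f (a, b)"] E.act_mult[of "s (a \<triangleright> b)" "f' (a, b)" "g (a \<triangleright> b)"]
        gf ab g[OF a] gab E.f_closed[OF a b] Z2_closed[OF f' a b] by simp
    finally show "eact E (g a) (s a) \<triangleright>\<^bsub>total E\<^esub> eact E (g b) (s b)
        = eact E (f' (a, b)) (eact E (g (a \<triangleright> b)) (s (a \<triangleright> b)))" .
  qed
  then show "f' \<in> ext_cocycles W \<Lambda> E" using E.ext_cocycles_iff by blast
qed

lemma coh_class_eq_iff:
  "f \<in> Z2 W \<Lambda> \<Longrightarrow> f' \<in> Z2 W \<Lambda> \<Longrightarrow> coh_class W \<Lambda> f = coh_class W \<Lambda> f' \<longleftrightarrow> (f, f') \<in> cohom_rel W \<Lambda>"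
  unfolding coh_class_def by (rule eq_equiv_class_iff[OF equiv_cohom_rel])

text \<open>A homomorphism over the identities is automatically bijective, since it maps each fibre
  equivariantly to a fibre and both are torsors under the same group.\<close>

lemma ext_equiv_iff:
  assumes E: "graded_ext W \<Lambda> E" and f: "f \<in> ext_cocycles W \<Lambda> E"
    and E': "graded_ext W \<Lambda> E'" and f': "f' \<in> ext_cocycles W \<Lambda> E'"
  shows "ext_equiv W \<Lambda> E E' \<longleftrightarrow> (f, f') \<in> cohom_rel W \<Lambda>"
proof -
  interpret E: wp_ext W \<Lambda> E by (rule wp_extI[OF E])
  interpret E': wp_ext W \<Lambda> E' by (rule wp_extI[OF E'])
  have bij: "bij_betw F (carrier (total E)) (carrier (total E'))"
    if F: "F \<in> ext_hom W \<Lambda> id (\<lambda>i. id) E E'" for F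
  proof -
    have F_pr: "F x \<in> carrier (total E')" "proj E' (F x) = proj E x" if "x \<in> carrier (total E)" for x
      using F[unfolded E.mem_ext_hom] that by auto
    have F_act: "F (eact E l x) = eact E' l (F x)"
      if "x \<in> carrier (total E)" "l \<in> carrier (\<Lambda> (E.gr x))" for x l
      using F[unfolded E.mem_ext_hom] that by auto
    show ?thesis
      unfolding bij_betw_def
    proof
      show "inj_on F (carrier (total E))"
      proof (rule inj_onI)
        fix x y assume x: "x \<in> carrier (total E)" and y: "y \<in> carrier (total E)" and eq: "F x = F y"
        have "proj E x = proj E y" using F_pr[OF x] F_pr[OF y] eq by simp
        then obtain l where l: "l \<in> carrier (\<Lambda> (E.gr x))" "eact E l x = y" using E.act_transitive[OF x y] by blast
        have "eact E' l (F x) = eact E' \<one>\<^bsub>\<Lambda> (E.gr x)\<^esub> (F x)"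
          using F_act[OF x l(1)] l(2) eq E'.act_one[OF F_pr(1)[OF x]] F_pr(2)[OF x] by simp
        moreover have "\<one>\<^bsub>\<Lambda> (E.gr x)\<^esub> \<in> carrier (\<Lambda> (E.gr x))"
          using group_grade[OF E.proj_closed[OF x]] by (simp add: group.is_monoid monoid.one_closed)
        ultimately have "l = \<one>\<^bsub>\<Lambda> (E.gr x)\<^esub>"
          using E'.act_free[OF F_pr(1)[OF x], of l "\<one>\<^bsub>\<Lambda> (E.gr x)\<^esub>"] l F_pr(2)[OF x] by simp
        then show "x = y" using l E.act_one[OF x] by simp
      qed
      show "F ` carrier (total E) = carrier (total E')"
      proof
        show "F ` carrier (total E) \<subseteq> carrier (total E')" using F_pr by auto
        show "carrier (total E') \<subseteq> F ` carrier (total E)"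
        proof
          fix y assume y: "y \<in> carrier (total E')"
          have "proj E' y \<in> proj E ` carrier (total E)" using y E.proj_surj by simp
          then obtain x where x: "x \<in> carrier (total E)" "proj E x = proj E' y" by auto
          obtain l where l: "l \<in> carrier (\<Lambda> (E'.gr (F x)))" "eact E' l (F x) = y"
            using E'.act_transitive[OF F_pr(1)[OF x(1)] y] F_pr(2)[OF x(1)] x(2) by auto
          then have l': "l \<in> carrier (\<Lambda> (E.gr x))" using F_pr(2)[OF x(1)] by simp
          show "y \<in> F ` carrier (total E)"
            using F_act[OF x(1) l'] l(2) E.act_closed[OF x(1) l'] by (metis imageI)
        qed
      qed
    qed
  qed
  have "ext_equiv W \<Lambda> E E' \<longleftrightarrow> ext_hom W \<Lambda> id (\<lambda>i. id) E E' \<noteq> {}"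
    unfolding ext_equiv_def using bij by blast
  also have "\<dots> \<longleftrightarrow> (f', f) \<in> cohom_rel W \<Lambda>" by (rule ext_hom_id_iff[OF E f E' f'])
  also have "\<dots> \<longleftrightarrow> (f, f') \<in> cohom_rel W \<Lambda>"
    using equiv_cohom_rel by (auto simp: equiv_def dest: symD)
  finally show ?thesis .
qed

lemma exts_cocycle:
  assumes "E \<in> exts W \<Lambda>" obtains f where "f \<in> Z2 W \<Lambda>" "f \<in> ext_cocycles W \<Lambda> E"
proof -
  have E: "graded_ext W \<Lambda> E" using assms by (simp add: exts_def)
  interpret E: wp_ext W \<Lambda> E by (rule wp_extI[OF E])
  show thesis using E.ext_cocycles_nonempty ext_cocycles_Z2[OF E] that by blast
qed

lemma ext_rel_class:
  assumes E: "E \<in> exts W \<Lambda>" and f: "f \<in> ext_cocycles W \<Lambda> E"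
  shows "ext_rel W \<Lambda> `` {E} = ext_class W \<Lambda> f"
proof -
  have "(E, E') \<in> ext_rel W \<Lambda> \<longleftrightarrow> E' \<in> exts W \<Lambda> \<and> f \<in> ext_cocycles W \<Lambda> E'" for E'
  proof (cases "E' \<in> exts W \<Lambda>")
    case True
    obtain f' where f': "f' \<in> ext_cocycles W \<Lambda> E'" using exts_cocycle[OF True] by blast
    have "(E, E') \<in> ext_rel W \<Lambda> \<longleftrightarrow> (f, f') \<in> cohom_rel W \<Lambda>"
      using ext_equiv_iff[of E f E' f'] E True f f' by (simp add: ext_rel_def exts_def)
    also have "\<dots> \<longleftrightarrow> (f', f) \<in> cohom_rel W \<Lambda>"
      using equiv_cohom_rel by (auto simp: equiv_def dest: symD)
    also have "\<dots> \<longleftrightarrow> f \<in> ext_cocycles W \<Lambda> E'"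
      using ext_cocycles_eq[of E' f'] True f' by (simp add: exts_def mem_coh_class)
    finally show ?thesis using True by simp
  qed (simp add: ext_rel_def)
  then show ?thesis by (auto simp: ext_class_def)
qed

lemma Ext_iff: "\<xi> \<in> Ext W \<Lambda> \<longleftrightarrow> (\<exists>f\<in>Z2 W \<Lambda>. \<xi> = ext_class W \<Lambda> f)"
proof
  assume "\<xi> \<in> Ext W \<Lambda>"
  then obtain E where E: "E \<in> exts W \<Lambda>" "\<xi> = ext_rel W \<Lambda> `` {E}" by (auto simp: Ext_def quotient_def)
  obtain f where "f \<in> Z2 W \<Lambda>" "f \<in> ext_cocycles W \<Lambda> E" using exts_cocycle[OF E(1)] .
  then show "\<exists>f\<in>Z2 W \<Lambda>. \<xi> = ext_class W \<Lambda> f" using ext_rel_class[OF E(1)] E(2) by blast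
next
  assume "\<exists>f\<in>Z2 W \<Lambda>. \<xi> = ext_class W \<Lambda> f"
  then obtain f where "f \<in> Z2 W \<Lambda>" "\<xi> = ext_class W \<Lambda> f" by blast
  then show "\<xi> \<in> Ext W \<Lambda>"
    using ext_rel_class[OF cocycle_ext[of f]] cocycle_ext(1)[of f] by (auto simp: Ext_def quotient_def)
qed

lemma H2_iff: "C \<in> H2 W \<Lambda> \<longleftrightarrow> (\<exists>f\<in>Z2 W \<Lambda>. C = coh_class W \<Lambda> f)"
  by (auto simp: H2_def quotient_def coh_class_def)

lemma HomC_iff: "D \<in> HomC W \<Lambda> \<longleftrightarrow> (\<exists>h\<in>Hom W \<Lambda>. D = conj_class W \<Lambda> h)"
  by (auto simp: HomC_def quotient_def conj_class_def)

lemma cocycle_class_ext_class: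
  assumes f: "f \<in> Z2 W \<Lambda>" shows "cocycle_class W \<Lambda> (ext_class W \<Lambda> f) = coh_class W \<Lambda> f"
proof -
  have "ext_cocycles W \<Lambda> E = coh_class W \<Lambda> f" if "E \<in> ext_class W \<Lambda> f" for E
    using that ext_cocycles_eq by (auto simp: ext_class_def exts_def)
  moreover have "cocycle_ext W \<Lambda> f \<in> ext_class W \<Lambda> f" using cocycle_ext[OF f] by (simp add: ext_class_def)
  ultimately show ?thesis by (auto simp: cocycle_class_def)
qed

lemma ext_class_eq_iff:
  assumes f: "f \<in> Z2 W \<Lambda>" and f': "f' \<in> Z2 W \<Lambda>"
  shows "ext_class W \<Lambda> f = ext_class W \<Lambda> f' \<longleftrightarrow> (f, f') \<in> cohom_rel W \<Lambda>"
proof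
  assume "ext_class W \<Lambda> f = ext_class W \<Lambda> f'"
  then have "coh_class W \<Lambda> f = coh_class W \<Lambda> f'"
    using cocycle_class_ext_class[OF f] cocycle_class_ext_class[OF f'] by simp
  then show "(f, f') \<in> cohom_rel W \<Lambda>" using coh_class_eq_iff[OF f f'] by simp
next
  assume ff': "(f, f') \<in> cohom_rel W \<Lambda>"
  have "f \<in> ext_cocycles W \<Lambda> E \<longleftrightarrow> f' \<in> ext_cocycles W \<Lambda> E" if "E \<in> exts W \<Lambda>" for E
  proof -
    have E: "graded_ext W \<Lambda> E" using that by (simp add: exts_def)
    show ?thesis
      using ext_cocycles_eq[OF E, of f] ext_cocycles_eq[OF E, of f'] coh_class_eq_iff[OF f f'] ff' 
        equiv_class_self[OF equiv_cohom_rel f] equiv_class_self[OF equiv_cohom_rel f']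
      by (metis coh_class_def)
  qed
  then show "ext_class W \<Lambda> f = ext_class W \<Lambda> f'" by (auto simp: ext_class_def)
qed

lemma conj_class_eq_iff:
  "h \<in> Hom W \<Lambda> \<Longrightarrow> h' \<in> Hom W \<Lambda> \<Longrightarrow> conj_class W \<Lambda> h = conj_class W \<Lambda> h' \<longleftrightarrow> (h, h') \<in> conj_rel W \<Lambda>"
  unfolding conj_class_def by (rule eq_equiv_class_iff[OF equiv_conj_rel])

lemma cohom_iff_conj:
  assumes "f \<in> Z2 W \<Lambda>" "f' \<in> Z2 W \<Lambda>"
  shows "(f, f') \<in> cohom_rel W \<Lambda> \<longleftrightarrow> (loop_holonomy W \<Lambda> f, loop_holonomy W \<Lambda> f') \<in> conj_rel W \<Lambda>"
  using cohom_imp_conj conj_imp_cohom[OF assms] by blast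

end

section \<open>The classification bijections\<close>

context ext_section
begin

text \<open>Moving the point above \<open>q\<^sub>i\<close> by \<open>c\<close> conjugates its monodromy by \<open>c\<close>.\<close>

lemma word_act_translate:
  assumes i: "i \<in> Ind W" and c: "c \<in> carrier (\<Lambda> i)" and k: "k \<in> carrier (\<Lambda> i)"
    and v: "v \<in> words (total E)" and loop: "map_word (proj E) v \<in> loops W (base W i)"
  shows "word_act (total E) (eact E c (s (base W i))) v = eact E k (eact E c (s (base W i))) \<longleftrightarrow>
    k = c \<otimes>\<^bsub>\<Lambda> i\<^esub> holonomy W \<Lambda> f (base W i) (map_word (proj E) v) \<otimes>\<^bsub>\<Lambda> i\<^esub> inv\<^bsub>\<Lambda> i\<^esub> c"
proof -
  interpret G: group "\<Lambda> i" by (rule group_Ind[OF i])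
  note q = base_closed[OF i]
  let ?k = "holonomy W \<Lambda> f (base W i) (map_word (proj E) v)"
  have w: "map_word (proj E) v \<in> words W" "word_act W (base W i) (map_word (proj E) v) = base W i"
    using loop by (simp_all add: loops_def)
  have hk: "?k \<in> carrier (\<Lambda> i)" using holonomy_closed[OF f_cochain q w(1)] i by simp
  have 1: "word_act (total E) (eact E c (s (base W i))) v = eact E (c \<otimes>\<^bsub>\<Lambda> i\<^esub> ?k) (s (base W i))"
    using word_act_act[OF s_closed[OF q] v] s_word_act[OF q v] act_mult[OF s_closed[OF q], of c ?k] q c hk i w
    by simp
  have 2: "eact E k (eact E c (s (base W i))) = eact E (k \<otimes>\<^bsub>\<Lambda> i\<^esub> c) (s (base W i))"
    using act_mult[OF s_closed[OF q], of k c] q c k i by simp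
  have "word_act (total E) (eact E c (s (base W i))) v = eact E k (eact E c (s (base W i)))
      \<longleftrightarrow> c \<otimes>\<^bsub>\<Lambda> i\<^esub> ?k = k \<otimes>\<^bsub>\<Lambda> i\<^esub> c"
    unfolding 1 2 using s_free[OF q, of "c \<otimes>\<^bsub>\<Lambda> i\<^esub> ?k" "k \<otimes>\<^bsub>\<Lambda> i\<^esub> c"] c k hk i by auto
  also have "\<dots> \<longleftrightarrow> k = c \<otimes>\<^bsub>\<Lambda> i\<^esub> ?k \<otimes>\<^bsub>\<Lambda> i\<^esub> inv\<^bsub>\<Lambda> i\<^esub> c"
    using c k hk G.inv_solve_right[of k "c \<otimes>\<^bsub>\<Lambda> i\<^esub> ?k" c] by auto
  finally show ?thesis .
qed

lemma monodromies_eq: "monodromies W \<Lambda> E = conj_class W \<Lambda> (loop_holonomy W \<Lambda> f)"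
proof (intro subset_antisym subsetI)
  fix h assume "h \<in> monodromies W \<Lambda> E"
  then obtain x where h: "h \<in> Hom W \<Lambda>" and x: "x \<in> (\<Pi> i\<in>Ind W. fibres E {base W i})"
    and hx: "\<forall>i\<in>Ind W. \<forall>g\<in>carrier (pi1 W (base W i)). \<forall>v\<in>words (total E).
      map_word (proj E) v \<in> g \<longrightarrow> word_act (total E) (x i) v = eact E (h i g) (x i)"
    unfolding monodromies_def by blast
  have xi: "x i \<in> carrier (total E)" "proj E (x i) = base W i" if "i \<in> Ind W" for i
    using x that by (auto simp: mem_fibre Pi_iff)
  have "(loop_holonomy W \<Lambda> f, h) \<in> conj_rel W \<Lambda>"
  proof (rule conj_relI[OF loop_holonomy_Hom[OF f_Z2] h, of "\<lambda>i. coord (x i)"])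
    fix i assume i: "i \<in> Ind W"
    show c: "coord (x i) \<in> carrier (\<Lambda> i)" using coord_closed[OF xi(1)[OF i]] xi(2)[OF i] i by simp
    fix w assume w: "w \<in> loops W (base W i)"
    have "w \<in> words W" using w by (simp add: loops_def)
    then obtain v where v: "v \<in> words (total E)" "map_word (proj E) v = w" using lift_word by blast
    have "adj_class W w \<in> carrier (pi1 W (base W i))" using w i by (simp add: carrier_pi1 base_closed)
    moreover have "map_word (proj E) v \<in> adj_class W w"
      using v self_mem_adj_class[OF \<open>w \<in> words W\<close>] by simp
    ultimately have "word_act (total E) (x i) v = eact E (h i (adj_class W w)) (x i)"
      using hx i v(1) by blast
    then show "h i (adj_class W w) = coord (x i) \<otimes>\<^bsub>\<Lambda> i\<^esub> loop_holonomy W \<Lambda> f i (adj_class W w)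
        \<otimes>\<^bsub>\<Lambda> i\<^esub> inv\<^bsub>\<Lambda> i\<^esub> coord (x i)"
      using word_act_translate[OF i c Hom_closed[OF h i w] v(1)] v(2) w act_coord[OF xi(1)[OF i]] xi(2)[OF i]
      by (simp add: loop_holonomy_class[OF f_Z2 i w])
  qed
  then show "h \<in> conj_class W \<Lambda> (loop_holonomy W \<Lambda> f)" by (simp add: conj_class_def)
next
  fix h assume "h \<in> conj_class W \<Lambda> (loop_holonomy W \<Lambda> f)"
  then obtain c where h: "h \<in> Hom W \<Lambda>" and conj: "conjugates c (loop_holonomy W \<Lambda> f) h"
    by (auto simp: conj_class_def conj_rel_iff)
  note c = conjugates_closed[OF conj] and eq = conjugates_eq[OF conj]
  show "h \<in> monodromies W \<Lambda> E"
    unfolding monodromies_def mem_Collect_eq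
  proof (intro conjI bexI[of _ "\<lambda>i. eact E (c i) (s (base W i))"] ballI impI)
    show "h \<in> Hom W \<Lambda>" by (rule h)
    show "(\<lambda>i. eact E (c i) (s (base W i))) \<in> (\<Pi> i\<in>Ind W. fibres E {base W i})"
      using c base_closed by (auto simp: mem_fibre act_closed proj_act)
    fix i g v assume i: "i \<in> Ind W" and g: "g \<in> carrier (pi1 W (base W i))" and v: "v \<in> words (total E)"
      and vg: "map_word (proj E) v \<in> g"
    obtain w where w: "w \<in> loops W (base W i)" "g = adj_class W w"
      using g by (auto simp: carrier_pi1 base_closed i)
    have wv: "adj_eq W w (map_word (proj E) v)" using vg w(2) by (simp add: mem_adj_class)
    have lv: "map_word (proj E) v \<in> loops W (base W i)" by (rule adj_eq_loops[OF wv w(1) base_closed[OF i]])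
    have gv: "g = adj_class W (map_word (proj E) v)" using w wv by (simp add: adj_class_eq_iff loops_def)
    show "word_act (total E) (eact E (c i) (s (base W i))) v = eact E (h i g) (eact E (c i) (s (base W i)))"
      using word_act_translate[OF i c[OF i] Hom_closed[OF h i lv] v lv] eq[OF i lv]
        loop_holonomy_class[OF f_Z2 i lv] gv by simp
  qed
qed

end

lemma equiv_Image_image:
  assumes "equiv A r" and "y \<in> X" and "\<And>x. x \<in> X \<Longrightarrow> (y, x) \<in> r"
  shows "r `` X = r `` {y}"
  using assms unfolding equiv_def by (auto dest: transD)

context wp_coeffs
begin

lemma Ext_image: "Ext W \<Lambda> = ext_class W \<Lambda> ` Z2 W \<Lambda>"
  using Ext_iff by auto

lemma bij_cocycle_class: "bij_betw (cocycle_class W \<Lambda>) (Ext W \<Lambda>) (H2 W \<Lambda>)"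
  unfolding bij_betw_def
proof
  show "inj_on (cocycle_class W \<Lambda>) (Ext W \<Lambda>)"
  proof (rule inj_onI)
    fix \<xi> \<eta> assume "\<xi> \<in> Ext W \<Lambda>" "\<eta> \<in> Ext W \<Lambda>" and eq: "cocycle_class W \<Lambda> \<xi> = cocycle_class W \<Lambda> \<eta>"
    then obtain f f' where f: "f \<in> Z2 W \<Lambda>" "f' \<in> Z2 W \<Lambda>" "\<xi> = ext_class W \<Lambda> f" "\<eta> = ext_class W \<Lambda> f'"
      by (auto simp: Ext_iff)
    show "\<xi> = \<eta>"
      using eq f(1,2) unfolding f(3,4) by (simp only: cocycle_class_ext_class coh_class_eq_iff ext_class_eq_iff)
  qed
  show "cocycle_class W \<Lambda> ` Ext W \<Lambda> = H2 W \<Lambda>"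
    unfolding Ext_image image_image using cocycle_class_ext_class by (auto simp: H2_iff)
qed

lemma monodromy_class_ext_class:
  assumes f: "f \<in> Z2 W \<Lambda>"
  shows "monodromy_class W \<Lambda> (ext_class W \<Lambda> f) = conj_class W \<Lambda> (loop_holonomy W \<Lambda> f)"
proof -
  have "monodromies W \<Lambda> E = conj_class W \<Lambda> (loop_holonomy W \<Lambda> f)" if "E \<in> ext_class W \<Lambda> f" for E
  proof -
    have "graded_ext W \<Lambda> E" "f \<in> ext_cocycles W \<Lambda> E" using that by (simp_all add: ext_class_def exts_def)
    then obtain s where "ext_section W \<Lambda> E s f" by (rule ext_sectionE)
    then show ?thesis by (rule ext_section.monodromies_eq)
  qed
  moreover have "cocycle_ext W \<Lambda> f \<in> ext_class W \<Lambda> f" using cocycle_ext[OF f] by (simp add: ext_class_def)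
  ultimately show ?thesis by (auto simp: monodromy_class_def)
qed

lemma bij_monodromy_class: "bij_betw (monodromy_class W \<Lambda>) (Ext W \<Lambda>) (HomC W \<Lambda>)"
  unfolding bij_betw_def
proof
  show "inj_on (monodromy_class W \<Lambda>) (Ext W \<Lambda>)"
  proof (rule inj_onI)
    fix \<xi> \<eta> assume "\<xi> \<in> Ext W \<Lambda>" "\<eta> \<in> Ext W \<Lambda>" and eq: "monodromy_class W \<Lambda> \<xi> = monodromy_class W \<Lambda> \<eta>"
    then obtain f f' where f: "f \<in> Z2 W \<Lambda>" "f' \<in> Z2 W \<Lambda>" "\<xi> = ext_class W \<Lambda> f" "\<eta> = ext_class W \<Lambda> f'"
      by (auto simp: Ext_iff)
    show "\<xi> = \<eta>"
      using eq f(1,2) loop_holonomy_Hom unfolding f(3,4)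
      by (simp only: monodromy_class_ext_class conj_class_eq_iff ext_class_eq_iff cohom_iff_conj)
  qed
  have "monodromy_class W \<Lambda> ` Ext W \<Lambda> = (\<lambda>f. monodromy_class W \<Lambda> (ext_class W \<Lambda> f)) ` Z2 W \<Lambda>"
    unfolding Ext_image image_image ..
  also have "\<dots> = (\<lambda>f. conj_class W \<Lambda> (loop_holonomy W \<Lambda> f)) ` Z2 W \<Lambda>"
    by (rule image_cong) (simp_all add: monodromy_class_ext_class)
  also have "\<dots> = conj_class W \<Lambda> ` Hom W \<Lambda>"
    using loop_holonomy_surj loop_holonomy_Hom by (auto simp: image_iff)
  also have "\<dots> = HomC W \<Lambda>" by (auto simp: HomC_iff)
  finally show "monodromy_class W \<Lambda> ` Ext W \<Lambda> = HomC W \<Lambda>" .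
qed

end

locale wp_comm_coeffs = wp_coeffs W \<Lambda>
  for W :: "('a, 'i, 'z) wpquandle_scheme" (structure) and \<Lambda> :: "'i \<Rightarrow> ('l, 'g) monoid_scheme" +
  assumes comm: "i \<in> Ind W \<Longrightarrow> comm_group (\<Lambda> i)"
begin

lemma conj_class_singleton:
  assumes h: "h \<in> Hom W \<Lambda>" shows "conj_class W \<Lambda> h = {h}"
proof -
  have "h' = h" if hh': "(h, h') \<in> conj_rel W \<Lambda>" for h'
  proof -
    obtain c where h': "h' \<in> Hom W \<Lambda>" and conj: "conjugates c h h'"
      using hh' by (auto simp: conj_rel_iff)
    note c = conjugates_closed[OF conj] and eq = conjugates_eq[OF conj]
    show ?thesis
    proof (rule Hom_eqI[OF h' h])
      fix i w assume i: "i \<in> Ind W" and w: "w \<in> loops W (base W i)"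
      interpret G: comm_group "\<Lambda> i" by (rule comm[OF i])
      show "h' i (adj_class W w) = h i (adj_class W w)"
        using eq[OF i w] c[OF i] Hom_closed[OF h i w] by (simp add: G.m_comm[of "c i"] G.m_assoc)
    qed
  qed
  moreover have "(h, h) \<in> conj_rel W \<Lambda>" using equiv_conj_rel h by (simp add: equiv_def refl_on_def)
  ultimately show ?thesis by (auto simp: conj_class_def)
qed

lemma monodromy_hom_ext_class:
  "f \<in> Z2 W \<Lambda> \<Longrightarrow> monodromy_hom W \<Lambda> (ext_class W \<Lambda> f) = loop_holonomy W \<Lambda> f"
  by (simp add: monodromy_hom_def monodromy_class_ext_class conj_class_singleton loop_holonomy_Hom)

lemma monodromy_class_singleton:
  "\<xi> \<in> Ext W \<Lambda> \<Longrightarrow> monodromy_class W \<Lambda> \<xi> = {monodromy_hom W \<Lambda> \<xi>}"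
  by (auto simp: Ext_iff monodromy_hom_ext_class monodromy_class_ext_class conj_class_singleton loop_holonomy_Hom)

lemma bij_monodromy_hom: "bij_betw (monodromy_hom W \<Lambda>) (Ext W \<Lambda>) (Hom W \<Lambda>)"
  unfolding bij_betw_def
proof
  show "inj_on (monodromy_hom W \<Lambda>) (Ext W \<Lambda>)"
  proof (rule inj_onI)
    fix \<xi> \<eta> assume *: "\<xi> \<in> Ext W \<Lambda>" "\<eta> \<in> Ext W \<Lambda>" "monodromy_hom W \<Lambda> \<xi> = monodromy_hom W \<Lambda> \<eta>"
    then have "monodromy_class W \<Lambda> \<xi> = monodromy_class W \<Lambda> \<eta>" by (simp add: monodromy_class_singleton)
    then show "\<xi> = \<eta>" using bij_monodromy_class * by (auto simp: bij_betw_def dest: inj_onD)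
  qed
  have "monodromy_hom W \<Lambda> ` Ext W \<Lambda> = (\<lambda>f. monodromy_hom W \<Lambda> (ext_class W \<Lambda> f)) ` Z2 W \<Lambda>"
    unfolding Ext_image image_image ..
  also have "\<dots> = loop_holonomy W \<Lambda> ` Z2 W \<Lambda>"
    by (rule image_cong) (simp_all add: monodromy_hom_ext_class)
  also have "\<dots> = Hom W \<Lambda>"
    using loop_holonomy_surj loop_holonomy_Hom by (auto simp: image_iff)
  finally show "monodromy_hom W \<Lambda> ` Ext W \<Lambda> = Hom W \<Lambda>" .
qed

end

section \<open>Naturality\<close>

context coeff_map
begin

lemma cohom_push:
  assumes "(f, f') \<in> cohom_rel W \<Lambda>"
  shows "(push_cochain W \<psi> f, push_cochain W \<psi> f') \<in> cohom_rel W \<Lambda>'"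
proof -
  obtain g where f: "f \<in> Z2 W \<Lambda>" "f' \<in> Z2 W \<Lambda>"
    and cob: "cobounds g f f'"
    using assms by (auto simp: cohom_rel_iff)
  note g = cobounds_closed[OF cob] and eq = cobounds_eq[OF cob]
  show ?thesis
  proof (rule C'.cohom_relI[OF Z2_push[OF f(1)] Z2_push[OF f(2)], of "\<lambda>a. \<psi> (grade W a) (g a)"])
    fix a assume a: "a \<in> carrier W"
    note i = grade_Ind[OF a]
    interpret G: group "\<L> a" by (rule group_Ind[OF i])
    show "\<psi> (grade W a) (g a) \<in> carrier (\<Lambda>' (grade W a))" by (rule push_closed[OF i g[OF a]])
    fix b assume b: "b \<in> carrier W"
    have gab: "g (a \<triangleright> b) \<in> carrier (\<L> a)" using g[of "a \<triangleright> b"] a b by (simp add: qop_closed)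
    show "push_cochain W \<psi> f (a, b) = inv\<^bsub>\<Lambda>' (grade W a)\<^esub> \<psi> (grade W a) (g a) \<otimes>\<^bsub>\<Lambda>' (grade W a)\<^esub>
       push_cochain W \<psi> f' (a, b) \<otimes>\<^bsub>\<Lambda>' (grade W a)\<^esub> \<psi> (grade W (a \<triangleright> b)) (g (a \<triangleright> b))"
      using a b g[OF a] gab Z2_closed[OF f(2) a b] by (simp add: eq push_mult[OF i] push_inv[OF i])
  qed
qed

lemma H2_push_coh_class:
  assumes f: "f \<in> Z2 W \<Lambda>"
  shows "H2_push W \<Lambda>' \<psi> (coh_class W \<Lambda> f) = coh_class W \<Lambda>' (push_cochain W \<psi> f)"
  unfolding H2_push_def coh_class_def push_cochain_def[symmetric]
proof (rule equiv_Image_image[OF C'.equiv_cohom_rel])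
  show "push_cochain W \<psi> f \<in> push_cochain W \<psi> ` cohom_rel W \<Lambda> `` {f}"
    using equiv_class_self[OF equiv_cohom_rel f] by (rule imageI)
qed (use cohom_push in auto)

lemma ext_push_ext_class:
  assumes f: "f \<in> Z2 W \<Lambda>"
  shows "ext_push W \<Lambda> \<Lambda>' \<psi> (ext_class W \<Lambda> f) = ext_class W \<Lambda>' (push_cochain W \<psi> f)"
proof -
  have iff: "ext_hom W \<Lambda> id \<psi> E E' \<noteq> {} \<longleftrightarrow> push_cochain W \<psi> f \<in> ext_cocycles W \<Lambda>' E'"
    if E: "E \<in> ext_class W \<Lambda> f" and E': "E' \<in> exts W \<Lambda>'" for E E'
  proof -
    have g: "graded_ext W \<Lambda> E" "f \<in> ext_cocycles W \<Lambda> E" "graded_ext W \<Lambda>' E'"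
      using E E' by (simp_all add: ext_class_def exts_def)
    obtain f' where f': "f' \<in> Z2 W \<Lambda>'" "f' \<in> ext_cocycles W \<Lambda>' E'" using C'.exts_cocycle[OF E'] .
    obtain s s' where "ext_section W \<Lambda> E s f" "ext_section W \<Lambda>' E' s' f'"
      using ext_sectionE[OF g(1,2)] C'.ext_sectionE[OF g(3) f'(2)] by metis
    from ext_hom_iff_cohomologous[OF this wp_map_id[OF well_pointed_axioms] \<psi>]
    have "ext_hom W \<Lambda> id \<psi> E E' \<noteq> {} \<longleftrightarrow> (f', push_cochain W \<psi> f) \<in> cohom_rel W \<Lambda>'"
      by (simp add: C'.pull_id C'.Z2_cochain[OF f'(1)])
    then show ?thesis using C'.ext_cocycles_eq[OF g(3) f'(2)] by (simp add: C'.mem_coh_class)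
  qed
  have "cocycle_ext W \<Lambda> f \<in> ext_class W \<Lambda> f" using cocycle_ext[OF f] by (simp add: ext_class_def)
  then have "E' \<in> ext_push W \<Lambda> \<Lambda>' \<psi> (ext_class W \<Lambda> f) \<longleftrightarrow> E' \<in> ext_class W \<Lambda>' (push_cochain W \<psi> f)" for E'
    unfolding ext_push_def ext_class_def[of W \<Lambda>'] mem_Collect_eq using iff by blast
  then show ?thesis by blast
qed

lemma hom_push_Hom:
  assumes h: "h \<in> Hom W \<Lambda>" shows "hom_push W \<psi> h \<in> Hom W \<Lambda>'"
  by (rule C'.HomI)
    (use h in \<open>auto simp: hom_push_def carrier_pi1 base_closed loops_append Hom_closed Hom_mult push_closed push_mult\<close>)

lemma hom_push_class:
  "i \<in> Ind W \<Longrightarrow> w \<in> loops W (base W i) \<Longrightarrow> hom_push W \<psi> h i (adj_class W w) = \<psi> i (h i (adj_class W w))"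
  by (simp add: hom_push_def carrier_pi1 base_closed)

lemma loop_holonomy_push:
  assumes f: "f \<in> Z2 W \<Lambda>"
  shows "loop_holonomy W \<Lambda>' (push_cochain W \<psi> f) = hom_push W \<psi> (loop_holonomy W \<Lambda> f)"
proof (rule C'.Hom_eqI[OF C'.loop_holonomy_Hom[OF Z2_push[OF f]] hom_push_Hom[OF loop_holonomy_Hom[OF f]]])
  fix i w assume i: "i \<in> Ind W" and w: "w \<in> loops W (base W i)"
  then show "loop_holonomy W \<Lambda>' (push_cochain W \<psi> f) i (adj_class W w)
      = hom_push W \<psi> (loop_holonomy W \<Lambda> f) i (adj_class W w)"
    using holonomy_push[OF f base_closed[OF i], of w]
    by (simp add: hom_push_class C'.loop_holonomy_class[OF Z2_push[OF f]] loop_holonomy_class[OF f]) (simp add: loops_def)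
qed

lemma HomC_push_conj_class:
  assumes h: "h \<in> Hom W \<Lambda>"
  shows "HomC_push W \<Lambda>' \<psi> (conj_class W \<Lambda> h) = conj_class W \<Lambda>' (hom_push W \<psi> h)"
  unfolding HomC_push_def conj_class_def
proof (rule equiv_Image_image[OF C'.equiv_conj_rel])
  show "hom_push W \<psi> h \<in> hom_push W \<psi> ` conj_rel W \<Lambda> `` {h}"
    using equiv_class_self[OF equiv_conj_rel h] by (rule imageI)
  fix k assume "k \<in> hom_push W \<psi> ` conj_rel W \<Lambda> `` {h}"
  then obtain h' where k: "k = hom_push W \<psi> h'" and hh': "(h, h') \<in> conj_rel W \<Lambda>" by auto
  obtain c where h': "h' \<in> Hom W \<Lambda>" and conj: "conjugates c h h'"
    using hh' by (auto simp: conj_rel_iff)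
  note c = conjugates_closed[OF conj] and eq = conjugates_eq[OF conj]
  show "(hom_push W \<psi> h, k) \<in> conj_rel W \<Lambda>'"
    unfolding k
  proof (rule C'.conj_relI[OF hom_push_Hom[OF h] hom_push_Hom[OF h'], of "\<lambda>i. \<psi> i (c i)"])
    fix i assume i: "i \<in> Ind W"
    interpret G: group "\<Lambda> i" by (rule group_Ind[OF i])
    show "\<psi> i (c i) \<in> carrier (\<Lambda>' i)" by (rule push_closed[OF i c[OF i]])
    fix w assume w: "w \<in> loops W (base W i)"
    show "hom_push W \<psi> h' i (adj_class W w)
        = \<psi> i (c i) \<otimes>\<^bsub>\<Lambda>' i\<^esub> hom_push W \<psi> h i (adj_class W w) \<otimes>\<^bsub>\<Lambda>' i\<^esub> inv\<^bsub>\<Lambda>' i\<^esub> \<psi> i (c i)"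
      using c[OF i] Hom_closed[OF h i w]
      by (simp add: hom_push_class[OF i w] eq[OF i w] push_mult[OF i] push_inv[OF i])
  qed
qed

lemma naturality_push:
  assumes "\<xi> \<in> Ext W \<Lambda>"
  shows "ext_push W \<Lambda> \<Lambda>' \<psi> \<xi> \<in> Ext W \<Lambda>'"
    and "cocycle_class W \<Lambda>' (ext_push W \<Lambda> \<Lambda>' \<psi> \<xi>) = H2_push W \<Lambda>' \<psi> (cocycle_class W \<Lambda> \<xi>)"
    and "monodromy_class W \<Lambda>' (ext_push W \<Lambda> \<Lambda>' \<psi> \<xi>) = HomC_push W \<Lambda>' \<psi> (monodromy_class W \<Lambda> \<xi>)"
proof -
  obtain f where f: "f \<in> Z2 W \<Lambda>" "\<xi> = ext_class W \<Lambda> f" using assms Ext_iff by blast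
  note pf = Z2_push[OF f(1)]
  show "ext_push W \<Lambda> \<Lambda>' \<psi> \<xi> \<in> Ext W \<Lambda>'"
    unfolding f(2) ext_push_ext_class[OF f(1)] C'.Ext_iff using pf by blast
  show "cocycle_class W \<Lambda>' (ext_push W \<Lambda> \<Lambda>' \<psi> \<xi>) = H2_push W \<Lambda>' \<psi> (cocycle_class W \<Lambda> \<xi>)"
    unfolding f(2) ext_push_ext_class[OF f(1)] cocycle_class_ext_class[OF f(1)]
      C'.cocycle_class_ext_class[OF pf] H2_push_coh_class[OF f(1)] ..
  show "monodromy_class W \<Lambda>' (ext_push W \<Lambda> \<Lambda>' \<psi> \<xi>) = HomC_push W \<Lambda>' \<psi> (monodromy_class W \<Lambda> \<xi>)"
    unfolding f(2) ext_push_ext_class[OF f(1)] monodromy_class_ext_class[OF f(1)]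
      C'.monodromy_class_ext_class[OF pf] HomC_push_conj_class[OF loop_holonomy_Hom[OF f(1)]]
      loop_holonomy_push[OF f(1)] ..
qed

end

locale coeff_pull = wp_map V W \<phi> + C: wp_coeffs W \<Lambda>
  for V :: "('a, 'i, 'y) wpquandle_scheme" and W :: "('b, 'i, 'z) wpquandle_scheme"
    and \<phi> :: "'a \<Rightarrow> 'b" and \<Lambda> :: "'i \<Rightarrow> ('l, 'g) monoid_scheme"
begin

sublocale D: wp_coeffs V \<Lambda>
  by (rule graded_coeffs[OF C.wp_coeffs_axioms])

lemma cohom_pull:
  assumes "(f, f') \<in> cohom_rel W \<Lambda>"
  shows "(pull_cochain V \<phi> f, pull_cochain V \<phi> f') \<in> cohom_rel V \<Lambda>"
proof -
  obtain g where f: "f \<in> Z2 W \<Lambda>" "f' \<in> Z2 W \<Lambda>"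
    and cob: "C.cobounds g f f'"
    using assms by (auto simp: C.cohom_rel_iff)
  note g = C.cobounds_closed[OF cob] and eq = C.cobounds_eq[OF cob]
  show ?thesis
  proof (rule D.cohom_relI[OF Z2_pull[OF C.wp_coeffs_axioms f(1)] Z2_pull[OF C.wp_coeffs_axioms f(2)],
        of "\<lambda>a. g (\<phi> a)"])
    fix a assume a: "a \<in> carrier V"
    show "g (\<phi> a) \<in> carrier (\<Lambda> (grade V a))" using g[of "\<phi> a"] a by simp
    fix b assume b: "b \<in> carrier V"
    show "pull_cochain V \<phi> f (a, b) = inv\<^bsub>\<Lambda> (grade V a)\<^esub> g (\<phi> a) \<otimes>\<^bsub>\<Lambda> (grade V a)\<^esub>
       pull_cochain V \<phi> f' (a, b) \<otimes>\<^bsub>\<Lambda> (grade V a)\<^esub> g (\<phi> (a \<triangleright>\<^bsub>V\<^esub> b))"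
      using eq[of "\<phi> a" "\<phi> b"] a b by (simp add: map_qop)
  qed
qed

lemma H2_pull_coh_class:
  assumes f: "f \<in> Z2 W \<Lambda>"
  shows "H2_pull V \<Lambda> \<phi> (coh_class W \<Lambda> f) = coh_class V \<Lambda> (pull_cochain V \<phi> f)"
  unfolding H2_pull_def coh_class_def pull_cochain_def[symmetric]
proof (rule equiv_Image_image[OF D.equiv_cohom_rel])
  show "pull_cochain V \<phi> f \<in> pull_cochain V \<phi> ` cohom_rel W \<Lambda> `` {f}"
    using equiv_class_self[OF C.equiv_cohom_rel f] by (rule imageI)
qed (use cohom_pull in auto)

lemma ext_pull_ext_class:
  assumes f: "f \<in> Z2 W \<Lambda>"
  shows "ext_pull V \<Lambda> \<phi> (ext_class W \<Lambda> f) = ext_class V \<Lambda> (pull_cochain V \<phi> f)"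
proof -
  have iff: "ext_hom V \<Lambda> \<phi> (\<lambda>i. id) E E' \<noteq> {} \<longleftrightarrow> pull_cochain V \<phi> f \<in> ext_cocycles V \<Lambda> E"
    if E: "E \<in> exts V \<Lambda>" and E': "E' \<in> ext_class W \<Lambda> f" for E E'
  proof -
    have g: "graded_ext V \<Lambda> E" "graded_ext W \<Lambda> E'" "f \<in> ext_cocycles W \<Lambda> E'"
      using E E' by (simp_all add: ext_class_def exts_def)
    obtain f' where f': "f' \<in> Z2 V \<Lambda>" "f' \<in> ext_cocycles V \<Lambda> E" using D.exts_cocycle[OF E] .
    obtain s s' where "ext_section V \<Lambda> E s f'" "ext_section W \<Lambda> E' s' f"
      using D.ext_sectionE[OF g(1) f'(2)] C.ext_sectionE[OF g(2,3)] by metis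
    from ext_hom_iff_cohomologous[OF this wp_map_axioms D.graded_hom_id]
    have "ext_hom V \<Lambda> \<phi> (\<lambda>i. id) E E' \<noteq> {} \<longleftrightarrow> (pull_cochain V \<phi> f, f') \<in> cohom_rel V \<Lambda>"
      by (simp add: D.push_id D.Z2_cochain[OF f'(1)])
    also have "\<dots> \<longleftrightarrow> (f', pull_cochain V \<phi> f) \<in> cohom_rel V \<Lambda>"
      using D.equiv_cohom_rel by (auto simp: equiv_def dest: symD)
    finally show ?thesis using D.ext_cocycles_eq[OF g(1) f'(2)] by (simp add: D.mem_coh_class)
  qed
  have "cocycle_ext W \<Lambda> f \<in> ext_class W \<Lambda> f" using C.cocycle_ext[OF f] by (simp add: ext_class_def)
  then have "E \<in> ext_pull V \<Lambda> \<phi> (ext_class W \<Lambda> f) \<longleftrightarrow> E \<in> ext_class V \<Lambda> (pull_cochain V \<phi> f)" for E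
    unfolding ext_pull_def ext_class_def[of V \<Lambda>] mem_Collect_eq using iff by blast
  then show ?thesis by blast
qed

lemma hom_pull_class:
  assumes i: "i \<in> Ind W" and w: "w \<in> loops V (base V i)"
  shows "hom_pull V W \<phi> h i (adj_class V w) = h i (adj_class W (map_word \<phi> w))"
  using i w Adj_map_class[of w] by (simp add: hom_pull_def V.carrier_pi1 V.base_closed Ind_eq loops_def)

lemma hom_pull_Hom:
  assumes h: "h \<in> Hom W \<Lambda>" shows "hom_pull V W \<phi> h \<in> Hom V \<Lambda>"
proof (rule D.HomI)
  show "hom_pull V W \<phi> h \<in> extensional (Ind V)"
    "\<And>i. i \<in> Ind V \<Longrightarrow> hom_pull V W \<phi> h i \<in> extensional (carrier (pi1 V (base V i)))"
    by (simp_all add: hom_pull_def)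
  fix i u assume "i \<in> Ind V" and u: "u \<in> loops V (base V i)"
  then have i: "i \<in> Ind W" by (simp add: Ind_eq)
  show "hom_pull V W \<phi> h i (adj_class V u) \<in> carrier (\<Lambda> i)"
    unfolding hom_pull_class[OF i u] by (rule C.Hom_closed[OF h i map_loops[OF i u]])
  fix v assume v: "v \<in> loops V (base V i)"
  show "hom_pull V W \<phi> h i (adj_class V (u @ v))
      = hom_pull V W \<phi> h i (adj_class V u) \<otimes>\<^bsub>\<Lambda> i\<^esub> hom_pull V W \<phi> h i (adj_class V v)"
    unfolding hom_pull_class[OF i u] hom_pull_class[OF i v] hom_pull_class[OF i V.loops_append[OF u v]] map_word_simps
    by (rule C.Hom_mult[OF h i map_loops[OF i u] map_loops[OF i v]])
qed

lemma loop_holonomy_pull: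
  assumes f: "f \<in> Z2 W \<Lambda>"
  shows "loop_holonomy V \<Lambda> (pull_cochain V \<phi> f) = hom_pull V W \<phi> (loop_holonomy W \<Lambda> f)"
proof (rule D.Hom_eqI[OF D.loop_holonomy_Hom[OF Z2_pull[OF C.wp_coeffs_axioms f]]
      hom_pull_Hom[OF C.loop_holonomy_Hom[OF f]]])
  fix i w assume i: "i \<in> Ind V" and w: "w \<in> loops V (base V i)"
  have i': "i \<in> Ind W" using i by (simp add: Ind_eq)
  have "w \<in> words V" using w by (simp add: loops_def)
  then show "loop_holonomy V \<Lambda> (pull_cochain V \<phi> f) i (adj_class V w)
      = hom_pull V W \<phi> (loop_holonomy W \<Lambda> f) i (adj_class V w)"
    unfolding hom_pull_class[OF i' w] C.loop_holonomy_class[OF f i' map_loops[OF i' w]]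
      D.loop_holonomy_class[OF Z2_pull[OF C.wp_coeffs_axioms f] i w]
    by (simp add: holonomy_pull V.base_closed[OF i] base_map[OF i'])
qed

lemma HomC_pull_conj_class:
  assumes h: "h \<in> Hom W \<Lambda>"
  shows "HomC_pull V W \<Lambda> \<phi> (conj_class W \<Lambda> h) = conj_class V \<Lambda> (hom_pull V W \<phi> h)"
  unfolding HomC_pull_def conj_class_def
proof (rule equiv_Image_image[OF D.equiv_conj_rel])
  show "hom_pull V W \<phi> h \<in> hom_pull V W \<phi> ` conj_rel W \<Lambda> `` {h}"
    using equiv_class_self[OF C.equiv_conj_rel h] by (rule imageI)
  fix k assume "k \<in> hom_pull V W \<phi> ` conj_rel W \<Lambda> `` {h}"
  then obtain h' where k: "k = hom_pull V W \<phi> h'" and hh': "(h, h') \<in> conj_rel W \<Lambda>" by auto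
  obtain c where h': "h' \<in> Hom W \<Lambda>" and conj: "C.conjugates c h h'"
    using hh' by (auto simp: C.conj_rel_iff)
  note c = C.conjugates_closed[OF conj] and eq = C.conjugates_eq[OF conj]
  show "(hom_pull V W \<phi> h, k) \<in> conj_rel V \<Lambda>"
    unfolding k
  proof (rule D.conj_relI[OF hom_pull_Hom[OF h] hom_pull_Hom[OF h'], of c])
    fix i assume "i \<in> Ind V"
    then have i: "i \<in> Ind W" by (simp add: Ind_eq)
    show "c i \<in> carrier (\<Lambda> i)" by (rule c[OF i])
    fix w assume w: "w \<in> loops V (base V i)"
    show "hom_pull V W \<phi> h' i (adj_class V w)
        = c i \<otimes>\<^bsub>\<Lambda> i\<^esub> hom_pull V W \<phi> h i (adj_class V w) \<otimes>\<^bsub>\<Lambda> i\<^esub> inv\<^bsub>\<Lambda> i\<^esub> c i"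
      unfolding hom_pull_class[OF i w] by (rule eq[OF i map_loops[OF i w]])
  qed
qed

lemma naturality_pull:
  assumes "\<xi> \<in> Ext W \<Lambda>"
  shows "ext_pull V \<Lambda> \<phi> \<xi> \<in> Ext V \<Lambda>"
    and "cocycle_class V \<Lambda> (ext_pull V \<Lambda> \<phi> \<xi>) = H2_pull V \<Lambda> \<phi> (cocycle_class W \<Lambda> \<xi>)"
    and "monodromy_class V \<Lambda> (ext_pull V \<Lambda> \<phi> \<xi>) = HomC_pull V W \<Lambda> \<phi> (monodromy_class W \<Lambda> \<xi>)"
proof -
  obtain f where f: "f \<in> Z2 W \<Lambda>" "\<xi> = ext_class W \<Lambda> f" using assms C.Ext_iff by blast
  note pf = Z2_pull[OF C.wp_coeffs_axioms f(1)]
  show "ext_pull V \<Lambda> \<phi> \<xi> \<in> Ext V \<Lambda>"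
    unfolding f(2) ext_pull_ext_class[OF f(1)] D.Ext_iff using pf by blast
  show "cocycle_class V \<Lambda> (ext_pull V \<Lambda> \<phi> \<xi>) = H2_pull V \<Lambda> \<phi> (cocycle_class W \<Lambda> \<xi>)"
    unfolding f(2) ext_pull_ext_class[OF f(1)] C.cocycle_class_ext_class[OF f(1)]
      D.cocycle_class_ext_class[OF pf] H2_pull_coh_class[OF f(1)] ..
  show "monodromy_class V \<Lambda> (ext_pull V \<Lambda> \<phi> \<xi>) = HomC_pull V W \<Lambda> \<phi> (monodromy_class W \<Lambda> \<xi>)"
    unfolding f(2) ext_pull_ext_class[OF f(1)] C.monodromy_class_ext_class[OF f(1)]
      D.monodromy_class_ext_class[OF pf] HomC_pull_conj_class[OF C.loop_holonomy_Hom[OF f(1)]]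
      loop_holonomy_pull[OF f(1)] ..
qed

end

section \<open>Decomposition into graded parts\<close>

text \<open>A decomposition as a product is carried along bijections that are natural for the
  projections. This derives the decompositions of \<open>Ext\<close> and \<open>Hom\<close> from the one of \<open>H\<^sup>2\<close>.\<close>

lemma product_bij_transport:
  assumes k: "bij_betw k A B" and k': "\<And>i. i \<in> I \<Longrightarrow> bij_betw (k' i) (A' i) (B' i)"
    and p: "\<And>i a. i \<in> I \<Longrightarrow> a \<in> A \<Longrightarrow> p i a \<in> A' i"
    and comm: "\<And>i a. i \<in> I \<Longrightarrow> a \<in> A \<Longrightarrow> k' i (p i a) = p' i (k a)"
    and bij: "bij_betw (\<lambda>b. \<lambda>i\<in>I. p' i b) B (\<Pi>\<^sub>E i\<in>I. B' i)"
  shows "bij_betw (\<lambda>a. \<lambda>i\<in>I. p i a) A (\<Pi>\<^sub>E i\<in>I. A' i)"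
  unfolding bij_betw_def
proof
  show "inj_on (\<lambda>a. \<lambda>i\<in>I. p i a) A"
  proof (rule inj_onI)
    fix a a' assume a: "a \<in> A" "a' \<in> A" and eq: "(\<lambda>i\<in>I. p i a) = (\<lambda>i\<in>I. p i a')"
    have "p i a = p i a'" if "i \<in> I" for i using fun_cong[OF eq, of i] that by simp
    then have "(\<lambda>i\<in>I. p' i (k a)) = (\<lambda>i\<in>I. p' i (k a'))"
      using comm a by (intro restrict_ext) (simp flip: comm)
    moreover have "k a \<in> B" "k a' \<in> B" using k a by (auto simp: bij_betw_def)
    ultimately have "k a = k a'" using bij by (auto simp: bij_betw_def inj_on_def)
    then show "a = a'" using k a by (auto simp: bij_betw_def inj_on_def)
  qed
  show "(\<lambda>a. \<lambda>i\<in>I. p i a) ` A = (\<Pi>\<^sub>E i\<in>I. A' i)"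
  proof (intro subset_antisym subsetI)
    fix t assume t: "t \<in> (\<Pi>\<^sub>E i\<in>I. A' i)"
    have "(\<lambda>i\<in>I. k' i (t i)) \<in> (\<Pi>\<^sub>E i\<in>I. B' i)" using t k' by (auto simp: bij_betw_def)
    then have "(\<lambda>i\<in>I. k' i (t i)) \<in> (\<lambda>b. \<lambda>i\<in>I. p' i b) ` B"
      unfolding bij_betw_imp_surj_on[OF bij] .
    then obtain b where b: "b \<in> B" "(\<lambda>i\<in>I. k' i (t i)) = (\<lambda>i\<in>I. p' i b)" by blast
    obtain a where a: "a \<in> A" "b = k a" using k b(1) by (auto simp: bij_betw_def)
    have "p i a = t i" if i: "i \<in> I" for i
    proof (rule inj_onD[of "k' i" "A' i"])
      show "k' i (p i a) = k' i (t i)" using fun_cong[OF b(2), of i] i a comm by simp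
    qed (use k'[OF i] p[OF i a(1)] t i in \<open>auto simp: bij_betw_def\<close>)
    then have "t = (\<lambda>i\<in>I. p i a)" using t by (intro extensionalityI[of _ I]) (auto simp: PiE_iff)
    then show "t \<in> (\<lambda>a. \<lambda>i\<in>I. p i a) ` A" using a(1) by blast
  qed (use p in auto)
qed

context wp_coeffs
begin

lemma group_grade_part: "j \<in> Ind W \<Longrightarrow> group (grade_part \<Lambda> i j)"
proof -
  assume j: "j \<in> Ind W"
  interpret G: group "\<Lambda> j" by (rule group_Ind[OF j])
  show ?thesis
    using G.is_group G.subgroup_imp_group[OF G.triv_subgroup] by (cases "j = i") (simp_all add: grade_part_def)
qed

lemma coeff_map_grade: "i \<in> Ind W \<Longrightarrow> coeff_map W \<Lambda> (grade_part \<Lambda> i) (grade_proj \<Lambda> i)"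
proof (intro coeff_map.intro wp_coeffs_axioms coeff_map_axioms.intro)
  show "wp_coeffs W (grade_part \<Lambda> i)"
    by (intro wp_coeffs.intro well_pointed_axioms wp_coeffs_axioms.intro)
      (simp add: graded_group_def group_grade_part)
  show "grade_proj \<Lambda> i \<in> graded_hom (Ind W) \<Lambda> (grade_part \<Lambda> i)"
    using group_Ind by (auto simp: graded_hom_def hom_def grade_proj_def grade_part_def group.is_monoid)
qed

lemma grade_part_same [simp]: "grade_part \<Lambda> i i = \<Lambda> i"
  by (simp add: grade_part_def)

text \<open>A cochain at \<open>(a, b)\<close> has its value in the factor given by the degree of \<open>a\<close>, and
  \<open>a \<triangleright> b\<close> has the same degree. So both the cocycle equation and the coboundary relation at \<open>a\<close>
  only involve one factor, and can be solved separately in each degree.\<close>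

lemma H2_graded:
  "bij_betw (\<lambda>C. \<lambda>i\<in>Ind W. H2_push W (grade_part \<Lambda> i) (grade_proj \<Lambda> i) C)
     (H2 W \<Lambda>) (\<Pi>\<^sub>E i\<in>Ind W. H2 W (grade_part \<Lambda> i))"
  unfolding bij_betw_def
proof
  let ?P = "\<lambda>i. push_cochain W (grade_proj \<Lambda> i)"
  have push: "H2_push W (grade_part \<Lambda> i) (grade_proj \<Lambda> i) (coh_class W \<Lambda> f) = coh_class W (grade_part \<Lambda> i) (?P i f)"
    and PZ: "?P i f \<in> Z2 W (grade_part \<Lambda> i)"
    if "i \<in> Ind W" "f \<in> Z2 W \<Lambda>" for i f
    using coeff_map.H2_push_coh_class[OF coeff_map_grade] coeff_map.Z2_push[OF coeff_map_grade] that by blast+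
  have wc: "wp_coeffs W (grade_part \<Lambda> i)" if "i \<in> Ind W" for i
    using coeff_map_grade[OF that] by (simp add: coeff_map_def)
  show "inj_on (\<lambda>C. \<lambda>i\<in>Ind W. H2_push W (grade_part \<Lambda> i) (grade_proj \<Lambda> i) C) (H2 W \<Lambda>)"
  proof (rule inj_onI)
    fix C D assume "C \<in> H2 W \<Lambda>" "D \<in> H2 W \<Lambda>"
      and eq: "(\<lambda>i\<in>Ind W. H2_push W (grade_part \<Lambda> i) (grade_proj \<Lambda> i) C)
        = (\<lambda>i\<in>Ind W. H2_push W (grade_part \<Lambda> i) (grade_proj \<Lambda> i) D)"
    then obtain f f' where f: "f \<in> Z2 W \<Lambda>" "f' \<in> Z2 W \<Lambda>" "C = coh_class W \<Lambda> f" "D = coh_class W \<Lambda> f'"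
      by (auto simp: H2_iff)
    have "\<exists>g. \<forall>a\<in>carrier W. g a \<in> carrier (grade_part \<Lambda> i (grade W a)) \<and> (\<forall>b\<in>carrier W.
       ?P i f (a, b) = inv\<^bsub>grade_part \<Lambda> i (grade W a)\<^esub> g a \<otimes>\<^bsub>grade_part \<Lambda> i (grade W a)\<^esub> ?P i f' (a, b)
           \<otimes>\<^bsub>grade_part \<Lambda> i (grade W a)\<^esub> g (a \<triangleright> b))" if i: "i \<in> Ind W" for i
    proof -
      interpret P: wp_coeffs W "grade_part \<Lambda> i" by (rule wc[OF i])
      have "coh_class W (grade_part \<Lambda> i) (?P i f) = coh_class W (grade_part \<Lambda> i) (?P i f')"
        using fun_cong[OF eq, of i] i f by (simp add: push)
      then have "(?P i f, ?P i f') \<in> cohom_rel W (grade_part \<Lambda> i)"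
        using P.coh_class_eq_iff PZ i f by blast
      then show ?thesis by (auto simp: P.cohom_rel_iff P.cobounds_def)
    qed
    then obtain g where g: "\<And>i a. i \<in> Ind W \<Longrightarrow> a \<in> carrier W \<Longrightarrow> g i a \<in> carrier (grade_part \<Lambda> i (grade W a))"
      and g_eq: "\<And>i a b. i \<in> Ind W \<Longrightarrow> a \<in> carrier W \<Longrightarrow> b \<in> carrier W \<Longrightarrow>
       ?P i f (a, b) = inv\<^bsub>grade_part \<Lambda> i (grade W a)\<^esub> g i a \<otimes>\<^bsub>grade_part \<Lambda> i (grade W a)\<^esub> ?P i f' (a, b)
           \<otimes>\<^bsub>grade_part \<Lambda> i (grade W a)\<^esub> g i (a \<triangleright> b)"
      by metis
    have "(f, f') \<in> cohom_rel W \<Lambda>"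
    proof (rule cohom_relI[OF f(1,2), of "\<lambda>a. g (grade W a) a"])
      fix a assume a: "a \<in> carrier W"
      show "g (grade W a) a \<in> carrier (\<L> a)" using g[OF grade_Ind[OF a] a] by simp
      fix b assume b: "b \<in> carrier W"
      show "f (a, b) = inv\<^bsub>\<L> a\<^esub> g (grade W a) a \<otimes>\<^bsub>\<L> a\<^esub> f' (a, b)
          \<otimes>\<^bsub>\<L> a\<^esub> g (grade W (a \<triangleright> b)) (a \<triangleright> b)"
        using g_eq[OF grade_Ind[OF a] a b] a b by (simp add: grade_proj_def)
    qed
    then show "C = D" using f coh_class_eq_iff by simp
  qed
  show "(\<lambda>C. \<lambda>i\<in>Ind W. H2_push W (grade_part \<Lambda> i) (grade_proj \<Lambda> i) C) ` H2 W \<Lambda>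
      = (\<Pi>\<^sub>E i\<in>Ind W. H2 W (grade_part \<Lambda> i))"
  proof (intro subset_antisym subsetI)
    fix t assume "t \<in> (\<lambda>C. \<lambda>i\<in>Ind W. H2_push W (grade_part \<Lambda> i) (grade_proj \<Lambda> i) C) ` H2 W \<Lambda>"
    then obtain f where f: "f \<in> Z2 W \<Lambda>"
      and t: "t = (\<lambda>i\<in>Ind W. H2_push W (grade_part \<Lambda> i) (grade_proj \<Lambda> i) (coh_class W \<Lambda> f))"
      by (auto simp: H2_iff)
    show "t \<in> (\<Pi>\<^sub>E i\<in>Ind W. H2 W (grade_part \<Lambda> i))"
      unfolding t by (rule restrict_PiE_iff[THEN iffD2]) (use push PZ f wp_coeffs.H2_iff[OF wc] in blast)
  next
    fix t assume t: "t \<in> (\<Pi>\<^sub>E i\<in>Ind W. H2 W (grade_part \<Lambda> i))"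
    then have "\<forall>i\<in>Ind W. \<exists>f\<in>Z2 W (grade_part \<Lambda> i). t i = coh_class W (grade_part \<Lambda> i) f"
      using wp_coeffs.H2_iff[OF wc] by (auto simp: PiE_iff)
    then obtain F where F: "\<And>i. i \<in> Ind W \<Longrightarrow> F i \<in> Z2 W (grade_part \<Lambda> i)"
      and tF: "\<And>i. i \<in> Ind W \<Longrightarrow> t i = coh_class W (grade_part \<Lambda> i) (F i)" by metis
    define f where "f = (\<lambda>(a, b)\<in>carrier W \<times> carrier W. F (grade W a) (a, b))"
    have fZ: "f \<in> Z2 W \<Lambda>"
    proof (rule Z2I)
      show "f \<in> cochains2 W \<Lambda>"
        unfolding f_def cochains2_restrict
      proof (intro ballI)
        fix a b assume a: "a \<in> carrier W" and b: "b \<in> carrier W"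
        show "F (grade W a) (a, b) \<in> carrier (\<L> a)"
          using wp_coeffs.Z2_closed[OF wc[OF grade_Ind[OF a]] F[OF grade_Ind[OF a]] a b] by simp
      qed
      fix a b c assume abc: "a \<in> carrier W" "b \<in> carrier W" "c \<in> carrier W"
      note i = grade_Ind[OF abc(1)]
      show "f (a, a) = \<one>\<^bsub>\<L> a\<^esub>"
        using wp_coeffs.Z2_diag[OF wc[OF i] F[OF i] abc(1)] abc by (simp add: f_def)
      show "f (a, b) \<otimes>\<^bsub>\<L> a\<^esub> f (a \<triangleright> b, c) = f (a, c) \<otimes>\<^bsub>\<L> a\<^esub> f (a \<triangleright> c, b \<triangleright> c)"
        using wp_coeffs.Z2_cocycle[OF wc[OF i] F[OF i] abc] abc by (simp add: f_def qop_closed)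
    qed
    have PF: "?P i f = F i" if i: "i \<in> Ind W" for i
    proof -
      interpret P: wp_coeffs W "grade_part \<Lambda> i" by (rule wc[OF i])
      show ?thesis
      proof (rule P.cochains2_eqI[OF P.Z2_cochain[OF PZ[OF i fZ]] P.Z2_cochain[OF F[OF i]]])
        fix a b assume ab: "a \<in> carrier W" "b \<in> carrier W"
        show "?P i f (a, b) = F i (a, b)"
          using P.Z2_closed[OF F[OF i] ab] ab
          by (cases "grade W a = i") (simp_all add: f_def grade_proj_def grade_part_def)
      qed
    qed
    have "t = (\<lambda>i\<in>Ind W. H2_push W (grade_part \<Lambda> i) (grade_proj \<Lambda> i) (coh_class W \<Lambda> f))"
    proof (rule extensionalityI[of _ "Ind W"])
      show "t \<in> extensional (Ind W)" using t by (simp add: PiE_iff)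
    qed (simp_all add: tF push fZ PF)
    moreover have "coh_class W \<Lambda> f \<in> H2 W \<Lambda>" using fZ H2_iff by blast
    ultimately show "t \<in> (\<lambda>C. \<lambda>i\<in>Ind W. H2_push W (grade_part \<Lambda> i) (grade_proj \<Lambda> i) C) ` H2 W \<Lambda>" by blast
  qed
qed

lemma Ext_graded:
  "bij_betw (\<lambda>\<xi>. \<lambda>i\<in>Ind W. ext_push W \<Lambda> (grade_part \<Lambda> i) (grade_proj \<Lambda> i) \<xi>)
     (Ext W \<Lambda>) (\<Pi>\<^sub>E i\<in>Ind W. Ext W (grade_part \<Lambda> i))"
proof (rule product_bij_transport[OF bij_cocycle_class _ _ _ H2_graded])
  fix i assume i: "i \<in> Ind W"
  show "bij_betw (cocycle_class W (grade_part \<Lambda> i)) (Ext W (grade_part \<Lambda> i)) (H2 W (grade_part \<Lambda> i))"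
    using coeff_map_grade[OF i] by (intro wp_coeffs.bij_cocycle_class) (simp add: coeff_map_def)
qed (use coeff_map.naturality_push[OF coeff_map_grade] in blast)+

lemma HomC_graded:
  "bij_betw (\<lambda>C. \<lambda>i\<in>Ind W. HomC_push W (grade_part \<Lambda> i) (grade_proj \<Lambda> i) C)
     (HomC W \<Lambda>) (\<Pi>\<^sub>E i\<in>Ind W. HomC W (grade_part \<Lambda> i))"
proof -
  let ?m = "monodromy_class W \<Lambda>" and ?m' = "\<lambda>i. monodromy_class W (grade_part \<Lambda> i)"
  have bij': "bij_betw (?m' i) (Ext W (grade_part \<Lambda> i)) (HomC W (grade_part \<Lambda> i))" if "i \<in> Ind W" for i
    using coeff_map_grade[OF that] by (intro wp_coeffs.bij_monodromy_class) (simp add: coeff_map_def)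
  have nat: "HomC_push W (grade_part \<Lambda> i) (grade_proj \<Lambda> i) (?m \<xi>) = ?m' i (ext_push W \<Lambda> (grade_part \<Lambda> i) (grade_proj \<Lambda> i) \<xi>)"
    "ext_push W \<Lambda> (grade_part \<Lambda> i) (grade_proj \<Lambda> i) \<xi> \<in> Ext W (grade_part \<Lambda> i)"
    if "i \<in> Ind W" "\<xi> \<in> Ext W \<Lambda>" for i \<xi>
    using coeff_map.naturality_push[OF coeff_map_grade] that by metis+
  note inv = bij_betw_inv_into[OF bij_monodromy_class]
  have inv_Ext: "inv_into (Ext W \<Lambda>) ?m C \<in> Ext W \<Lambda>" "?m (inv_into (Ext W \<Lambda>) ?m C) = C" if "C \<in> HomC W \<Lambda>" for C
    using that inv bij_betw_inv_into_right[OF bij_monodromy_class] by (auto simp: bij_betw_def)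
  show ?thesis
  proof (rule product_bij_transport[OF inv bij_betw_inv_into[OF bij'] _ _ Ext_graded])
    fix i C assume i: "i \<in> Ind W" and C: "C \<in> HomC W \<Lambda>"
    have eq: "HomC_push W (grade_part \<Lambda> i) (grade_proj \<Lambda> i) C
      = ?m' i (ext_push W \<Lambda> (grade_part \<Lambda> i) (grade_proj \<Lambda> i) (inv_into (Ext W \<Lambda>) ?m C))"
      using nat(1)[OF i inv_Ext(1)[OF C]] inv_Ext(2)[OF C] by simp
    show "HomC_push W (grade_part \<Lambda> i) (grade_proj \<Lambda> i) C \<in> HomC W (grade_part \<Lambda> i)"
      unfolding eq using bij'[OF i] nat(2)[OF i inv_Ext(1)[OF C]] by (auto simp: bij_betw_def)
    show "inv_into (Ext W (grade_part \<Lambda> i)) (?m' i) (HomC_push W (grade_part \<Lambda> i) (grade_proj \<Lambda> i) C)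
        = ext_push W \<Lambda> (grade_part \<Lambda> i) (grade_proj \<Lambda> i) (inv_into (Ext W \<Lambda>) ?m C)"
      unfolding eq by (rule bij_betw_inv_into_left[OF bij'[OF i] nat(2)[OF i inv_Ext(1)[OF C]]])
  qed
qed

end

section \<open>Commutative coefficients: products of cocycles and Baer sums\<close>

definition mult_cochain ::
  "('a, 'i, 'z) wpquandle_scheme \<Rightarrow> ('i \<Rightarrow> ('l, 'g) monoid_scheme)
     \<Rightarrow> ('a \<times> 'a \<Rightarrow> 'l) \<Rightarrow> ('a \<times> 'a \<Rightarrow> 'l) \<Rightarrow> ('a \<times> 'a \<Rightarrow> 'l)" where
  "mult_cochain W \<Lambda> f f' = (\<lambda>(a, b)\<in>carrier W \<times> carrier W. f (a, b) \<otimes>\<^bsub>\<Lambda> (grade W a)\<^esub> f' (a, b))"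

definition one_cochain ::
  "('a, 'i, 'z) wpquandle_scheme \<Rightarrow> ('i \<Rightarrow> ('l, 'g) monoid_scheme) \<Rightarrow> ('a \<times> 'a \<Rightarrow> 'l)" where
  "one_cochain W \<Lambda> = (\<lambda>(a, b)\<in>carrier W \<times> carrier W. \<one>\<^bsub>\<Lambda> (grade W a)\<^esub>)"

lemma mult_cochain_app [simp]:
  "a \<in> carrier W \<Longrightarrow> b \<in> carrier W \<Longrightarrow>
     mult_cochain W \<Lambda> f f' (a, b) = f (a, b) \<otimes>\<^bsub>\<Lambda> (grade W a)\<^esub> f' (a, b)"
  by (simp add: mult_cochain_def)

lemma one_cochain_app [simp]:
  "a \<in> carrier W \<Longrightarrow> b \<in> carrier W \<Longrightarrow> one_cochain W \<Lambda> (a, b) = \<one>\<^bsub>\<Lambda> (grade W a)\<^esub>"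
  by (simp add: one_cochain_def)

context wp_coeffs
begin

lemma Z2_one: "one_cochain W \<Lambda> \<in> Z2 W \<Lambda>"
proof (rule Z2I)
  have one: "\<one>\<^bsub>\<L> a\<^esub> \<in> carrier (\<L> a)" if "a \<in> carrier W" for a
    using group_grade[OF that] by (simp add: group.is_monoid monoid.one_closed)
  then show "one_cochain W \<Lambda> \<in> cochains2 W \<Lambda>"
    unfolding one_cochain_def cochains2_restrict by blast
  fix a b c assume a: "a \<in> carrier W" "b \<in> carrier W" "c \<in> carrier W"
  then show "one_cochain W \<Lambda> (a, a) = \<one>\<^bsub>\<L> a\<^esub>"
    "one_cochain W \<Lambda> (a, b) \<otimes>\<^bsub>\<L> a\<^esub> one_cochain W \<Lambda> (a \<triangleright> b, c)
      = one_cochain W \<Lambda> (a, c) \<otimes>\<^bsub>\<L> a\<^esub> one_cochain W \<Lambda> (a \<triangleright> c, b \<triangleright> c)"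
    by (simp_all add: qop_closed)
qed

lemma holonomy_one:
  "x \<in> carrier W \<Longrightarrow> w \<in> words W \<Longrightarrow> holonomy W \<Lambda> (one_cochain W \<Lambda>) x w = \<one>\<^bsub>\<L> x\<^esub>"
proof (induction w arbitrary: x)
  case (Cons l w)
  obtain a s where l: "l = (a, s)" by (cases l)
  interpret G: group "\<L> x" by (rule group_grade[OF Cons.prems(1)])
  show ?case using Cons by (simp add: l qop_closed qbar_closed)
qed simp

lemma trivial_ext_class: "ext_rel W \<Lambda> `` {trivial_ext W \<Lambda>} = ext_class W \<Lambda> (one_cochain W \<Lambda>)"
proof (rule ext_rel_class)
  have one: "one_cochain W \<Lambda> (a, b) = \<one>\<^bsub>\<L> a\<^esub>" if "a \<in> carrier W" "b \<in> carrier W" for a b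
    using that by simp
  have mult: "l \<otimes>\<^bsub>\<L> a\<^esub> \<one>\<^bsub>\<L> a\<^esub> = l"
    "l \<otimes>\<^bsub>\<L> a\<^esub> inv\<^bsub>\<L> a\<^esub> \<one>\<^bsub>\<L> a\<^esub> = l"
    if "a \<in> carrier W" "l \<in> carrier (\<L> a)" for a l
    using group_grade[OF that(1)] that(2) by (simp_all add: group.is_monoid monoid.r_one monoid.inv_one)
  show "trivial_ext W \<Lambda> \<in> exts W \<Lambda>" "one_cochain W \<Lambda> \<in> ext_cocycles W \<Lambda> (trivial_ext W \<Lambda>)"
    by (rule ext_from_cocycle[OF Z2_one]; simp add: trivial_ext_def mult qbar_closed)+
qed

end

context wp_comm_coeffs
begin

lemma comm_grade: "x \<in> carrier W \<Longrightarrow> comm_group (\<L> x)"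
  by (rule comm[OF grade_Ind])

lemma Z2_mult:
  assumes f: "f \<in> Z2 W \<Lambda>" and f': "f' \<in> Z2 W \<Lambda>" shows "mult_cochain W \<Lambda> f f' \<in> Z2 W \<Lambda>"
proof (rule Z2I)
  show "mult_cochain W \<Lambda> f f' \<in> cochains2 W \<Lambda>"
    unfolding mult_cochain_def cochains2_restrict
    using Z2_closed[OF f] Z2_closed[OF f'] group_grade by (simp add: group.is_monoid monoid.m_closed)
  fix a b c assume a: "a \<in> carrier W" and b: "b \<in> carrier W" and c: "c \<in> carrier W"
  interpret G: comm_group "\<L> a" by (rule comm_grade[OF a])
  show "mult_cochain W \<Lambda> f f' (a, a) = \<one>\<^bsub>\<L> a\<^esub>"
    using a Z2_diag[OF f a] Z2_diag[OF f' a] by simp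
  have cl: "k (a, b) \<in> carrier (\<L> a)" "k (a, c) \<in> carrier (\<L> a)"
    "k (a \<triangleright> b, c) \<in> carrier (\<L> a)" "k (a \<triangleright> c, b \<triangleright> c) \<in> carrier (\<L> a)" if "k \<in> Z2 W \<Lambda>" for k
    using Z2_closed[OF that a b] Z2_closed[OF that a c] Z2_closed[OF that, of "a \<triangleright> b" c]
      Z2_closed[OF that, of "a \<triangleright> c" "b \<triangleright> c"] a b c by (simp_all add: qop_closed)
  have four: "(x \<otimes>\<^bsub>\<L> a\<^esub> y) \<otimes>\<^bsub>\<L> a\<^esub> (z \<otimes>\<^bsub>\<L> a\<^esub> t)
      = (x \<otimes>\<^bsub>\<L> a\<^esub> z) \<otimes>\<^bsub>\<L> a\<^esub> (y \<otimes>\<^bsub>\<L> a\<^esub> t)"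
    if "x \<in> carrier (\<L> a)" "y \<in> carrier (\<L> a)"
      "z \<in> carrier (\<L> a)" "t \<in> carrier (\<L> a)" for x y z t
    using that by (simp add: G.m_ac)
  show "mult_cochain W \<Lambda> f f' (a, b) \<otimes>\<^bsub>\<L> a\<^esub> mult_cochain W \<Lambda> f f' (a \<triangleright> b, c)
      = mult_cochain W \<Lambda> f f' (a, c) \<otimes>\<^bsub>\<L> a\<^esub> mult_cochain W \<Lambda> f f' (a \<triangleright> c, b \<triangleright> c)"
    using four[OF cl(1)[OF f] cl(1)[OF f'] cl(3)[OF f] cl(3)[OF f']]
      four[OF cl(2)[OF f] cl(2)[OF f'] cl(4)[OF f] cl(4)[OF f']]
      Z2_cocycle[OF f a b c] Z2_cocycle[OF f' a b c] a b c by (simp add: qop_closed)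
qed

lemma holonomy_mult:
  assumes f: "f \<in> Z2 W \<Lambda>" and f': "f' \<in> Z2 W \<Lambda>"
  shows "x \<in> carrier W \<Longrightarrow> w \<in> words W \<Longrightarrow> holonomy W \<Lambda> (mult_cochain W \<Lambda> f f') x w
    = holonomy W \<Lambda> f x w \<otimes>\<^bsub>\<L> x\<^esub> holonomy W \<Lambda> f' x w"
proof (induction w arbitrary: x)
  case Nil
  interpret G: comm_group "\<L> x" by (rule comm_grade[OF Nil.prems(1)])
  show ?case by simp
next
  case (Cons l w)
  obtain a s where l: "l = (a, s)" by (cases l)
  note x = Cons.prems(1)
  interpret G: comm_group "\<L> x" by (rule comm_grade[OF x])
  have a: "a \<in> carrier W" "x \<triangleright> a \<in> carrier W" "x \<triangleleft> a \<in> carrier W" and w: "w \<in> words W"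
    using Cons.prems by (auto simp: l qop_closed qbar_closed)
  have cl: "k (x, a) \<in> carrier (\<L> x)" "k (x \<triangleleft> a, a) \<in> carrier (\<L> x)"
    "holonomy W \<Lambda> k (x \<triangleright> a) w \<in> carrier (\<L> x)" "holonomy W \<Lambda> k (x \<triangleleft> a) w \<in> carrier (\<L> x)"
    if k: "k \<in> Z2 W \<Lambda>" for k
    using Z2_closed[OF k x a(1)] Z2_closed[OF k a(3,1)] holonomy_closed[OF Z2_cochain[OF k] a(2) w]
      holonomy_closed[OF Z2_cochain[OF k] a(3) w] x a by simp_all
  show ?case
    using Cons.IH[OF a(2) w] Cons.IH[OF a(3) w] x a cl[OF f] cl[OF f']
    by (simp add: l G.m_ac G.inv_mult_group)
qed

text \<open>For commutative coefficients the class of a cocycle is detected by its holonomy, which is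
  multiplicative in the cocycle. This gives \<open>cohom_mult\<close> without a computation with cochains.\<close>

lemma cohom_iff_holonomy:
  assumes "f \<in> Z2 W \<Lambda>" "f' \<in> Z2 W \<Lambda>"
  shows "(f, f') \<in> cohom_rel W \<Lambda> \<longleftrightarrow> loop_holonomy W \<Lambda> f = loop_holonomy W \<Lambda> f'"
  using cohom_iff_conj[OF assms] loop_holonomy_Hom[OF assms(1)] loop_holonomy_Hom[OF assms(2)]
    conj_class_singleton conj_class_eq_iff by (metis singleton_inject)

lemma loop_holonomy_mult:
  assumes f: "f \<in> Z2 W \<Lambda>" and f': "f' \<in> Z2 W \<Lambda>"
  shows "loop_holonomy W \<Lambda> (mult_cochain W \<Lambda> f f') = (\<lambda>i\<in>Ind W. \<lambda>g\<in>carrier (pi1 W (base W i)).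
    loop_holonomy W \<Lambda> f i g \<otimes>\<^bsub>\<Lambda> i\<^esub> loop_holonomy W \<Lambda> f' i g)"
proof (rule ext, rule ext)
  fix i g
  consider "i \<notin> Ind W" | "i \<in> Ind W" "g \<notin> carrier (pi1 W (base W i))"
    | w where "i \<in> Ind W" "w \<in> loops W (base W i)" "g = adj_class W w"
    by (auto simp: carrier_pi1 base_closed)
  then show "loop_holonomy W \<Lambda> (mult_cochain W \<Lambda> f f') i g = (\<lambda>i\<in>Ind W. \<lambda>g\<in>carrier (pi1 W (base W i)).
    loop_holonomy W \<Lambda> f i g \<otimes>\<^bsub>\<Lambda> i\<^esub> loop_holonomy W \<Lambda> f' i g) i g"
  proof cases
    case (3 w)
    have "w \<in> words W" using 3(2) by (simp add: loops_def)
    moreover have "g \<in> carrier (pi1 W (base W i))" using 3 by (simp add: carrier_pi1 base_closed)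
    ultimately show ?thesis
      using 3(1) holonomy_mult[OF f f' base_closed[OF 3(1)]] loop_holonomy_class[OF _ 3(1,2)]
        f f' Z2_mult[OF f f'] by (simp add: 3(3))
  qed (simp_all add: loop_holonomy_def)
qed

lemma cohom_mult:
  assumes "(f, k) \<in> cohom_rel W \<Lambda>" "(f', k') \<in> cohom_rel W \<Lambda>"
  shows "(mult_cochain W \<Lambda> f f', mult_cochain W \<Lambda> k k') \<in> cohom_rel W \<Lambda>"
proof -
  have "f \<in> Z2 W \<Lambda>" "k \<in> Z2 W \<Lambda>" "f' \<in> Z2 W \<Lambda>" "k' \<in> Z2 W \<Lambda>" using assms by (auto simp: cohom_rel_def)
  then show ?thesis using assms by (simp add: cohom_iff_holonomy Z2_mult loop_holonomy_mult)
qed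

text \<open>The image of a pair of sections is a section with the product of the two cocycles; given a
  section with this cocycle, multiplying coefficients defines the homomorphism.\<close>

lemma baer_homs_iff:
  fixes E1 :: "('e, 'a, 'l) qext" and E2 :: "('f, 'a, 'l) qext" and E :: "('d, 'a, 'l) qext"
  assumes "ext_section W \<Lambda> E1 s1 f1" and "ext_section W \<Lambda> E2 s2 f2" and "graded_ext W \<Lambda> E"
  shows "baer_homs W \<Lambda> E1 E2 E \<noteq> {} \<longleftrightarrow> mult_cochain W \<Lambda> f1 f2 \<in> ext_cocycles W \<Lambda> E"
proof -
  interpret E1: ext_section W \<Lambda> E1 s1 f1 by (rule assms(1))
  interpret E2: ext_section W \<Lambda> E2 s2 f2 by (rule assms(2))
  interpret E: wp_ext W \<Lambda> E by (rule wp_extI[OF assms(3)])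
  let ?f = "mult_cochain W \<Lambda> f1 f2"
  note fZ = Z2_mult[OF E1.f_Z2 E2.f_Z2]
  show ?thesis
  proof
    assume "baer_homs W \<Lambda> E1 E2 E \<noteq> {}"
    then obtain F where F_hom: "F \<in> baer_homs W \<Lambda> E1 E2 E" by blast
    have F: "F (x, y) \<in> carrier (total E)" "proj E (F (x, y)) = a"
      if "a \<in> carrier W" "x \<in> fibres E1 {a}" "y \<in> fibres E2 {a}" for a x y
      using F_hom that unfolding baer_homs_def E.mem_fibre by blast+
    have F_op: "F (x \<triangleright>\<^bsub>total E1\<^esub> x', y \<triangleright>\<^bsub>total E2\<^esub> y') = F (x, y) \<triangleright>\<^bsub>total E\<^esub> F (x', y')"
      if "a \<in> carrier W" "x \<in> fibres E1 {a}" "y \<in> fibres E2 {a}"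
        "b \<in> carrier W" "x' \<in> fibres E1 {b}" "y' \<in> fibres E2 {b}" for a x y b x' y'
      using F_hom that unfolding baer_homs_def by blast
    have F_act: "F (eact E1 l x, eact E2 m y) = eact E (l \<otimes>\<^bsub>\<L> a\<^esub> m) (F (x, y))"
      if "a \<in> carrier W" "x \<in> fibres E1 {a}" "y \<in> fibres E2 {a}"
        "l \<in> carrier (\<L> a)" "m \<in> carrier (\<L> a)" for a x y l m
      using F_hom that unfolding baer_homs_def by blast
    have fib: "s1 a \<in> fibres E1 {a}" "s2 a \<in> fibres E2 {a}" if "a \<in> carrier W" for a
      using that by (simp_all add: E1.mem_fibre E2.mem_fibre)
    have "E.section_cocycle (\<lambda>a. F (s1 a, s2 a)) ?f"
      unfolding E.section_cocycle_def E.is_section_def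
    proof (intro conjI ballI Z2_cochain[OF fZ])
      fix a assume a: "a \<in> carrier W"
      show "F (s1 a, s2 a) \<in> carrier (total E)" "proj E (F (s1 a, s2 a)) = a"
        by (rule F[OF a fib[OF a]])+
      fix b assume b: "b \<in> carrier W"
      have ab: "a \<triangleright> b \<in> carrier W" "grade W (a \<triangleright> b) = grade W a" using a b by (simp_all add: qop_closed)
      have "F (s1 a, s2 a) \<triangleright>\<^bsub>total E\<^esub> F (s1 b, s2 b)
          = F (eact E1 (f1 (a, b)) (s1 (a \<triangleright> b)), eact E2 (f2 (a, b)) (s2 (a \<triangleright> b)))"
        using F_op[OF a fib[OF a] b fib[OF b]] a b by (simp add: E1.s_qop E2.s_qop)
      also have "\<dots> = eact E (?f (a, b)) (F (s1 (a \<triangleright> b), s2 (a \<triangleright> b)))"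
        using F_act[OF ab(1) fib[OF ab(1)]] E1.f_closed[OF a b] E2.f_closed[OF a b] a b ab by simp
      finally show "F (s1 a, s2 a) \<triangleright>\<^bsub>total E\<^esub> F (s1 b, s2 b) = eact E (?f (a, b)) (F (s1 (a \<triangleright> b), s2 (a \<triangleright> b)))" .
    qed
    then show "?f \<in> ext_cocycles W \<Lambda> E" using E.ext_cocycles_iff by blast
  next
    assume "?f \<in> ext_cocycles W \<Lambda> E"
    then obtain s where "ext_section W \<Lambda> E s ?f" by (rule ext_sectionE[OF assms(3)])
    then interpret S: ext_section W \<Lambda> E s ?f .
    define F where "F = (\<lambda>(x, y). eact E (E1.coord x \<otimes>\<^bsub>\<Lambda> (E1.gr x)\<^esub> E2.coord y) (s (proj E1 x)))"
    have "F \<in> baer_homs W \<Lambda> E1 E2 E"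
      unfolding baer_homs_def mem_Collect_eq
    proof (intro conjI ballI)
      fix a x y assume a: "a \<in> carrier W" and "x \<in> fibres E1 {a}" and "y \<in> fibres E2 {a}"
      then have x: "x \<in> carrier (total E1)" "proj E1 x = a" and y: "y \<in> carrier (total E2)" "proj E2 y = a"
        by (simp_all add: E1.mem_fibre E2.mem_fibre)
      interpret G: comm_group "\<L> a" by (rule comm_grade[OF a])
      have c: "E1.coord x \<in> carrier (\<L> a)" "E2.coord y \<in> carrier (\<L> a)"
        using E1.coord_closed[OF x(1)] E2.coord_closed[OF y(1)] x(2) y(2) by simp_all
      show Fxy: "F (x, y) \<in> fibres E {a}"
        using a c x by (simp add: F_def E.mem_fibre E.act_closed E.proj_act)
      fix b x' y' assume b: "b \<in> carrier W" and "x' \<in> fibres E1 {b}" and "y' \<in> fibres E2 {b}"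
      then have x': "x' \<in> carrier (total E1)" "proj E1 x' = b" and y': "y' \<in> carrier (total E2)" "proj E2 y' = b"
        by (simp_all add: E1.mem_fibre E2.mem_fibre)
      have c': "E1.coord x' \<in> carrier (\<L> b)" "E2.coord y' \<in> carrier (\<L> b)"
        using E1.coord_closed[OF x'(1)] E2.coord_closed[OF y'(1)] x'(2) y'(2) by simp_all
      have cc': "E1.coord x' \<otimes>\<^bsub>\<L> b\<^esub> E2.coord y' \<in> carrier (\<L> b)"
        using c' comm_grade[OF b] by (simp add: comm_group_def group.is_monoid monoid.m_closed)
      have ab: "a \<triangleright> b \<in> carrier W" "grade W (a \<triangleright> b) = grade W a" using a b by (simp_all add: qop_closed)
      note ff = E1.f_closed[OF a b] E2.f_closed[OF a b]
      have "F (x, y) \<triangleright>\<^bsub>total E\<^esub> F (x', y') = F (x, y) \<triangleright>\<^bsub>total E\<^esub> s b"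
        using Fxy b cc' x' by (intro E.qop_cong_proj) (simp_all add: F_def E.mem_fibre E.act_closed E.proj_act)
      also have "\<dots> = eact E (E1.coord x \<otimes>\<^bsub>\<L> a\<^esub> E2.coord y) (eact E (?f (a, b)) (s (a \<triangleright> b)))"
        using a b c x by (simp add: F_def E.act_qop S.s_qop del: mult_cochain_app)
      also have "\<dots> = eact E ((E1.coord x \<otimes>\<^bsub>\<L> a\<^esub> E2.coord y) \<otimes>\<^bsub>\<L> a\<^esub> ?f (a, b)) (s (a \<triangleright> b))"
        using E.act_mult[of "s (a \<triangleright> b)" "E1.coord x \<otimes>\<^bsub>\<L> a\<^esub> E2.coord y" "?f (a, b)"] ab c S.f_closed[OF a b]
        by (simp del: mult_cochain_app)
      also have "(E1.coord x \<otimes>\<^bsub>\<L> a\<^esub> E2.coord y) \<otimes>\<^bsub>\<L> a\<^esub> ?f (a, b)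
          = E1.coord (x \<triangleright>\<^bsub>total E1\<^esub> x') \<otimes>\<^bsub>\<L> a\<^esub> E2.coord (y \<triangleright>\<^bsub>total E2\<^esub> y')"
        using E1.coord_qop[OF x(1) x'(1)] E2.coord_qop[OF y(1) y'(1)] x(2) x'(2) y(2) y'(2) a b c ff
        by (simp add: G.m_ac)
      finally show "F (x \<triangleright>\<^bsub>total E1\<^esub> x', y \<triangleright>\<^bsub>total E2\<^esub> y') = F (x, y) \<triangleright>\<^bsub>total E\<^esub> F (x', y')"
        using x x' a b by (simp add: F_def)
    next
      fix a x y l m assume a: "a \<in> carrier W" and "x \<in> fibres E1 {a}" and "y \<in> fibres E2 {a}"
        and l: "l \<in> carrier (\<L> a)" and m: "m \<in> carrier (\<L> a)"
      then have x: "x \<in> carrier (total E1)" "proj E1 x = a" and y: "y \<in> carrier (total E2)" "proj E2 y = a"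
        by (simp_all add: E1.mem_fibre E2.mem_fibre)
      interpret G: comm_group "\<L> a" by (rule comm_grade[OF a])
      have c: "E1.coord x \<in> carrier (\<L> a)" "E2.coord y \<in> carrier (\<L> a)"
        using E1.coord_closed[OF x(1)] E2.coord_closed[OF y(1)] x(2) y(2) by simp_all
      have "E1.coord (eact E1 l x) \<otimes>\<^bsub>\<L> a\<^esub> E2.coord (eact E2 m y)
          = (l \<otimes>\<^bsub>\<L> a\<^esub> m) \<otimes>\<^bsub>\<L> a\<^esub> (E1.coord x \<otimes>\<^bsub>\<L> a\<^esub> E2.coord y)"
        using E1.coord_act[OF x(1), of l] E2.coord_act[OF y(1), of m] x(2) y(2) l m c by (simp add: G.m_ac)
      then show "F (eact E1 l x, eact E2 m y) = eact E (l \<otimes>\<^bsub>\<L> a\<^esub> m) (F (x, y))"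
        using x l m c a E.act_mult[of "s a" "l \<otimes>\<^bsub>\<L> a\<^esub> m" "E1.coord x \<otimes>\<^bsub>\<L> a\<^esub> E2.coord y"]
        by (simp add: F_def E1.proj_act)
    qed
    then show "baer_homs W \<Lambda> E1 E2 E \<noteq> {}" by blast
  qed
qed

lemma baer_sum_ext_class:
  assumes f: "f \<in> Z2 W \<Lambda>" and f': "f' \<in> Z2 W \<Lambda>"
  shows "{E \<in> exts W \<Lambda>. \<exists>E1\<in>ext_class W \<Lambda> f. \<exists>E2\<in>ext_class W \<Lambda> f'. baer_homs W \<Lambda> E1 E2 E \<noteq> {}}
    = ext_class W \<Lambda> (mult_cochain W \<Lambda> f f')"
proof -
  have iff: "baer_homs W \<Lambda> E1 E2 E \<noteq> {} \<longleftrightarrow> mult_cochain W \<Lambda> f f' \<in> ext_cocycles W \<Lambda> E"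
    if "E \<in> exts W \<Lambda>" "E1 \<in> ext_class W \<Lambda> f" "E2 \<in> ext_class W \<Lambda> f'" for E E1 E2
  proof -
    have g: "graded_ext W \<Lambda> E1" "f \<in> ext_cocycles W \<Lambda> E1" "graded_ext W \<Lambda> E2" "f' \<in> ext_cocycles W \<Lambda> E2"
      "graded_ext W \<Lambda> E" using that by (simp_all add: ext_class_def exts_def)
    obtain s1 s2 where "ext_section W \<Lambda> E1 s1 f" "ext_section W \<Lambda> E2 s2 f'"
      using ext_sectionE[OF g(1,2)] ext_sectionE[OF g(3,4)] by metis
    from baer_homs_iff[OF this g(5)] show ?thesis .
  qed
  have "cocycle_ext W \<Lambda> f \<in> ext_class W \<Lambda> f" "cocycle_ext W \<Lambda> f' \<in> ext_class W \<Lambda> f'"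
    using cocycle_ext[OF f] cocycle_ext[OF f'] by (simp_all add: ext_class_def)
  then have "E \<in> {E \<in> exts W \<Lambda>. \<exists>E1\<in>ext_class W \<Lambda> f. \<exists>E2\<in>ext_class W \<Lambda> f'. baer_homs W \<Lambda> E1 E2 E \<noteq> {}}
      \<longleftrightarrow> E \<in> ext_class W \<Lambda> (mult_cochain W \<Lambda> f f')" for E
    unfolding ext_class_def[of W \<Lambda> "mult_cochain W \<Lambda> f f'"] mem_Collect_eq using iff by blast
  then show ?thesis by blast
qed

lemma product_coh_class:
  assumes f: "f \<in> Z2 W \<Lambda>" and f': "f' \<in> Z2 W \<Lambda>"
  shows "cohom_rel W \<Lambda> `` {mult_cochain W \<Lambda> k k' | k k'. k \<in> coh_class W \<Lambda> f \<and> k' \<in> coh_class W \<Lambda> f'}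
    = coh_class W \<Lambda> (mult_cochain W \<Lambda> f f')"
  unfolding coh_class_def[of W \<Lambda> "mult_cochain W \<Lambda> f f'"]
proof (rule equiv_Image_image[OF equiv_cohom_rel])
  have "f \<in> coh_class W \<Lambda> f" "f' \<in> coh_class W \<Lambda> f'"
    using equiv_class_self[OF equiv_cohom_rel] f f' by (simp_all add: coh_class_def)
  then show "mult_cochain W \<Lambda> f f' \<in> {mult_cochain W \<Lambda> k k' | k k'. k \<in> coh_class W \<Lambda> f \<and> k' \<in> coh_class W \<Lambda> f'}"
    by blast
qed (auto simp: mem_coh_class cohom_mult)

end

section \<open>Module coefficients\<close>

locale wp_modules = well_pointed W + R: ring R
  for W :: "('a, 'i, 'z) wpquandle_scheme" (structure) and R :: "('r, 's) ring_scheme" +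
  fixes M :: "'i \<Rightarrow> ('r, 'l) module"
  assumes modules: "i \<in> Ind W \<Longrightarrow> left_module R (M i)"

lemma coeff_groups_simps [simp]:
  "carrier (coeff_groups M i) = carrier (M i)"
  "x \<otimes>\<^bsub>coeff_groups M i\<^esub> y = x \<oplus>\<^bsub>M i\<^esub> y"
  "\<one>\<^bsub>coeff_groups M i\<^esub> = \<zero>\<^bsub>M i\<^esub>"
  by (simp_all add: coeff_groups_def)

lemma comm_group_coeff_groups:
  assumes "left_module R (M i)" shows "comm_group (coeff_groups M i)"
proof -
  interpret M: abelian_group "M i" using assms by (simp add: left_module_def)
  show ?thesis
    by (rule comm_groupI) (auto simp: M.a_assoc intro: M.a_comm bexI[of _ "\<ominus>\<^bsub>M i\<^esub> x" for x] M.l_neg)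
qed

sublocale wp_modules \<subseteq> wp_comm_coeffs W "coeff_groups M"
proof (intro wp_comm_coeffs.intro wp_coeffs.intro wp_coeffs_axioms.intro wp_comm_coeffs_axioms.intro)
  show "well_pointed W" by (rule well_pointed_axioms)
  have comm: "comm_group (coeff_groups M i)" if "i \<in> Ind W" for i
    by (rule comm_group_coeff_groups) (rule modules[OF that])
  then show "graded_group (Ind W) (coeff_groups M)"
    by (simp add: graded_group_def comm_group_def)
  show "comm_group (coeff_groups M i)" if "i \<in> Ind W" for i by (rule comm[OF that])
qed

text \<open>The module axioms are equations, and pass to images.\<close>

lemma left_module_image:
  assumes A: "left_module R A" and t: "t \<in> linear_maps R A B" and surj: "t ` carrier A = carrier B"
    and zero: "t \<zero>\<^bsub>A\<^esub> = \<zero>\<^bsub>B\<^esub>"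
  shows "left_module R B"
proof -
  interpret A: left_module R A by (rule A)
  have t_closed: "t x \<in> carrier B" if "x \<in> carrier A" for x using surj that by blast
  have add: "t x \<oplus>\<^bsub>B\<^esub> t y = t (x \<oplus>\<^bsub>A\<^esub> y)" if "x \<in> carrier A" "y \<in> carrier A" for x y
    using t that by (simp add: linear_maps_def)
  have smult: "r \<odot>\<^bsub>B\<^esub> t x = t (r \<odot>\<^bsub>A\<^esub> x)" if "r \<in> carrier R" "x \<in> carrier A" for r x
    using t that by (simp add: linear_maps_def)
  have ex: "\<exists>x\<in>carrier A. u = t x" if "u \<in> carrier B" for u using surj that by blast
  have "abelian_group B"
  proof (rule abelian_groupI)
    fix u assume "u \<in> carrier B"
    then obtain x where x: "x \<in> carrier A" "u = t x" using ex by blast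
    show "\<zero>\<^bsub>B\<^esub> \<oplus>\<^bsub>B\<^esub> u = u" using x by (simp add: add flip: zero)
    show "\<exists>y\<in>carrier B. y \<oplus>\<^bsub>B\<^esub> u = \<zero>\<^bsub>B\<^esub>"
      using x by (intro bexI[of _ "t (\<ominus>\<^bsub>A\<^esub> x)"]) (simp_all add: add t_closed A.M.l_neg flip: zero)
    fix v assume "v \<in> carrier B"
    then obtain y where y: "y \<in> carrier A" "v = t y" using ex by blast
    show "u \<oplus>\<^bsub>B\<^esub> v \<in> carrier B" using x y by (simp add: add t_closed)
    show "u \<oplus>\<^bsub>B\<^esub> v = v \<oplus>\<^bsub>B\<^esub> u" using x y A.M.a_comm[of x y] by (simp add: add)
    show "u \<oplus>\<^bsub>B\<^esub> v \<oplus>\<^bsub>B\<^esub> w = u \<oplus>\<^bsub>B\<^esub> (v \<oplus>\<^bsub>B\<^esub> w)" if "w \<in> carrier B" for w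
      using ex[OF that] x y by (auto simp: add A.M.a_assoc)
  qed (simp add: t_closed flip: zero)
  moreover have "left_module_axioms R B"
  proof (rule left_module_axioms.intro)
    note simps = add smult t_closed A.smult_closed A.smult_l_distr A.smult_r_distr A.smult_assoc A.smult_one
    fix u assume "u \<in> carrier B"
    then obtain x where x: "x \<in> carrier A" "u = t x" using ex by blast
    show "\<one>\<^bsub>R\<^esub> \<odot>\<^bsub>B\<^esub> u = u" using x by (simp add: simps)
    fix r assume r: "r \<in> carrier R"
    show "r \<odot>\<^bsub>B\<^esub> u \<in> carrier B" using r x by (simp add: simps)
    show "r \<odot>\<^bsub>B\<^esub> (u \<oplus>\<^bsub>B\<^esub> v) = r \<odot>\<^bsub>B\<^esub> u \<oplus>\<^bsub>B\<^esub> r \<odot>\<^bsub>B\<^esub> v" if "v \<in> carrier B" for v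
      using ex[OF that] r x by (auto simp: simps)
    fix s assume "s \<in> carrier R"
    then show "(r \<oplus>\<^bsub>R\<^esub> s) \<odot>\<^bsub>B\<^esub> u = r \<odot>\<^bsub>B\<^esub> u \<oplus>\<^bsub>B\<^esub> s \<odot>\<^bsub>B\<^esub> u"
      "(r \<otimes>\<^bsub>R\<^esub> s) \<odot>\<^bsub>B\<^esub> u = r \<odot>\<^bsub>B\<^esub> (s \<odot>\<^bsub>B\<^esub> u)"
      using r x by (simp_all add: simps)
  qed
  ultimately show ?thesis by (intro left_module.intro A.R.ring_axioms)
qed

text \<open>The maps between the three modules are determined by what they do to representing cocycles,
  so that linearity can be checked there.\<close>

lemma linear_maps_on_images:
  assumes Z: "left_module R Z" and p: "p \<in> linear_maps R Z A" "p ` carrier Z = carrier A"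
    and q: "q \<in> linear_maps R Z' B" and t: "t \<in> linear_maps R Z Z'"
    and T: "\<And>z. z \<in> carrier Z \<Longrightarrow> T (p z) = q (t z)"
  shows "T \<in> linear_maps R A B"
proof -
  interpret Z: left_module R Z by (rule Z)
  have tz: "t z \<in> carrier Z'" if "z \<in> carrier Z" for z using t that by (auto simp: linear_maps_def)
  have "T (p x \<oplus>\<^bsub>A\<^esub> p y) = T (p x) \<oplus>\<^bsub>B\<^esub> T (p y)" if xy: "x \<in> carrier Z" "y \<in> carrier Z" for x y
  proof -
    have "T (p x \<oplus>\<^bsub>A\<^esub> p y) = T (p (x \<oplus>\<^bsub>Z\<^esub> y))" using p(1) xy by (simp add: linear_maps_def)
    also have "\<dots> = q (t x \<oplus>\<^bsub>Z'\<^esub> t y)" using t xy by (simp add: T linear_maps_def)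
    also have "\<dots> = T (p x) \<oplus>\<^bsub>B\<^esub> T (p y)" using q xy tz by (simp add: T linear_maps_def)
    finally show ?thesis .
  qed
  moreover have "T (r \<odot>\<^bsub>A\<^esub> p x) = r \<odot>\<^bsub>B\<^esub> T (p x)" if rx: "r \<in> carrier R" "x \<in> carrier Z" for r x
  proof -
    have "T (r \<odot>\<^bsub>A\<^esub> p x) = T (p (r \<odot>\<^bsub>Z\<^esub> x))" using p(1) rx by (simp add: linear_maps_def)
    also have "\<dots> = q (r \<odot>\<^bsub>Z'\<^esub> t x)" using t rx by (simp add: T linear_maps_def Z.smult_closed)
    also have "\<dots> = r \<odot>\<^bsub>B\<^esub> T (p x)" using q rx tz by (simp add: T linear_maps_def)
    finally show ?thesis .
  qed
  moreover have "T (p x) \<in> carrier B" if "x \<in> carrier Z" for x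
    using q tz[OF that] that by (auto simp: T linear_maps_def)
  ultimately show ?thesis unfolding linear_maps_def using p(2)[symmetric] by auto
qed

lemma linear_maps_id: "(\<lambda>x. x) \<in> linear_maps R Z Z"
  by (simp add: linear_maps_def)

text \<open>The common source of the three modules: here the module axioms hold pointwise.\<close>

definition Z2_module ::
  "('a, 'i, 'z) wpquandle_scheme \<Rightarrow> ('i \<Rightarrow> ('r, 'l) module) \<Rightarrow> ('r, 'a \<times> 'a \<Rightarrow> 'l) module" where
  "Z2_module W M = \<lparr>carrier = Z2 W (coeff_groups M), monoid.mult = undefined, one = undefined,
     zero = one_cochain W (coeff_groups M), add = mult_cochain W (coeff_groups M),
     smult = \<lambda>r. push_cochain W (\<lambda>i. smult (M i) r)\<rparr>"

context wp_modules
begin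

lemma coeff_map_smult:
  assumes "r \<in> carrier R"
  shows "coeff_map W (coeff_groups M) (coeff_groups M) (\<lambda>i. smult (M i) r)"
  by (intro coeff_map.intro wp_coeffs_axioms coeff_map_axioms.intro)
    (use assms left_module.smult_closed[OF modules] left_module.smult_r_distr[OF modules]
      in \<open>auto simp: graded_hom_def hom_def\<close>)

lemma coeff_map_neg: "coeff_map W (coeff_groups M) (coeff_groups M) (\<lambda>i. a_inv (M i))"
proof (intro coeff_map.intro wp_coeffs_axioms coeff_map_axioms.intro)
  have "abelian_group (M i)" if "i \<in> Ind W" for i using modules[OF that] by (simp add: left_module_def)
  then show "(\<lambda>i. a_inv (M i)) \<in> graded_hom (Ind W) (coeff_groups M) (coeff_groups M)"
    by (simp add: graded_hom_def hom_def abelian_group.a_inv_closed abelian_group.minus_add)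
qed

lemma Z2_eqI:
  assumes "f \<in> Z2 W (coeff_groups M)" "f' \<in> Z2 W (coeff_groups M)"
    and "\<And>a b. a \<in> carrier W \<Longrightarrow> b \<in> carrier W \<Longrightarrow> f (a, b) = f' (a, b)"
  shows "f = f'"
  using assms by (intro cochains2_eqI Z2_cochain)

lemma left_module_Z2: "left_module R (Z2_module W M)"
proof (intro left_module.intro R.ring_axioms)
  note [simp] = Z2_module_def
  note ops = Z2_mult Z2_one coeff_map.Z2_push[OF coeff_map_smult] coeff_map.Z2_push[OF coeff_map_neg]
  have cl: "f (a, b) \<in> carrier (M (grade W a))" if "f \<in> Z2 W (coeff_groups M)" "a \<in> carrier W" "b \<in> carrier W" for f a b
    using Z2_closed[OF that] by simp
  have ab: "abelian_group (M (grade W a))" if "a \<in> carrier W" for a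
    using modules[OF grade_Ind[OF that]] by (simp add: left_module_def)
  note lm = modules[OF grade_Ind]
  show "abelian_group (Z2_module W M)"
  proof (rule abelian_groupI)
    fix f assume "f \<in> carrier (Z2_module W M)"
    then have f: "f \<in> Z2 W (coeff_groups M)" by simp
    show "\<zero>\<^bsub>Z2_module W M\<^esub> \<oplus>\<^bsub>Z2_module W M\<^esub> f = f"
      by (simp, rule Z2_eqI) (use f ops cl abelian_monoid.l_zero[OF abelian_group.axioms(1)[OF ab]] in simp_all)
    have "mult_cochain W (coeff_groups M) (push_cochain W (\<lambda>i. a_inv (M i)) f) f = one_cochain W (coeff_groups M)"
      by (rule Z2_eqI) (use f ops cl abelian_group.l_neg[OF ab] in simp_all)
    then show "\<exists>g\<in>carrier (Z2_module W M). g \<oplus>\<^bsub>Z2_module W M\<^esub> f = \<zero>\<^bsub>Z2_module W M\<^esub>"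
      using ops(4)[OF f] by auto
    fix g assume "g \<in> carrier (Z2_module W M)"
    then have g: "g \<in> Z2 W (coeff_groups M)" by simp
    show "f \<oplus>\<^bsub>Z2_module W M\<^esub> g \<in> carrier (Z2_module W M)" using f g by (simp add: ops)
    show "f \<oplus>\<^bsub>Z2_module W M\<^esub> g = g \<oplus>\<^bsub>Z2_module W M\<^esub> f"
      by (simp, rule Z2_eqI) (use f g ops cl abelian_monoid.a_comm[OF abelian_group.axioms(1)[OF ab]] in simp_all)
    fix h assume "h \<in> carrier (Z2_module W M)"
    then have h: "h \<in> Z2 W (coeff_groups M)" by simp
    show "f \<oplus>\<^bsub>Z2_module W M\<^esub> g \<oplus>\<^bsub>Z2_module W M\<^esub> h = f \<oplus>\<^bsub>Z2_module W M\<^esub> (g \<oplus>\<^bsub>Z2_module W M\<^esub> h)"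
      by (simp, rule Z2_eqI) (use f g h ops cl abelian_monoid.a_assoc[OF abelian_group.axioms(1)[OF ab]] in simp_all)
  qed (simp add: ops)
  show "left_module_axioms R (Z2_module W M)"
  proof (rule left_module_axioms.intro)
    fix f assume "f \<in> carrier (Z2_module W M)"
    then have f: "f \<in> Z2 W (coeff_groups M)" by simp
    show "\<one>\<^bsub>R\<^esub> \<odot>\<^bsub>Z2_module W M\<^esub> f = f"
      by (simp, rule Z2_eqI) (use f ops cl left_module.smult_one[OF lm] in simp_all)
    fix r assume r: "r \<in> carrier R"
    show "r \<odot>\<^bsub>Z2_module W M\<^esub> f \<in> carrier (Z2_module W M)" using r f by (simp add: ops)
    show "r \<odot>\<^bsub>Z2_module W M\<^esub> (f \<oplus>\<^bsub>Z2_module W M\<^esub> g)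
        = r \<odot>\<^bsub>Z2_module W M\<^esub> f \<oplus>\<^bsub>Z2_module W M\<^esub> r \<odot>\<^bsub>Z2_module W M\<^esub> g"
      if "g \<in> carrier (Z2_module W M)" for g
    proof -
      have g: "g \<in> Z2 W (coeff_groups M)" using that by simp
      show ?thesis
        by (simp, rule Z2_eqI) (use r f g ops cl left_module.smult_r_distr[OF lm] in simp_all)
    qed
    fix s assume s: "s \<in> carrier R"
    show "(r \<oplus>\<^bsub>R\<^esub> s) \<odot>\<^bsub>Z2_module W M\<^esub> f
        = r \<odot>\<^bsub>Z2_module W M\<^esub> f \<oplus>\<^bsub>Z2_module W M\<^esub> s \<odot>\<^bsub>Z2_module W M\<^esub> f"
      by (simp, rule Z2_eqI) (use r s f ops cl left_module.smult_l_distr[OF lm] in simp_all)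
    show "(r \<otimes>\<^bsub>R\<^esub> s) \<odot>\<^bsub>Z2_module W M\<^esub> f = r \<odot>\<^bsub>Z2_module W M\<^esub> (s \<odot>\<^bsub>Z2_module W M\<^esub> f)"
      by (simp, rule Z2_eqI) (use r s f ops cl left_module.smult_assoc[OF lm] in simp_all)
  qed
qed

lemma
  shows linear_coh_class: "coh_class W (coeff_groups M) \<in> linear_maps R (Z2_module W M) (H2_module W M)"
    and coh_class_surj: "coh_class W (coeff_groups M) ` carrier (Z2_module W M) = carrier (H2_module W M)"
    and coh_class_zero: "coh_class W (coeff_groups M) \<zero>\<^bsub>Z2_module W M\<^esub> = \<zero>\<^bsub>H2_module W M\<^esub>"
proof -
  have add: "add (H2_module W M) C D = cohom_rel W (coeff_groups M) ``
       {mult_cochain W (coeff_groups M) f f' | f f'. f \<in> C \<and> f' \<in> D}" for C D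
    by (simp add: H2_module_def mult_cochain_def)
  show "coh_class W (coeff_groups M) \<in> linear_maps R (Z2_module W M) (H2_module W M)"
    unfolding linear_maps_def mem_Collect_eq add
    by (simp add: Z2_module_def product_coh_class)
      (auto simp: H2_module_def H2_iff coeff_map.H2_push_coh_class[OF coeff_map_smult])
  show "coh_class W (coeff_groups M) ` carrier (Z2_module W M) = carrier (H2_module W M)"
    by (auto simp: Z2_module_def H2_module_def H2_iff)
  show "coh_class W (coeff_groups M) \<zero>\<^bsub>Z2_module W M\<^esub> = \<zero>\<^bsub>H2_module W M\<^esub>"
    by (simp add: Z2_module_def H2_module_def coh_class_def one_cochain_def)
qed

lemma
  shows linear_ext_class: "ext_class W (coeff_groups M) \<in> linear_maps R (Z2_module W M) (Ext_module W M)"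
    and ext_class_surj: "ext_class W (coeff_groups M) ` carrier (Z2_module W M) = carrier (Ext_module W M)"
    and ext_class_zero: "ext_class W (coeff_groups M) \<zero>\<^bsub>Z2_module W M\<^esub> = \<zero>\<^bsub>Ext_module W M\<^esub>"
proof -
  show "ext_class W (coeff_groups M) \<in> linear_maps R (Z2_module W M) (Ext_module W M)"
    using Ext_iff
    by (auto simp: linear_maps_def Z2_module_def Ext_module_def baer_sum_ext_class
        coeff_map.ext_push_ext_class[OF coeff_map_smult])
  show "ext_class W (coeff_groups M) ` carrier (Z2_module W M) = carrier (Ext_module W M)"
    by (simp add: Z2_module_def Ext_module_def Ext_image)
  show "ext_class W (coeff_groups M) \<zero>\<^bsub>Z2_module W M\<^esub> = \<zero>\<^bsub>Ext_module W M\<^esub>"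
    by (simp add: Z2_module_def Ext_module_def trivial_ext_class)
qed

lemma
  shows linear_loop_holonomy: "loop_holonomy W (coeff_groups M) \<in> linear_maps R (Z2_module W M) (Hom_module W M)"
    and loop_holonomy_image: "loop_holonomy W (coeff_groups M) ` carrier (Z2_module W M) = carrier (Hom_module W M)"
    and loop_holonomy_zero: "loop_holonomy W (coeff_groups M) \<zero>\<^bsub>Z2_module W M\<^esub> = \<zero>\<^bsub>Hom_module W M\<^esub>"
proof -
  show "loop_holonomy W (coeff_groups M) \<in> linear_maps R (Z2_module W M) (Hom_module W M)"
    by (auto simp: linear_maps_def Z2_module_def Hom_module_def loop_holonomy_mult loop_holonomy_Hom
        coeff_map.loop_holonomy_push[OF coeff_map_smult])
  show "loop_holonomy W (coeff_groups M) ` carrier (Z2_module W M) = carrier (Hom_module W M)"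
    using loop_holonomy_surj loop_holonomy_Hom by (auto simp: Z2_module_def Hom_module_def image_iff)
  show "loop_holonomy W (coeff_groups M) \<zero>\<^bsub>Z2_module W M\<^esub> = \<zero>\<^bsub>Hom_module W M\<^esub>"
  proof (rule ext, rule ext)
    fix i g
    consider "i \<notin> Ind W" | "i \<in> Ind W" "g \<notin> carrier (pi1 W (base W i))"
      | w where "i \<in> Ind W" "w \<in> loops W (base W i)" "g = adj_class W w"
      by (auto simp: carrier_pi1 base_closed)
    then show "loop_holonomy W (coeff_groups M) \<zero>\<^bsub>Z2_module W M\<^esub> i g = \<zero>\<^bsub>Hom_module W M\<^esub> i g"
    proof cases
      case (3 w)
      have "w \<in> words W" using 3(2) by (simp add: loops_def)
      moreover have "g \<in> carrier (pi1 W (base W i))" using 3 by (simp add: carrier_pi1 base_closed)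
      ultimately show ?thesis
        using 3(1) loop_holonomy_class[OF Z2_one 3(1,2)] holonomy_one[OF base_closed[OF 3(1)]]
        by (simp add: Z2_module_def Hom_module_def 3(3))
    qed (simp_all add: loop_holonomy_def Hom_module_def)
  qed
qed

lemma left_module_H2: "left_module R (H2_module W M)"
  by (rule left_module_image) (rule left_module_Z2 linear_coh_class coh_class_surj coh_class_zero)+

lemma left_module_Ext: "left_module R (Ext_module W M)"
  by (rule left_module_image) (rule left_module_Z2 linear_ext_class ext_class_surj ext_class_zero)+

lemma left_module_Hom: "left_module R (Hom_module W M)"
  by (rule left_module_image) (rule left_module_Z2 linear_loop_holonomy loop_holonomy_image loop_holonomy_zero)+

lemma cocycle_class_iso: "cocycle_class W (coeff_groups M) \<in> module_isos R (Ext_module W M) (H2_module W M)"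
  unfolding module_isos_def mem_Collect_eq
proof
  show "cocycle_class W (coeff_groups M) \<in> linear_maps R (Ext_module W M) (H2_module W M)"
    by (rule linear_maps_on_images[OF left_module_Z2 linear_ext_class ext_class_surj linear_coh_class linear_maps_id])
      (simp add: Z2_module_def cocycle_class_ext_class)
  show "bij_betw (cocycle_class W (coeff_groups M)) (carrier (Ext_module W M)) (carrier (H2_module W M))"
    using bij_cocycle_class by (simp add: Ext_module_def H2_module_def)
qed

lemma monodromy_hom_iso: "monodromy_hom W (coeff_groups M) \<in> module_isos R (Ext_module W M) (Hom_module W M)"
  unfolding module_isos_def mem_Collect_eq
proof
  show "monodromy_hom W (coeff_groups M) \<in> linear_maps R (Ext_module W M) (Hom_module W M)"
    by (rule linear_maps_on_images[OF left_module_Z2 linear_ext_class ext_class_surj linear_loop_holonomy linear_maps_id])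
      (simp add: Z2_module_def monodromy_hom_ext_class)
  show "bij_betw (monodromy_hom W (coeff_groups M)) (carrier (Ext_module W M)) (carrier (Hom_module W M))"
    using bij_monodromy_hom by (simp add: Ext_module_def Hom_module_def)
qed

end

locale wp_modules_map = wp_modules W R M + N: wp_modules W R N
  for W :: "('a, 'i, 'z) wpquandle_scheme" (structure) and R :: "('r, 's) ring_scheme"
    and M :: "'i \<Rightarrow> ('r, 'l) module" and N :: "'i \<Rightarrow> ('r, 'm) module" +
  fixes \<psi> :: "'i \<Rightarrow> 'l \<Rightarrow> 'm"
  assumes linear: "i \<in> Ind W \<Longrightarrow> \<psi> i \<in> linear_maps R (M i) (N i)"
begin

sublocale c: coeff_map W "coeff_groups M" "coeff_groups N" \<psi>
  by (intro coeff_map.intro wp_coeffs_axioms N.wp_coeffs_axioms coeff_map_axioms.intro)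
    (use linear in \<open>auto simp: graded_hom_def hom_def linear_maps_def\<close>)

lemma linear_push: "push_cochain W \<psi> \<in> linear_maps R (Z2_module W M) (Z2_module W N)"
proof -
  note eq = N.Z2_eqI[OF c.Z2_push]
  have cl: "f (a, b) \<in> carrier (M (grade W a))" if "f \<in> Z2 W (coeff_groups M)" "a \<in> carrier W" "b \<in> carrier W" for f a b
    using Z2_closed[OF that] by simp
  have "push_cochain W \<psi> (mult_cochain W (coeff_groups M) f g)
      = mult_cochain W (coeff_groups N) (push_cochain W \<psi> f) (push_cochain W \<psi> g)"
    if "f \<in> Z2 W (coeff_groups M)" "g \<in> Z2 W (coeff_groups M)" for f g
    by (rule eq) (use that linear grade_Ind cl in \<open>simp_all add: Z2_mult N.Z2_mult c.Z2_push linear_maps_def\<close>)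
  moreover have "push_cochain W \<psi> (push_cochain W (\<lambda>i. smult (M i) r) f)
      = push_cochain W (\<lambda>i. smult (N i) r) (push_cochain W \<psi> f)"
    if "r \<in> carrier R" "f \<in> Z2 W (coeff_groups M)" for r f
    by (rule eq) (use that linear grade_Ind cl coeff_map.Z2_push[OF coeff_map_smult] coeff_map.Z2_push[OF N.coeff_map_smult]
        in \<open>simp_all add: c.Z2_push linear_maps_def\<close>)
  ultimately show ?thesis by (simp add: linear_maps_def Z2_module_def c.Z2_push)
qed

lemma linear_H2_push: "H2_push W (coeff_groups N) \<psi> \<in> linear_maps R (H2_module W M) (H2_module W N)"
  by (rule linear_maps_on_images[OF left_module_Z2 linear_coh_class coh_class_surj N.linear_coh_class linear_push])
    (simp add: Z2_module_def c.H2_push_coh_class)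

lemma linear_ext_push:
  "ext_push W (coeff_groups M) (coeff_groups N) \<psi> \<in> linear_maps R (Ext_module W M) (Ext_module W N)"
  by (rule linear_maps_on_images[OF left_module_Z2 linear_ext_class ext_class_surj N.linear_ext_class linear_push])
    (simp add: Z2_module_def c.ext_push_ext_class)

lemma linear_hom_push: "hom_push W \<psi> \<in> linear_maps R (Hom_module W M) (Hom_module W N)"
  by (rule linear_maps_on_images[OF left_module_Z2 linear_loop_holonomy loop_holonomy_image N.linear_loop_holonomy linear_push])
    (simp add: Z2_module_def c.loop_holonomy_push)

lemma monodromy_hom_push:
  assumes "\<xi> \<in> Ext W (coeff_groups M)"
  shows "monodromy_hom W (coeff_groups N) (ext_push W (coeff_groups M) (coeff_groups N) \<psi> \<xi>)
    = hom_push W \<psi> (monodromy_hom W (coeff_groups M) \<xi>)"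
  using assms by (auto simp: Ext_iff c.ext_push_ext_class monodromy_hom_ext_class N.monodromy_hom_ext_class
      c.Z2_push c.loop_holonomy_push)

end

locale wp_modules_pull = wp_map V W \<phi> + M: wp_modules W R M
  for V :: "('a, 'i, 'y) wpquandle_scheme" and W :: "('b, 'i, 'z) wpquandle_scheme"
    and \<phi> :: "'a \<Rightarrow> 'b" and R :: "('r, 's) ring_scheme" and M :: "'i \<Rightarrow> ('r, 'l) module"
begin

sublocale P: coeff_pull V W \<phi> "coeff_groups M"
  by (intro coeff_pull.intro wp_map_axioms M.wp_coeffs_axioms)

sublocale N: wp_modules V R M
  by (intro wp_modules.intro wp_modules_axioms.intro V.well_pointed_axioms M.R.ring_axioms)
    (simp add: Ind_eq M.modules)

lemma linear_pull: "pull_cochain V \<phi> \<in> linear_maps R (Z2_module W M) (Z2_module V M)"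
proof -
  note Zp = Z2_pull[OF M.wp_coeffs_axioms]
  note eq = N.Z2_eqI[OF Zp]
  have "pull_cochain V \<phi> (mult_cochain W (coeff_groups M) f g)
      = mult_cochain V (coeff_groups M) (pull_cochain V \<phi> f) (pull_cochain V \<phi> g)"
    if "f \<in> Z2 W (coeff_groups M)" "g \<in> Z2 W (coeff_groups M)" for f g
    by (rule eq) (use that in \<open>simp_all add: M.Z2_mult N.Z2_mult Zp\<close>)
  moreover have "pull_cochain V \<phi> (push_cochain W (\<lambda>i. smult (M i) r) f)
      = push_cochain V (\<lambda>i. smult (M i) r) (pull_cochain V \<phi> f)"
    if "r \<in> carrier R" "f \<in> Z2 W (coeff_groups M)" for r f
    by (rule eq) (use that coeff_map.Z2_push[OF M.coeff_map_smult] coeff_map.Z2_push[OF N.coeff_map_smult]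
        in \<open>simp_all add: Zp\<close>)
  ultimately show ?thesis by (simp add: linear_maps_def Z2_module_def Zp)
qed

lemma linear_H2_pull: "H2_pull V (coeff_groups M) \<phi> \<in> linear_maps R (H2_module W M) (H2_module V M)"
  by (rule linear_maps_on_images[OF M.left_module_Z2 M.linear_coh_class M.coh_class_surj N.linear_coh_class linear_pull])
    (simp add: Z2_module_def P.H2_pull_coh_class)

lemma linear_ext_pull: "ext_pull V (coeff_groups M) \<phi> \<in> linear_maps R (Ext_module W M) (Ext_module V M)"
  by (rule linear_maps_on_images[OF M.left_module_Z2 M.linear_ext_class M.ext_class_surj N.linear_ext_class linear_pull])
    (simp add: Z2_module_def P.ext_pull_ext_class)

lemma linear_hom_pull: "hom_pull V W \<phi> \<in> linear_maps R (Hom_module W M) (Hom_module V M)"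
  by (rule linear_maps_on_images[OF M.left_module_Z2 M.linear_loop_holonomy M.loop_holonomy_image
        N.linear_loop_holonomy linear_pull])
    (simp add: Z2_module_def P.loop_holonomy_pull)

lemma monodromy_hom_pull:
  assumes "\<xi> \<in> Ext W (coeff_groups M)"
  shows "monodromy_hom V (coeff_groups M) (ext_pull V (coeff_groups M) \<phi> \<xi>)
    = hom_pull V W \<phi> (monodromy_hom W (coeff_groups M) \<xi>)"
  using assms by (auto simp: M.Ext_iff P.ext_pull_ext_class M.monodromy_hom_ext_class N.monodromy_hom_ext_class
      Z2_pull[OF M.wp_coeffs_axioms] P.loop_holonomy_pull)

end

theorem corollary9p8:
  fixes W :: "('a, 'i) wpquandle"
    and \<Lambda> :: "'i \<Rightarrow> 'l monoid"
  assumes "well_pointed W" and "graded_group (Ind W) \<Lambda>"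
  shows
    \<comment> \<open>bijections\<close>
    "bij_betw (cocycle_class W \<Lambda>) (Ext W \<Lambda>) (H2 W \<Lambda>) \<and>
     bij_betw (monodromy_class W \<Lambda>) (Ext W \<Lambda>) (HomC W \<Lambda>) \<and>
     ((\<forall>i\<in>Ind W. comm_group (\<Lambda> i)) \<longrightarrow>
        (\<forall>\<xi>\<in>Ext W \<Lambda>. monodromy_class W \<Lambda> \<xi> = {monodromy_hom W \<Lambda> \<xi>}) \<and>
        bij_betw (monodromy_hom W \<Lambda>) (Ext W \<Lambda>) (Hom W \<Lambda>)) \<and>
     \<comment> \<open>all three sets are products of their graded parts, and the bijections are graded\<close>
     bij_betw (\<lambda>C. \<lambda>i\<in>Ind W. H2_push W (grade_part \<Lambda> i) (grade_proj \<Lambda> i) C)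
       (H2 W \<Lambda>) (\<Pi>\<^sub>E i\<in>Ind W. H2 W (grade_part \<Lambda> i)) \<and>
     bij_betw (\<lambda>\<xi>. \<lambda>i\<in>Ind W. ext_push W \<Lambda> (grade_part \<Lambda> i) (grade_proj \<Lambda> i) \<xi>)
       (Ext W \<Lambda>) (\<Pi>\<^sub>E i\<in>Ind W. Ext W (grade_part \<Lambda> i)) \<and>
     bij_betw (\<lambda>C. \<lambda>i\<in>Ind W. HomC_push W (grade_part \<Lambda> i) (grade_proj \<Lambda> i) C)
       (HomC W \<Lambda>) (\<Pi>\<^sub>E i\<in>Ind W. HomC W (grade_part \<Lambda> i)) \<and>
     (\<forall>\<xi>\<in>Ext W \<Lambda>. \<forall>i\<in>Ind W.
        cocycle_class W (grade_part \<Lambda> i) (ext_push W \<Lambda> (grade_part \<Lambda> i) (grade_proj \<Lambda> i) \<xi>)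
          = H2_push W (grade_part \<Lambda> i) (grade_proj \<Lambda> i) (cocycle_class W \<Lambda> \<xi>) \<and>
        monodromy_class W (grade_part \<Lambda> i) (ext_push W \<Lambda> (grade_part \<Lambda> i) (grade_proj \<Lambda> i) \<xi>)
          = HomC_push W (grade_part \<Lambda> i) (grade_proj \<Lambda> i) (monodromy_class W \<Lambda> \<xi>)) \<and>
     \<comment> \<open>naturality in the coefficients\<close>
     (\<forall>(\<Lambda>' :: 'i \<Rightarrow> 'm monoid) \<psi>.
        graded_group (Ind W) \<Lambda>' \<and> \<psi> \<in> graded_hom (Ind W) \<Lambda> \<Lambda>' \<longrightarrow>
        (\<forall>\<xi>\<in>Ext W \<Lambda>.
           ext_push W \<Lambda> \<Lambda>' \<psi> \<xi> \<in> Ext W \<Lambda>' \<and>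
           cocycle_class W \<Lambda>' (ext_push W \<Lambda> \<Lambda>' \<psi> \<xi>) = H2_push W \<Lambda>' \<psi> (cocycle_class W \<Lambda> \<xi>) \<and>
           monodromy_class W \<Lambda>' (ext_push W \<Lambda> \<Lambda>' \<psi> \<xi>)
             = HomC_push W \<Lambda>' \<psi> (monodromy_class W \<Lambda> \<xi>))) \<and>
     \<comment> \<open>naturality in the well-pointed quandle\<close>
     (\<forall>(V :: ('b, 'i) wpquandle) \<phi>.
        well_pointed V \<and> \<phi> \<in> wp_hom V W \<longrightarrow>
        (\<forall>\<xi>\<in>Ext W \<Lambda>.
           ext_pull V \<Lambda> \<phi> \<xi> \<in> Ext V \<Lambda> \<and>
           cocycle_class V \<Lambda> (ext_pull V \<Lambda> \<phi> \<xi>) = H2_pull V \<Lambda> \<phi> (cocycle_class W \<Lambda> \<xi>) \<and>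
           monodromy_class V \<Lambda> (ext_pull V \<Lambda> \<phi> \<xi>)
             = HomC_pull V W \<Lambda> \<phi> (monodromy_class W \<Lambda> \<xi>))) \<and>
     \<comment> \<open>module coefficients\<close>
     (\<forall>(R :: 'r ring) (M :: 'i \<Rightarrow> ('r, 'l) module).
        ring R \<and> (\<forall>i\<in>Ind W. left_module R (M i)) \<longrightarrow>
        left_module R (H2_module W M) \<and>
        left_module R (Ext_module W M) \<and>
        left_module R (Hom_module W M) \<and>
        cocycle_class W (coeff_groups M) \<in> module_isos R (Ext_module W M) (H2_module W M) \<and>
        monodromy_hom W (coeff_groups M) \<in> module_isos R (Ext_module W M) (Hom_module W M) \<and>
        (\<forall>(N :: 'i \<Rightarrow> ('r, 'm) module) \<psi>.
           (\<forall>i\<in>Ind W. left_module R (N i) \<and> \<psi> i \<in> linear_maps R (M i) (N i)) \<longrightarrow>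
           H2_push W (coeff_groups N) \<psi> \<in> linear_maps R (H2_module W M) (H2_module W N) \<and>
           ext_push W (coeff_groups M) (coeff_groups N) \<psi> \<in> linear_maps R (Ext_module W M) (Ext_module W N) \<and>
           hom_push W \<psi> \<in> linear_maps R (Hom_module W M) (Hom_module W N) \<and>
           (\<forall>\<xi>\<in>Ext W (coeff_groups M). monodromy_hom W (coeff_groups N) (ext_push W (coeff_groups M) (coeff_groups N) \<psi> \<xi>)
              = hom_push W \<psi> (monodromy_hom W (coeff_groups M) \<xi>))) \<and>
        (\<forall>(V :: ('b, 'i) wpquandle) \<phi>.
           well_pointed V \<and> \<phi> \<in> wp_hom V W \<longrightarrow>
           H2_pull V (coeff_groups M) \<phi> \<in> linear_maps R (H2_module W M) (H2_module V M) \<and>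
           ext_pull V (coeff_groups M) \<phi> \<in> linear_maps R (Ext_module W M) (Ext_module V M) \<and>
           hom_pull V W \<phi> \<in> linear_maps R (Hom_module W M) (Hom_module V M) \<and>
           (\<forall>\<xi>\<in>Ext W (coeff_groups M). monodromy_hom V (coeff_groups M) (ext_pull V (coeff_groups M) \<phi> \<xi>)
              = hom_pull V W \<phi> (monodromy_hom W (coeff_groups M) \<xi>))))"
proof -
  interpret C: wp_coeffs W \<Lambda>
    using assms by (simp add: wp_coeffs_def wp_coeffs_axioms_def)
  have abelian: "(\<forall>i\<in>Ind W. comm_group (\<Lambda> i)) \<longrightarrow>
      (\<forall>\<xi>\<in>Ext W \<Lambda>. monodromy_class W \<Lambda> \<xi> = {monodromy_hom W \<Lambda> \<xi>}) \<and>
      bij_betw (monodromy_hom W \<Lambda>) (Ext W \<Lambda>) (Hom W \<Lambda>)"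
  proof
    assume "\<forall>i\<in>Ind W. comm_group (\<Lambda> i)"
    then interpret A: wp_comm_coeffs W \<Lambda>
      by (intro wp_comm_coeffs.intro C.wp_coeffs_axioms wp_comm_coeffs_axioms.intro) simp
    show "(\<forall>\<xi>\<in>Ext W \<Lambda>. monodromy_class W \<Lambda> \<xi> = {monodromy_hom W \<Lambda> \<xi>}) \<and>
        bij_betw (monodromy_hom W \<Lambda>) (Ext W \<Lambda>) (Hom W \<Lambda>)"
      using A.monodromy_class_singleton A.bij_monodromy_hom by blast
  qed
  have push: "coeff_map W \<Lambda> \<Lambda>' \<psi>"
    if "graded_group (Ind W) \<Lambda>' \<and> \<psi> \<in> graded_hom (Ind W) \<Lambda> \<Lambda>'" for \<Lambda>' :: "'i \<Rightarrow> 'm monoid" and \<psi>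
    using that assms(1) by (intro coeff_map.intro C.wp_coeffs_axioms coeff_map_axioms.intro wp_coeffs.intro
        wp_coeffs_axioms.intro) simp_all
  have map: "wp_map V W \<phi>" if "well_pointed V \<and> \<phi> \<in> wp_hom V W" for V :: "('b, 'i) wpquandle" and \<phi>
    using that assms(1) by (intro wp_map.intro wp_map_axioms.intro) simp_all
  have pull: "coeff_pull V W \<phi> \<Lambda>" if "well_pointed V \<and> \<phi> \<in> wp_hom V W" for V :: "('b, 'i) wpquandle" and \<phi>
    by (intro coeff_pull.intro map[OF that] C.wp_coeffs_axioms)
  show ?thesis
  proof (intro conjI, goal_cases)
    case 1 show ?case by (rule C.bij_cocycle_class)
  next
    case 2 show ?case by (rule C.bij_monodromy_class)
  next
    case 3 show ?case by (rule abelian)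
  next
    case 4 show ?case by (rule C.H2_graded)
  next
    case 5 show ?case by (rule C.Ext_graded)
  next
    case 6 show ?case by (rule C.HomC_graded)
  next
    case 7 show ?case using coeff_map.naturality_push[OF C.coeff_map_grade] by blast
  next
    case 8 show ?case using coeff_map.naturality_push[OF push] by blast
  next
    case 9 show ?case using coeff_pull.naturality_pull[OF pull] by blast
  next
    case 10 show ?case
    proof (intro allI impI, goal_cases)
      case (1 R M)
      interpret M: wp_modules W R M
        using 1 assms(1) by (simp add: wp_modules_def wp_modules_axioms_def)
      have mods: "wp_modules_map W R M N \<psi>"
        if "\<forall>i\<in>Ind W. left_module R (N i) \<and> \<psi> i \<in> linear_maps R (M i) (N i)"
        for N :: "'i \<Rightarrow> ('r, 'm) module" and \<psi>
        using that 1 assms(1)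
        by (simp add: wp_modules_map_def wp_modules_map_axioms_def wp_modules_def wp_modules_axioms_def)
      have pulls: "wp_modules_pull V W \<phi> R M" if "well_pointed V \<and> \<phi> \<in> wp_hom V W"
        for V :: "('b, 'i) wpquandle" and \<phi>
        by (intro wp_modules_pull.intro map[OF that] M.wp_modules_axioms)
      show ?case
        by (intro conjI allI impI ballI M.left_module_H2 M.left_module_Ext M.left_module_Hom M.cocycle_class_iso
            M.monodromy_hom_iso wp_modules_map.linear_H2_push[OF mods] wp_modules_map.linear_ext_push[OF mods]
            wp_modules_map.linear_hom_push[OF mods] wp_modules_map.monodromy_hom_push[OF mods]
            wp_modules_pull.linear_H2_pull[OF pulls] wp_modules_pull.linear_ext_pull[OF pulls]
            wp_modules_pull.linear_hom_pull[OF pulls] wp_modules_pull.monodromy_hom_pull[OF pulls]) auto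
    qed
  qed
qed

end
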